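(* Let $\Lambda$ be a lattice in $\mathbb{C}$. The following assertions hold true. (1) If $\Lambda$ is not isogenous to $\overline{\Lambda}$, then the only weakly bialgebraic sets for $\mathcal{P}_\Lambda$ are singletons. (2) Suppose that $\Lambda$ is not CM and $\Lambda$ is isogenous to $\overline{\Lambda}$. Let $\gamma \in \mathbb{C}$ be such that $\mathrm{Isog}(\Lambda, \overline{\Lambda})=\mathbb{Z} \cdot \gamma$. (a) If $|\gamma| \notin \mathbb{Q}$, then the only weakly bialgebraic sets for $\mathcal{P}_\Lambda$ are singletons. (b) If $|\gamma| \in \mathbb{Q}$, then the weakly bialgebraic sets for $\mathcal{P}_\Lambda$ are exactly the singletons and the translates of the lines $$L_1=\{(x, y) \in \mathbb{R}^2 \mid \sqrt{\gamma}(x+iy) \in \mathbb{R}\} \quad\text{and}\quad L_2=\{(x, y) \in \mathbb{R}^2 \mid \sqrt{\gamma}(x+iy) \in i\mathbb{R}\}$$ (for either choice of square root $\sqrt{\gamma}$). (3) If $\Lambda$ is CM, then the weakly bialgebraic sets for $\mathcal{P}_\Lambda$ are exactly the singletons and the translates of the lines through the origin in $\mathbb{R}^2$ containing a non-zero point of $\Lambda$.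
   Context: Identify $\mathbb{R}^2$ with $\mathbb{C}$ via $(x,y)\mapsto x+iy$. For a lattice $\Lambda\subset\mathbb{C}$ let $\wp_\Lambda$ be its Weierstrass $\wp$-function and define $\mathcal{P}_\Lambda:\mathbb{R}^2\smallsetminus\Lambda\to\mathbb{R}^2$, $(x,y)\mapsto(\mathrm{Re}\,\wp_\Lambda(x+iy),\mathrm{Im}\,\wp_\Lambda(x+iy))$. A non-empty subset $\mathcal{V}\subsetneq\mathbb{R}^2$ is called weakly bialgebraic for $\mathcal{P}_\Lambda$ if (i) there exist algebraic subvarieties $V\subset\mathbb{A}^2_\mathbb{R}$ and $W\subsetneq\mathbb{A}^2_\mathbb{R}$ (closed, possibly reducible) with $\mathcal{V}=V(\mathbb{R})$ and $\mathcal{P}_\Lambda(\mathcal{V}\cap(\mathbb{R}^2\smallsetminus\Lambda))\subset W(\mathbb{R})$; and (ii) $\mathcal{V}$ cannot be written as $V_1(\mathbb{R})\cup V_2(\mathbb{R})$ with $V_1,V_2\subset\mathbb{A}^2_\mathbb{R}$ algebraic subvarieties and both inclusions $V_i(\mathbb{R})\subset\mathcal{V}$ proper. For lattices $\Lambda_1,\Lambda_2\subset\mathbb{C}$, $\mathrm{Isog}(\Lambda_1,\Lambda_2)=\{\alpha\in\mathbb{C}:\alpha\Lambda_1\subset\Lambda_2\}$ (a free abelian group of rank at most 2); $\Lambda_1$ is isogenous to $\Lambda_2$ if this group is non-zero; $\Lambda$ is CM if $\mathrm{Isog}(\Lambda,\Lambda)$ has rank two. $\overline{\Lambda}$ is the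 complex conjugate lattice. *)

theory Defs
  imports "HOL-Analysis.Analysis" "HOL-Computational_Algebra.Polynomial"
begin

definition lattice_gen :: "complex \<Rightarrow> complex \<Rightarrow> complex set" where
  "lattice_gen w1 w2 = {of_int m * w1 + of_int n * w2 | m n :: int. True}"

definition is_lattice :: "complex set \<Rightarrow> bool" where
  "is_lattice L \<longleftrightarrow> (\<exists>w1 w2. w1 \<noteq> 0 \<and> Im (w2 / w1) \<noteq> 0 \<and> L = lattice_gen w1 w2)"

text \<open>Weierstrass wp-function of a lattice (meaningful off the lattice).\<close>
definition wp :: "complex set \<Rightarrow> complex \<Rightarrow> complex" where
  "wp L z = 1 / z^2 + infsum (\<lambda>w. 1 / (z - w)^2 - 1 / w^2) (L - {0})"

definition wpP :: "complex set \<Rightarrow> real \<times> real \<Rightarrow> real \<times> real" where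
  "wpP L xy = (Re (wp L (Complex (fst xy) (snd xy))), Im (wp L (Complex (fst xy) (snd xy))))"

definition Isog :: "complex set \<Rightarrow> complex set \<Rightarrow> complex set" where
  "Isog L1 L2 = {a. (\<lambda>x. a * x) ` L1 \<subseteq> L2}"

definition isogenous :: "complex set \<Rightarrow> complex set \<Rightarrow> bool" where
  "isogenous L1 L2 \<longleftrightarrow> Isog L1 L2 \<noteq> {0}"

text \<open>CM: Isog(L,L) has rank two, i.e. contains two Z-linearly independent elements
  (the rank is always at most two).\<close>
definition is_CM :: "complex set \<Rightarrow> bool" where
  "is_CM L \<longleftrightarrow> (\<exists>a\<in>Isog L L. \<exists>b\<in>Isog L L.
      \<forall>m n :: int. of_int m * a + of_int n * b = 0 \<longrightarrow> m = 0 \<and> n = 0)"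

text \<open>Bivariate real polynomials as \<open>real poly poly\<close>: inner variable x, outer variable y.\<close>
definition eval2 :: "real poly poly \<Rightarrow> real \<times> real \<Rightarrow> real" where
  "eval2 p xy = poly (poly p [:snd xy:]) (fst xy)"

definition zero_set :: "real poly poly set \<Rightarrow> (real \<times> real) set" where
  "zero_set F = {xy. \<forall>f\<in>F. eval2 f xy = 0}"

text \<open>Real points V(R) of a closed algebraic subvariety V of the affine plane.\<close>
definition real_alg_set :: "(real \<times> real) set \<Rightarrow> bool" where
  "real_alg_set S \<longleftrightarrow> (\<exists>F. finite F \<and> S = zero_set F)"

text \<open>Real points W(R) of a proper closed subvariety W of the affine plane
  (W is cut out by a finite family not all of whose members are zero).\<close>
definition proper_real_alg_set :: "(real \<times> real) set \<Rightarrow> bool" where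
  "proper_real_alg_set S \<longleftrightarrow> (\<exists>F. finite F \<and> (\<exists>f\<in>F. f \<noteq> 0) \<and> S = zero_set F)"

definition weakly_bialgebraic :: "complex set \<Rightarrow> (real \<times> real) set \<Rightarrow> bool" where
  "weakly_bialgebraic L S \<longleftrightarrow>
     S \<noteq> {} \<and> S \<noteq> UNIV \<and> real_alg_set S \<and>
     (\<exists>W. proper_real_alg_set W \<and>
          wpP L ` (S \<inter> {xy. Complex (fst xy) (snd xy) \<notin> L}) \<subseteq> W) \<and>
     \<not> (\<exists>V1 V2. real_alg_set V1 \<and> real_alg_set V2 \<and> V1 \<subset> S \<and> V2 \<subset> S \<and> S = V1 \<union> V2)"

definition translate :: "real \<times> real \<Rightarrow> (real \<times> real) set \<Rightarrow> (real \<times> real) set" where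
  "translate v S = (\<lambda>p. (fst p + fst v, snd p + snd v)) ` S"

definition line1 :: "complex \<Rightarrow> (real \<times> real) set" where
  "line1 g = {xy. csqrt g * Complex (fst xy) (snd xy) \<in> \<real>}"

definition line2 :: "complex \<Rightarrow> (real \<times> real) set" where
  "line2 g = {xy. csqrt g * Complex (fst xy) (snd xy) \<in> (\<lambda>t. \<i> * of_real t) ` UNIV}"

definition line_through :: "complex \<Rightarrow> (real \<times> real) set" where
  "line_through w = {(Re (of_real t * w), Im (of_real t * w)) | t :: real. True}"

end

(* A one-dimensional bialgebraic set S lies on an irreducible complex curve F(z, w) = 0 with w the
   conjugate of z, along which wp(z) and its conjugate wp'(w) satisfy a polynomial relation G. The
   relation is propagated from S to the whole curve: the roots w of F(z, .) turn entire functions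
   of w into polynomials in w with holomorphic coefficients, so the norm of the relation is a
   determinant that is holomorphic in z and vanishes on an uncountable set. Now fix a generic z and
   translate by multiples of a lattice vector l. The points of the curve above z + n l lie, modulo
   the conjugate lattice, in a finite set not depending on n. Hence two translates of the curve by
   lattice vectors meet in a generic point and so coincide; the curve is invariant under a
   translation and must be a line w = a z + b, with k a l in the conjugate lattice for some k.
   On S this means that S is a real line and |a| = 1. Conversely, along such a line wp and its
   conjugate are elliptic for a common lattice and therefore algebraically dependent. *)

theory Submission
  imports
    Defs
    "HOL-Complex_Analysis.Complex_Analysis"
    "HOL-Computational_Algebra.Fundamental_Theorem_Algebra"
    "HOL-Computational_Algebra.Polynomial_Factorial"
    "HOL-Computational_Algebra.Field_as_Ring"
    "Jordan_Normal_Form.Determinant"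
begin

section \<open>Bivariate polynomials\<close>

text \<open>The roots w of F(z, .) branch, and a root followed along a loop in z need not return to
  itself. So the relation cannot be continued along a single-valued w(z); the determinant is
  symmetric in all the roots and needs no choice of a branch. What survives is an existence
  statement: over all but countably many z, at least one root satisfies the relation. That is
  enough, because the comparison of translates only picks one root over each z + n l. All
  exceptional sets are countable, and so are both lattices; hence one z can avoid all lattice
  translates of these sets at once. A root w may lie in the conjugate lattice, where the relation
  says nothing; such a root is kept and counted as congruent to 0. The finite set over z arises
  because G(wp(z), .) is a nonzero polynomial for generic z: wp'(w) takes finitely many values, each
  at finitely many points modulo the conjugate lattice. The factor k appears because the pigeonhole
  principle produces a period that is only a multiple of l.\<close>

definition ev :: "'a::comm_ring_1 poly poly \<Rightarrow> 'a \<Rightarrow> 'a \<Rightarrow> 'a" where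
  "ev F z w = poly (poly F [:w:]) z"

lemma eval2_ev: "eval2 p xy = ev p (fst xy) (snd xy)"
  by (simp add: eval2_def ev_def)

lemma ev_simps [simp]:
  "ev 0 z w = 0" "ev 1 z w = 1"
  "ev (F + G) z w = ev F z w + ev G z w"
  "ev (F - G) z w = ev F z w - ev G z w"
  "ev (- F) z w = - ev F z w"
  "ev (F * G) z w = ev F z w * ev G z w"
  "ev (pCons a F) z w = poly a z + w * ev F z w"
  "ev (Polynomial.smult a F) z w = poly a z * ev F z w"
  by (simp_all add: ev_def)

lemma ev_sum: "ev (sum f A) z w = (\<Sum>a\<in>A. ev (f a) z w)"
  by (induction A rule: infinite_finite_induct) auto

definition slice :: "'a::comm_ring_1 poly poly \<Rightarrow> 'a \<Rightarrow> 'a poly" where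
  "slice F z = map_poly (\<lambda>p. poly p z) F"

lemma poly_slice: "poly (slice F z) w = ev F z w"
  unfolding slice_def by (induction F) (auto simp: map_poly_pCons)

lemma coeff_slice: "coeff (slice F z) i = poly (coeff F i) z"
  by (simp add: slice_def coeff_map_poly)

lemma degree_slice: "poly (lead_coeff F) z \<noteq> 0 \<Longrightarrow> degree (slice F z) = degree F"
  by (intro antisym degree_le le_degree) (auto simp: coeff_slice coeff_eq_0)

lemma ev_altdef: "ev F z w = (\<Sum>j\<le>degree F. poly (coeff F j) z * w ^ j)"
proof -
  have "ev F z w = poly (\<Sum>j\<le>degree F. coeff F j * [:w:] ^ j) z"
    by (simp add: ev_def poly_altdef)
  also have "\<dots> = (\<Sum>j\<le>degree F. poly (coeff F j) z * w ^ j)"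
    by (simp add: poly_sum)
  finally show ?thesis .
qed

lemma slice_eq_0_finite:
  fixes F :: "'a::idom poly poly"
  assumes "F \<noteq> 0"
  shows "finite {z. slice F z = 0}"
proof -
  have "{z. slice F z = 0} \<subseteq> {z. poly (lead_coeff F) z = 0}"
  proof clarify
    fix z assume "slice F z = 0"
    then show "poly (lead_coeff F) z = 0" by (metis coeff_0 coeff_slice)
  qed
  then show ?thesis
    by (rule finite_subset) (use assms poly_roots_finite[of "lead_coeff F"] in simp)
qed

lemma ev_eq_0_imp_eq_0:
  fixes F :: "'a::{idom,ring_char_0} poly poly"
  assumes "\<And>z w. ev F z w = 0"
  shows "F = 0"
proof (rule ccontr)
  assume "F \<noteq> 0"
  then have "finite {z. slice F z = 0}" by (rule slice_eq_0_finite)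
  moreover have "slice F z = 0" for z
    using assms by (simp add: poly_slice poly_all_0_iff_0[symmetric])
  ultimately show False by (simp add: infinite_UNIV_char_0)
qed

text \<open>A nonzero element of least degree in the ideal generated by \<open>F\<close> and \<open>G\<close> pseudo-divides both;
  primality of \<open>F\<close> forces its degree to be zero.\<close>
lemma finite_common_zeros_aux:
  fixes F G :: "'a::{field,factorial_ring_gcd,semiring_gcd_mult_normalize} poly poly"
  assumes F: "prime_elem F" "degree F \<ge> 1" and nd: "\<not> F dvd G"
  shows "\<exists>A B R. R \<noteq> 0 \<and> A * F + B * G = [:R:]"
proof -
  define I where "I = {H. \<exists>A B. H = A * F + B * G}"
  have mult_I: "P * H \<in> I" if "H \<in> I" for P H
  proof -
    from that obtain A B where "H = A * F + B * G" by (auto simp: I_def)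
    then have "P * H = (P * A) * F + (P * B) * G" by (simp add: algebra_simps)
    then show ?thesis unfolding I_def by blast
  qed
  have diff_I: "H - K \<in> I" if "H \<in> I" "K \<in> I" for H K
  proof -
    from that obtain A B A' B' where "H = A * F + B * G" "K = A' * F + B' * G"
      by (auto simp: I_def)
    then have "H - K = (A - A') * F + (B - B') * G" by (simp add: algebra_simps)
    then show ?thesis unfolding I_def by blast
  qed
  have FI: "F \<in> I" unfolding I_def
    by (rule CollectI, rule exI[of _ 1], rule exI[of _ 0]) simp
  have GI: "G \<in> I" unfolding I_def
    by (rule CollectI, rule exI[of _ 0], rule exI[of _ 1]) simp
  have "F \<noteq> 0" using F by auto
  then have ex: "\<exists>H. H \<in> I \<and> H \<noteq> 0" using FI by blast
  define H where "H = arg_min degree (\<lambda>H. H \<in> I \<and> H \<noteq> 0)"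
  have "H \<in> I \<and> H \<noteq> 0"
    using ex unfolding H_def by (rule exE) (rule arg_min_natI)
  then have H: "H \<in> I" "H \<noteq> 0" by simp_all
  have Hmin: "degree H \<le> degree K" if "K \<in> I" "K \<noteq> 0" for K
    unfolding H_def using that by (intro arg_min_nat_le) simp
  have pd: "\<exists>a Q. a \<noteq> 0 \<and> [:a:] * K = H * Q" if "K \<in> I" for K
  proof -
    obtain a Q where aQ: "a \<noteq> 0" "Polynomial.smult a K = H * Q + pseudo_mod K H"
      using pseudo_mod(1)[OF H(2), of K] by blast
    have "pseudo_mod K H = [:a:] * K - Q * H" using aQ by (simp add: algebra_simps)
    then have "pseudo_mod K H \<in> I" using mult_I diff_I that H by metis
    then have "pseudo_mod K H = 0"
      using Hmin pseudo_mod(2)[OF H(2), of K] by fastforce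
    with aQ show ?thesis by auto
  qed
  have nodvd: "\<not> F dvd [:a:]" if "a \<noteq> 0" for a
    using F(2) that dvd_imp_degree_le[of F "[:a:]"] by auto
  obtain a Q where aQ: "a \<noteq> 0" "[:a:] * F = H * Q" using pd[OF FI] by blast
  obtain b P where bP: "b \<noteq> 0" "[:b:] * G = H * P" using pd[OF GI] by blast
  \<comment> \<open>\<open>F\<close> divides \<open>H * Q\<close> but not \<open>H\<close>:
    otherwise it would divide \<open>[:b:] * G\<close>, and neither factor allows this. So
    \<open>F\<close> cancels against \<open>Q\<close>, and \<open>H\<close> divides a nonzero
    polynomial in z alone.\<close>
  have "F dvd H * Q" using aQ(2) by (metis dvd_triv_right)
  then have "F dvd H \<or> F dvd Q" using F by (simp add: prime_elem_dvd_mult_iff)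
  moreover have "\<not> F dvd H"
  proof
    assume "F dvd H"
    then have "F dvd [:b:] * G" using bP by simp
    then show False using F nd nodvd[OF bP(1)] prime_elem_dvd_mult_iff by blast
  qed
  ultimately obtain K where "Q = F * K" by (auto elim: dvdE)
  with aQ have "F * [:a:] = F * (H * K)" by (simp only: mult.commute mult.left_commute)
  with \<open>F \<noteq> 0\<close> have "[:a:] = H * K" by (metis mult_left_cancel)
  then have "H dvd [:a:]" by (rule dvdI)
  moreover have "[:a:] \<noteq> 0" using aQ(1) by simp
  ultimately have "degree H \<le> degree [:a:]" by (rule dvd_imp_degree_le)
  then have "degree H = 0" by simp
  then obtain R where "H = [:R:]" by (auto elim: degree_eq_zeroE)
  moreover obtain A B where "H = A * F + B * G" using H(1) by (auto simp: I_def)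
  ultimately show ?thesis using H(2) by (metis pCons_0_0)
qed

text \<open>The combination of \<open>F\<close> and \<open>G\<close> in
  \<open>finite_common_zeros_aux\<close> is free of w, so the abscissa of every common zero is a
  root of the one-variable polynomial \<open>R\<close>.\<close>

lemma finite_common_zeros:
  fixes F G :: "'a::{field,factorial_ring_gcd,semiring_gcd_mult_normalize} poly poly"
  assumes "prime_elem F" "degree F \<ge> 1" "\<not> F dvd G"
  shows "finite {z. \<exists>w. ev F z w = 0 \<and> ev G z w = 0}"
proof -
  obtain A B R where R: "R \<noteq> 0" "A * F + B * G = [:R:]"
    using finite_common_zeros_aux[OF assms] by blast
  have "poly R z = ev A z w * ev F z w + ev B z w * ev G z w" for z w
    using arg_cong[OF R(2), of "\<lambda>P. ev P z w"] by simp
  then have "{z. \<exists>w. ev F z w = 0 \<and> ev G z w = 0} \<subseteq> {z. poly R z = 0}"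
    by auto (metis add.right_neutral mult_zero_right)
  then show ?thesis by (rule finite_subset) (use R poly_roots_finite in blast)
qed

definition shift :: "'a::comm_ring_1 \<Rightarrow> 'a \<Rightarrow> 'a poly poly \<Rightarrow> 'a poly poly" where
  "shift \<tau> \<nu> F = pcompose (map_poly (\<lambda>p. pcompose p [:\<tau>, 1:]) F) [:[:\<nu>:], 1:]"

lemma ev_shift: "ev (shift \<tau> \<nu> F) z w = ev F (z + \<tau>) (w + \<nu>)"
  unfolding shift_def
  by (induction F) (auto simp: map_poly_pCons pcompose_pCons poly_pcompose algebra_simps)

text \<open>Iterating the translation carries the zero (x0, y0) to infinitely many zeros on one line
  of slope \<nu> / \<tau>. Hence \<open>F\<close> vanishes on that line, and the linear polynomial
  of the line divides the irreducible \<open>F\<close>, so equals it up to a constant.\<close>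

lemma zeros_line_if_dvd_shift:
  fixes F :: "'a::{field_char_0,factorial_ring_gcd,semiring_gcd_mult_normalize} poly poly"
  assumes F: "prime_elem F" "degree F \<ge> 1" and dvd: "F dvd shift \<tau> \<nu> F" and "\<tau> \<noteq> 0"
    and z: "ev F x0 y0 = 0"
  shows "ev F x y = 0 \<longleftrightarrow> \<tau> * (y - y0) = \<nu> * (x - x0)"
proof -
  have step: "ev F (x0 + of_nat n * \<tau>) (y0 + of_nat n * \<nu>) = 0" for n
  proof (induction n)
    case (Suc n)
    obtain K where "shift \<tau> \<nu> F = F * K" using dvd by auto
    then have "ev (shift \<tau> \<nu> F) (x0 + of_nat n * \<tau>) (y0 + of_nat n * \<nu>) = 0"
      using Suc by simp
    then have "ev F (x0 + of_nat n * \<tau> + \<tau>) (y0 + of_nat n * \<nu> + \<nu>) = 0"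
      by (simp add: ev_shift)
    then show ?case by (simp add: algebra_simps)
  qed (use z in simp)
  define a where "a = \<nu> / \<tau>"
  define l where "l = [:y0 - a * x0, a:]"
  \<comment> \<open>Substituting \<open>l\<close> for the outer variable restricts \<open>F\<close>
    to the line and leaves a polynomial in x.\<close>
  have "poly F l = 0"
  proof (rule ccontr)
    assume "poly F l \<noteq> 0"
    then have "finite {x. poly (poly F l) x = 0}" by (rule poly_roots_finite)
    moreover have eq: "poly (poly F l) x = ev F x (poly l x)" for x
      unfolding ev_def by (induction F) auto
    have "x0 + of_nat n * \<tau> \<in> {x. poly (poly F l) x = 0}" for n
    proof -
      have "poly l (x0 + of_nat n * \<tau>) = y0 + of_nat n * \<nu>"
        using \<open>\<tau> \<noteq> 0\<close> by (simp add: l_def a_def field_simps)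
      then show ?thesis using step[of n] by (simp add: eq)
    qed
    then have "range (\<lambda>n. x0 + of_nat n * \<tau>) \<subseteq> {x. poly (poly F l) x = 0}" by blast
    moreover have "inj (\<lambda>n::nat. x0 + of_nat n * \<tau>)"
      using \<open>\<tau> \<noteq> 0\<close> by (auto simp: inj_on_def)
    ultimately show False by (meson finite_imageD finite_subset infinite_UNIV_nat)
  qed
  then have "[:- l, 1:] dvd F" by (simp add: poly_eq_0_iff_dvd)
  then obtain K where K: "F = [:- l, 1:] * K" by blast
  have "irreducible F" using F(1) by (simp add: prime_elem_imp_irreducible)
  then have "is_unit [:- l, 1:] \<or> is_unit K" using K irreducibleD by blast
  moreover have "\<not> is_unit [:- l, 1:]" by (auto simp: is_unit_poly_iff)
  ultimately have "is_unit K" by blast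
  then obtain c where c: "K = [:[:c:]:]" "c \<noteq> 0"
    by (auto simp: is_unit_poly_iff) (metis not_is_unit_0)
  have "ev F x y = c * (y - poly l x)" by (simp add: K c(1) algebra_simps)
  then have "ev F x y = 0 \<longleftrightarrow> y = poly l x" using c by simp
  also have "\<dots> \<longleftrightarrow> \<tau> * (y - y0) = \<nu> * (x - x0)"
    using \<open>\<tau> \<noteq> 0\<close> by (auto simp: l_def a_def field_simps)
  finally show ?thesis .
qed

text \<open>The prime \<open>F\<close> cannot divide its w-derivative, which is nonzero of smaller
  degree, so the two have common zeros over finitely many z only. Over every other z the slice has
  simple roots, and it has full degree unless the leading coefficient vanishes.\<close>

lemma finite_not_rsquarefree_slices:
  fixes F :: "complex poly poly"
  assumes F: "prime_elem F" "degree F \<ge> 1"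
  shows "finite {z. card {w. ev F z w = 0} \<noteq> degree F}"
proof -
  have ev_pd: "poly (pderiv (slice F z)) w = ev (pderiv F) z w" for z w
  proof -
    have "pderiv (slice F z) = slice (pderiv F) z"
      by (rule poly_eqI) (simp add: coeff_slice coeff_pderiv)
    then show ?thesis by (simp add: poly_slice)
  qed
  have "pderiv F \<noteq> 0" using F(2) by (metis degree_pderiv pderiv_eq_0_iff not_one_le_zero)
  moreover have "degree (pderiv F) < degree F" using F(2) by (simp add: degree_pderiv)
  ultimately have "\<not> F dvd pderiv F"
    using dvd_imp_degree_le[of F "pderiv F"] by linarith
  then have fin: "finite {z. \<exists>w. ev F z w = 0 \<and> ev (pderiv F) z w = 0}"
    using finite_common_zeros F by blast
  have "F \<noteq> 0" using F by auto
  have "card {w. ev F z w = 0} = degree F"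
    if "poly (lead_coeff F) z \<noteq> 0" "\<not>(\<exists>w. ev F z w = 0 \<and> ev (pderiv F) z w = 0)" for z
  proof -
    have "rsquarefree (slice F z)"
      using that(2) by (simp add: rsquarefree_roots poly_slice ev_pd)
    then have "card {w. poly (slice F z) w = 0} = degree (slice F z)"
    proof -
      have "degree (Polynomial.smult (lead_coeff (slice F z)) (\<Prod>w | poly (slice F z) w = 0. [:- w, 1:]))
        = card {w. poly (slice F z) w = 0}"
        using \<open>rsquarefree (slice F z)\<close> by (simp add: degree_prod_sum_eq rsquarefree_def)
      then show ?thesis
        using complex_poly_decompose_rsquarefree[OF \<open>rsquarefree (slice F z)\<close>] by simp
    qed
    then show ?thesis using that by (simp add: poly_slice degree_slice)
  qed
  then have "{z. card {w. ev F z w = 0} \<noteq> degree F} \<subseteq>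
     {z. poly (lead_coeff F) z = 0} \<union> {z. \<exists>w. ev F z w = 0 \<and> ev (pderiv F) z w = 0}" by blast
  then show ?thesis
    by (rule finite_subset) (use fin \<open>F \<noteq> 0\<close> poly_roots_finite[of "lead_coeff F"] in auto)
qed

section \<open>Irreducible real algebraic sets\<close>

lemma real_alg_setI: "finite F \<Longrightarrow> real_alg_set (zero_set F)"
  by (auto simp: real_alg_set_def)

lemma zero_set_all_0: "(\<And>f. f \<in> F \<Longrightarrow> f = 0) \<Longrightarrow> zero_set F = UNIV"
  by (force simp: zero_set_def eval2_ev)

lemma real_alg_set_Un:
  assumes "real_alg_set S" "real_alg_set T"
  shows "real_alg_set (S \<union> T)"
proof -
  obtain F G where F: "finite F" "S = zero_set F" and G: "finite G" "T = zero_set G"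
    using assms by (auto simp: real_alg_set_def)
  have "S \<union> T = zero_set ((\<lambda>(f, g). f * g) ` (F \<times> G))"
    by (auto simp: F G zero_set_def eval2_ev)
  then show ?thesis using F G by (auto intro!: real_alg_setI)
qed

lemma real_alg_set_Int_zeros:
  assumes "real_alg_set S"
  shows "real_alg_set {p \<in> S. eval2 f p = 0 \<and> eval2 g p = 0}"
proof -
  obtain F where F: "finite F" "S = zero_set F" using assms by (auto simp: real_alg_set_def)
  have "{p \<in> S. eval2 f p = 0 \<and> eval2 g p = 0} = zero_set (insert f (insert g F))"
    by (auto simp: F zero_set_def)
  then show ?thesis using F by (auto intro!: real_alg_setI)
qed

lemma real_alg_set_singleton: "real_alg_set {p}"
proof -
  have "{p} = zero_set {[:[:- fst p, 1:]:], [:[:- snd p:], 1:]}"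
    by (auto simp: zero_set_def eval2_ev prod_eq_iff)
  then show ?thesis by (metis real_alg_setI finite.intros)
qed

lemma real_alg_set_empty: "real_alg_set {}"
proof -
  have "{} = zero_set {1}" by (auto simp: zero_set_def eval2_ev)
  then show ?thesis by (metis real_alg_setI finite.intros)
qed

lemma real_alg_set_finite: "finite S \<Longrightarrow> real_alg_set S"
proof (induction rule: finite_induct)
  case (insert x F)
  then show ?case using real_alg_set_Un[OF real_alg_set_singleton, of F x] by simp
qed (rule real_alg_set_empty)

text \<open>On w = conj z the coordinates are x = (z + w) / 2 and y = (z - w) / (2 i); the facts
  \<open>X\<close> and \<open>Y\<close> in the proof are these substitutions.\<close>

lemma complexify:
  fixes f :: "real poly poly"
  shows "\<exists>F. \<forall>x y. ev F (Complex x y) (Complex x (- y)) = of_real (ev f x y)"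
proof -
  have X: "ev [:[:0, 1/2:], [:1/2:]:] (Complex x y) (Complex x (- y)) = of_real x" for x y
    by (simp add: complex_eq_iff)
  have Y: "ev [:[:0, - \<i> / 2:], [:\<i> / 2:]:] (Complex x y) (Complex x (- y)) = of_real y" for x y
    by (simp add: complex_eq_iff)
  have inner: "\<exists>F. \<forall>x y. ev F (Complex x y) (Complex x (- y)) = of_real (poly a x)" for a
  proof (induction a)
    case 0
    show ?case by (rule exI[of _ 0]) simp
  next
    case (pCons c a)
    then obtain F where F: "\<And>x y. ev F (Complex x y) (Complex x (- y)) = of_real (poly a x)" by blast
    show ?case
    proof (intro exI allI)
      fix x y
      show "ev ([:[:of_real c:]:] + [:[:0, 1/2:], [:1/2:]:] * F) (Complex x y) (Complex x (- y)) = 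
        of_real (poly (pCons c a) x)"
        unfolding ev_simps(3,6) F X by simp
    qed
  qed
  show ?thesis
  proof (induction f)
    case 0
    show ?case by (rule exI[of _ 0]) simp
  next
    case (pCons a f)
    then obtain F where F: "\<And>x y. ev F (Complex x y) (Complex x (- y)) = of_real (ev f x y)" by blast
    obtain A where A: "\<And>x y. ev A (Complex x y) (Complex x (- y)) = of_real (poly a x)"
      using inner by blast
    show ?case
    proof (intro exI allI)
      fix x y
      show "ev (A + [:[:0, - \<i> / 2:], [:\<i> / 2:]:] * F) (Complex x y) (Complex x (- y)) = 
        of_real (ev (pCons a f) x y)"
        unfolding ev_simps(3,6) F Y A by simp
    qed
  qed
qed

text \<open>The converse passage, by expanding z = x + i y and w = x - i y. One complex equation
  becomes two real ones, so irreducibility, which speaks of real sets, can be tested against complex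
  polynomials.\<close>

lemma real_imag_parts:
  fixes F :: "complex poly poly"
  shows "\<exists>A B. \<forall>x y. ev F (Complex x y) (Complex x (- y)) = Complex (ev A x y) (ev B x y)"
proof -
  have inner: "\<exists>A B. \<forall>x y. poly a (Complex x y) = Complex (ev A x y) (ev B x y)" for a
  proof (induction a)
    case 0
    show ?case by (rule exI[of _ 0], rule exI[of _ 0]) (simp add: complex_eq_iff)
  next
    case (pCons c a)
    then obtain A B where AB: "\<And>x y. poly a (Complex x y) = Complex (ev A x y) (ev B x y)" by blast
    show ?case
    proof (intro exI allI)
      fix x y
      show "poly (pCons c a) (Complex x y) = 
         Complex (ev ([:[:Re c:]:] + [:[:0,1:]:] * A - [:0,1:] * B) x y) 
                 (ev ([:[:Im c:]:] + [:[:0,1:]:] * B + [:0,1:] * A) x y)"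
        by (simp add: AB complex_eq_iff)
    qed
  qed
  show ?thesis
  proof (induction F)
    case 0
    show ?case by (rule exI[of _ 0], rule exI[of _ 0]) (simp add: complex_eq_iff)
  next
    case (pCons c F)
    then obtain A B where AB: "\<And>x y. ev F (Complex x y) (Complex x (- y)) = Complex (ev A x y) (ev B x y)" by blast
    obtain C D where CD: "\<And>x y. poly c (Complex x y) = Complex (ev C x y) (ev D x y)"
      using inner by blast
    show ?case
    proof (intro exI allI)
      fix x y
      show "ev (pCons c F) (Complex x y) (Complex x (- y)) = 
         Complex (ev (C + [:[:0,1:]:] * A + [:0,1:] * B) x y) 
                 (ev (D + [:[:0,1:]:] * B - [:0,1:] * A) x y)"
        by (simp add: AB CD complex_eq_iff)
    qed
  qed
qed

definition irred_alg :: "(real \<times> real) set \<Rightarrow> bool" where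
  "irred_alg S \<longleftrightarrow> S \<noteq> {} \<and> real_alg_set S \<and>
     \<not> (\<exists>V1 V2. real_alg_set V1 \<and> real_alg_set V2 \<and> V1 \<subset> S \<and> V2 \<subset> S \<and> S = V1 \<union> V2)"

text \<open>Each alternative has two equations because they will be the real and the imaginary part
  of one complex equation.\<close>

lemma irred_alg_cover:
  assumes "irred_alg S" "\<And>p. p \<in> S \<Longrightarrow> eval2 f p = 0 \<and> eval2 g p = 0 \<or> eval2 h p = 0 \<and> eval2 k p = 0"
  shows "(\<forall>p\<in>S. eval2 f p = 0 \<and> eval2 g p = 0) \<or> (\<forall>p\<in>S. eval2 h p = 0 \<and> eval2 k p = 0)"
proof -
  let ?V1 = "{p \<in> S. eval2 f p = 0 \<and> eval2 g p = 0}" and ?V2 = "{p \<in> S. eval2 h p = 0 \<and> eval2 k p = 0}"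
  have "real_alg_set ?V1" "real_alg_set ?V2" "S = ?V1 \<union> ?V2"
    using assms by (auto simp: irred_alg_def intro!: real_alg_set_Int_zeros)
  then have "\<not> (?V1 \<subset> S \<and> ?V2 \<subset> S)" using assms(1) unfolding irred_alg_def by blast
  then show ?thesis by blast
qed

lemma irred_alg_real_prime:
  assumes "irred_alg S" "\<And>p. p \<in> S \<Longrightarrow> eval2 (f * g) p = 0"
  shows "(\<forall>p\<in>S. eval2 f p = 0) \<or> (\<forall>p\<in>S. eval2 g p = 0)"
  using irred_alg_cover[OF assms(1), of f f g g] assms(2) by (auto simp: eval2_ev)

text \<open>Restriction of a polynomial on C^2 to the totally real plane w = conj z.\<close>

definition evc :: "complex poly poly \<Rightarrow> real \<times> real \<Rightarrow> complex" where
  "evc F p = ev F (Complex (fst p) (snd p)) (Complex (fst p) (- snd p))"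

lemma irred_alg_complex_prime:
  assumes "irred_alg S" "\<And>p. p \<in> S \<Longrightarrow> evc F p * evc G p = 0"
  shows "(\<forall>p\<in>S. evc F p = 0) \<or> (\<forall>p\<in>S. evc G p = 0)"
proof -
  obtain f g where fg: "\<And>x y. ev F (Complex x y) (Complex x (- y)) = Complex (ev f x y) (ev g x y)"
    using real_imag_parts by blast
  obtain h k where hk: "\<And>x y. ev G (Complex x y) (Complex x (- y)) = Complex (ev h x y) (ev k x y)"
    using real_imag_parts by blast
  have F: "evc F p = 0 \<longleftrightarrow> eval2 f p = 0 \<and> eval2 g p = 0" for p
    by (simp add: evc_def fg eval2_ev complex_eq_iff)
  have G: "evc G p = 0 \<longleftrightarrow> eval2 h p = 0 \<and> eval2 k p = 0" for p
    by (simp add: evc_def hk eval2_ev complex_eq_iff)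
  show ?thesis unfolding F G
    by (rule irred_alg_cover[OF assms(1)]) (use assms(2) F G in auto)
qed

lemma complexify_nonzero:
  fixes f :: "real poly poly"
  assumes "f \<noteq> 0"
  obtains F where "F \<noteq> 0" "\<And>p. evc F p = of_real (eval2 f p)"
proof -
  obtain F where F: "\<And>x y. ev F (Complex x y) (Complex x (- y)) = of_real (ev f x y)"
    using complexify by blast
  obtain x y where "ev f x y \<noteq> 0" using ev_eq_0_imp_eq_0 assms by blast
  then have "F \<noteq> 0" using F[of x y] by auto
  with F show ?thesis by (intro that) (auto simp: evc_def eval2_ev)
qed

text \<open>Some nonzero real polynomial vanishes on S, since S is not the plane. Its
  complexification factors into primes over C, and irreducibility of S selects one that vanishes on
  all of S; this prime need not come from a real polynomial.\<close>

lemma irred_alg_prime_poly: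
  assumes S: "irred_alg S" "S \<noteq> UNIV" "infinite S"
  obtains F where "prime_elem F" "degree F \<ge> 1" "\<And>p. p \<in> S \<Longrightarrow> evc F p = 0"
proof -
  obtain f where f: "f \<noteq> 0" "\<And>p. p \<in> S \<Longrightarrow> eval2 f p = 0"
  proof -
    obtain Fs where Fs: "S = zero_set Fs" using S by (auto simp: irred_alg_def real_alg_set_def)
    have "\<exists>f\<in>Fs. f \<noteq> 0"
      using S(2) by (auto simp: Fs zero_set_all_0)
    then show ?thesis using that Fs by (auto simp: zero_set_def)
  qed
  obtain H where H: "H \<noteq> 0" "\<And>p. evc H p = of_real (eval2 f p)"
    using complexify_nonzero[OF f(1)] by blast
  define M where "M = prime_factorization H"
  have M: "\<And>P. P \<in># M \<Longrightarrow> prime P" by (simp add: M_def in_prime_factors_imp_prime)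
  have "H dvd prod_mset M"
    unfolding M_def using prod_mset_prime_factorization_weak[OF H(1)] by (rule associatedD2)
  then obtain K where K: "prod_mset M = H * K" by auto
  have "evc (prod_mset M) p = 0" if "p \<in> S" for p
    using H(2)[of p] f(2)[OF that] by (simp add: K evc_def)
  with M have "\<exists>P. prime P \<and> (\<forall>p\<in>S. evc P p = 0)"
  proof (induction M)
    case empty
    then show ?case using S by (auto simp: evc_def irred_alg_def)
  next
    case (add P M)
    have "(\<forall>p\<in>S. evc P p = 0) \<or> (\<forall>p\<in>S. evc (prod_mset M) p = 0)"
      by (rule irred_alg_complex_prime[OF S(1)]) (use add.prems(2) in \<open>simp add: evc_def\<close>)
    then show ?case using add.IH add.prems(1) by (metis union_single_eq_member add_mset_add_single union_iff)
  qed
  then obtain P where P: "prime P" "\<And>p. p \<in> S \<Longrightarrow> evc P p = 0" by blast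
  \<comment> \<open>A prime free of w would allow only finitely many z, hence finitely many points
    of S.\<close>
  have "degree P \<ge> 1"
  proof (rule ccontr)
    assume "\<not> degree P \<ge> 1"
    then obtain a where a: "P = [:a:]" by (metis degree_eq_zeroE less_one not_le)
    then have "a \<noteq> 0" using P(1) by auto
    have "(\<lambda>p. Complex (fst p) (snd p)) ` S \<subseteq> {z. poly a z = 0}"
      using P(2) by (auto simp: evc_def a)
    then have "finite ((\<lambda>p. Complex (fst p) (snd p)) ` S)"
      using poly_roots_finite[OF \<open>a \<noteq> 0\<close>] finite_subset by blast
    then show False
      using S(3) by (auto dest!: finite_imageD simp: inj_on_def prod_eq_iff)
  qed
  with P that[of P] show ?thesis by (simp add: prime_imp_prime_elem)
qed

section \<open>Cardinality of irreducible sets\<close>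

lemma vertical_line_subset:
  assumes "infinite {y. (x0, y) \<in> zero_set Fs}"
  shows "(x0, y) \<in> zero_set Fs"
proof -
  have "ev f x0 y = 0" if "f \<in> Fs" for f
  proof (rule ccontr)
    assume "ev f x0 y \<noteq> 0"
    then have "slice f x0 \<noteq> 0" by (metis poly_0 poly_slice)
    then have "finite {y. poly (slice f x0) y = 0}" by (rule poly_roots_finite)
    moreover have "{y. (x0, y) \<in> zero_set Fs} \<subseteq> {y. poly (slice f x0) y = 0}"
      using that by (auto simp: zero_set_def eval2_ev poly_slice)
    ultimately show False using assms finite_subset by blast
  qed
  then show ?thesis by (auto simp: zero_set_def eval2_ev)
qed

text \<open>The propagation of zeros needs uncountably many of them, whereas S is only known to be
  infinite. Take \<open>p\<close> of least degree in y among the nonzero polynomials vanishing on S.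
  If \<open>p\<close> involves y, it changes sign in y near a suitable point of S, and the
  intermediate value theorem gives points of S over a whole interval of x.\<close>

lemma irred_alg_uncountable:
  assumes S: "irred_alg S" "S \<noteq> UNIV" "infinite S"
  shows "uncountable S"
proof -
  obtain Fs where Fs: "S = zero_set Fs" "finite Fs" using S by (auto simp: irred_alg_def real_alg_set_def)
  define I where "I = {f. \<forall>p\<in>S. eval2 f p = 0}"
  have "\<exists>f\<in>Fs. f \<noteq> 0"
    using S(2) by (auto simp: Fs zero_set_all_0)
  moreover have FsI: "Fs \<subseteq> I" by (auto simp: Fs zero_set_def I_def)
  ultimately have ex: "\<exists>f. f \<in> I \<and> f \<noteq> 0" by blast
  define p where "p = arg_min degree (\<lambda>H. H \<in> I \<and> H \<noteq> 0)"
  have "p \<in> I \<and> p \<noteq> 0"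
    using ex unfolding p_def by (rule exE) (rule arg_min_natI)
  then have p: "p \<in> I" "p \<noteq> 0" by simp_all
  have pmin: "degree p \<le> degree K" if "K \<in> I" "K \<noteq> 0" for K
    unfolding p_def using that by (intro arg_min_nat_le) simp
  show ?thesis
  proof (cases "degree p = 0")
    case True
    then obtain q where q: "p = [:q:]" by (rule degree_eq_zeroE)
    with p have "q \<noteq> 0" by auto
    have sub: "fst ` S \<subseteq> {x. poly q x = 0}" using p(1) by (auto simp: I_def eval2_ev q)
    then have fin: "finite (fst ` S)" using poly_roots_finite[OF \<open>q \<noteq> 0\<close>] finite_subset by blast
    \<comment> \<open>Only finitely many x occur, so some vertical line meets S infinitely often and
      is then contained in S.\<close>
    have "\<exists>x0. infinite {y. (x0, y) \<in> S}"
    proof (rule ccontr)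
      assume "\<not> ?thesis"
      then have "finite (\<Union>x\<in>fst ` S. Pair x ` {y. (x, y) \<in> S})" using fin by (intro finite_UN_I) auto
      moreover have "S \<subseteq> (\<Union>x\<in>fst ` S. Pair x ` {y. (x, y) \<in> S})" by force
      ultimately show False using S(3) finite_subset by blast
    qed
    then obtain x0 where "infinite {y. (x0, y) \<in> S}" by blast
    then have "Pair x0 ` UNIV \<subseteq> S" using vertical_line_subset unfolding Fs by blast
    moreover have "uncountable (Pair x0 ` (UNIV :: real set))"
      using uncountable_UNIV_real by (auto dest!: countable_image_inj_on simp: inj_on_def)
    ultimately show ?thesis using countable_subset by blast
  next
    case False
    have "\<exists>a. a \<noteq> 0 \<and> p dvd Polynomial.smult a f" if "f \<in> Fs" for f
    proof -
      obtain a Q where aQ: "a \<noteq> 0" "Polynomial.smult a f = p * Q + pseudo_mod f p"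
        using pseudo_mod(1)[OF p(2), of f] by blast
      have "pseudo_mod f p = Polynomial.smult a f - p * Q" using aQ by (simp add: algebra_simps)
      then have "pseudo_mod f p \<in> I"
        using p(1) that FsI by (auto simp: I_def eval2_ev)
      then have "pseudo_mod f p = 0"
        using pmin pseudo_mod(2)[OF p(2), of f] by fastforce
      with aQ show ?thesis by auto
    qed
    then obtain a where a: "\<And>f. f \<in> Fs \<Longrightarrow> a f \<noteq> 0" "\<And>f. f \<in> Fs \<Longrightarrow> p dvd Polynomial.smult (a f) f" by metis
    \<comment> \<open>Where \<open>b\<close> is nonzero, the zeros of \<open>p\<close> lie in S:
      pseudo-division turns each defining polynomial, times a factor of \<open>b\<close>, into a
      multiple of \<open>p\<close>.\<close>
    define b where "b = (\<Prod>f\<in>Fs. a f)"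
    have b: "b \<noteq> 0" using a(1) Fs(2) by (simp add: b_def)
    then have "[:b:] \<notin> I" using pmin[of "[:b:]"] False by auto
    moreover have "pderiv p \<notin> I"
    proof
      assume "pderiv p \<in> I"
      moreover have "pderiv p \<noteq> 0" using False by (simp add: pderiv_eq_0_iff)
      ultimately have "degree p \<le> degree (pderiv p)" by (rule pmin)
      then show False using False by (simp add: degree_pderiv)
    qed
    \<comment> \<open>By minimality neither \<open>pderiv p\<close> nor \<open>b\<close> vanishes on
      S, so irreducibility gives one point of S where both are nonzero.\<close>
    ultimately have "\<not> (\<forall>s\<in>S. eval2 (pderiv p * [:b:]) s = 0)"
      using irred_alg_real_prime[OF S(1), of "pderiv p" "[:b:]"] unfolding I_def by blast
    then obtain x0 y0 where s: "(x0, y0) \<in> S" "ev (pderiv p) x0 y0 \<noteq> 0" "poly b x0 \<noteq> 0"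
      by (auto simp: eval2_ev)
    have pslice: "ev (pderiv p) x0 y = poly (pderiv (slice p x0)) y" for y
    proof -
      have "pderiv (slice p x0) = slice (pderiv p) x0"
        by (rule poly_eqI) (simp add: coeff_slice coeff_pderiv)
      then show ?thesis by (simp add: poly_slice)
    qed
    have p0: "ev p x0 y0 = 0" using p(1) s(1) by (auto simp: I_def eval2_ev)
    have "((\<lambda>y. ev p x0 y) has_real_derivative ev (pderiv p) x0 y0) (at y0)"
      using poly_DERIV[of "slice p x0" y0] by (simp add: pslice poly_slice[abs_def])
    have "\<exists>y1 y2. y1 < y2 \<and> ev p x0 y1 * ev p x0 y2 < 0"
    proof (cases "ev (pderiv p) x0 y0 > 0")
      case True
      obtain d where d: "d > 0" "\<And>h. 0 < h \<Longrightarrow> h < d \<Longrightarrow> ev p x0 y0 < ev p x0 (y0 + h)"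
        using DERIV_pos_inc_right[OF \<open>(_ has_real_derivative _) _\<close> True] by blast
      obtain e where e: "e > 0" "\<And>h. 0 < h \<Longrightarrow> h < e \<Longrightarrow> ev p x0 (y0 - h) < ev p x0 y0"
        using DERIV_pos_inc_left[OF \<open>(_ has_real_derivative _) _\<close> True] by blast
      show ?thesis using d(1) d(2)[of "d/2"] e(1) e(2)[of "e/2"] p0
        by (intro exI[of _ "y0 - e/2"] exI[of _ "y0 + d/2"]) (auto simp: mult_less_0_iff)
    next
      case False
      then have neg: "ev (pderiv p) x0 y0 < 0" using s by auto
      obtain d where d: "d > 0" "\<And>h. 0 < h \<Longrightarrow> h < d \<Longrightarrow> ev p x0 y0 > ev p x0 (y0 + h)"
        using DERIV_neg_dec_right[OF \<open>(_ has_real_derivative _) _\<close> neg] by blast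
      obtain e where e: "e > 0" "\<And>h. 0 < h \<Longrightarrow> h < e \<Longrightarrow> ev p x0 (y0 - h) > ev p x0 y0"
        using DERIV_neg_dec_left[OF \<open>(_ has_real_derivative _) _\<close> neg] by blast
      show ?thesis using d(1) d(2)[of "d/2"] e(1) e(2)[of "e/2"] p0
        by (intro exI[of _ "y0 - e/2"] exI[of _ "y0 + d/2"]) (auto simp: mult_less_0_iff)
    qed
    then obtain y1 y2 where y: "y1 < y2" "ev p x0 y1 * ev p x0 y2 < 0" by blast
    \<comment> \<open>The sign change between the fixed heights \<open>y1\<close> and
      \<open>y2\<close> and the condition on \<open>b\<close> both persist for all x near
      \<open>x0\<close>.\<close>
    have "continuous_on UNIV (\<lambda>x. ev p x y1 * ev p x y2)" "continuous_on UNIV (poly b)"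
      unfolding ev_def by (intro continuous_intros)+
    then have "open {x. ev p x y1 * ev p x y2 < 0}" "open {x. poly b x \<noteq> 0}"
      by (auto intro!: open_Collect_less open_Collect_neq)
    then have "open ({x. ev p x y1 * ev p x y2 < 0} \<inter> {x. poly b x \<noteq> 0})" by blast
    moreover have "x0 \<in> {x. ev p x y1 * ev p x y2 < 0} \<inter> {x. poly b x \<noteq> 0}" using y s by auto
    ultimately obtain e where e: "e > 0" "ball x0 e \<subseteq> {x. ev p x y1 * ev p x y2 < 0} \<inter> {x. poly b x \<noteq> 0}"
      by (meson openE)
    have "ball x0 e \<subseteq> fst ` S"
    proof
      fix x assume "x \<in> ball x0 e"
      with e have x: "ev p x y1 * ev p x y2 < 0" "poly b x \<noteq> 0" by auto
      obtain y where y: "poly (slice p x) y = 0"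
        using poly_IVT[OF y(1), of "slice p x"] x(1) unfolding poly_slice by blast
      have "ev f x y = 0" if f: "f \<in> Fs" for f
      proof -
        obtain K where "Polynomial.smult (a f) f = p * K" using a(2)[OF f] by auto
        then have "ev (Polynomial.smult (a f) f) x y = ev (p * K) x y" by (simp only:)
        then have "poly (a f) x * ev f x y = 0" using y by (simp add: poly_slice)
        moreover have "poly (a f) x \<noteq> 0"
          using x(2) that Fs(2) by (auto simp: b_def poly_prod)
        ultimately show ?thesis by simp
      qed
      then have "(x, y) \<in> S" by (auto simp: Fs zero_set_def eval2_ev)
      then show "x \<in> fst ` S" by force
    qed
    moreover have "uncountable (ball x0 e)" using e(1) uncountable_ball by blast
    ultimately show ?thesis using countable_image countable_subset by blast
  qed
qed

lemma irred_alg_finite: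
  assumes "irred_alg S" "finite S"
  shows "\<exists>p. S = {p}"
proof -
  obtain p where p: "p \<in> S" using assms by (auto simp: irred_alg_def)
  have "S = {p}"
  proof (rule ccontr)
    assume "S \<noteq> {p}"
    then have "{p} \<subset> S" "S - {p} \<subset> S" "S = {p} \<union> (S - {p})" using p by auto
    then show False using assms real_alg_set_finite[of "S - {p}"] real_alg_set_singleton[of p]
      unfolding irred_alg_def by blast
  qed
  then show ?thesis by blast
qed

section \<open>Common zeros of an algebraic curve and an analytic relation\<close>

text \<open>Reducing w^k modulo \<open>F\<close>, made monic in w, leaves a remainder of degree
  below \<open>degree F\<close> whose coefficients are rational in z. They grow at most
  geometrically in k, locally uniformly in z, whereas the Taylor coefficients of the entire
  \<open>\<beta>\<close> decay faster than any geometric rate. So the reduced series converges to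
  holomorphic coefficients.\<close>

lemma weierstrass_division:
  fixes F :: "complex poly poly"
  assumes d: "degree F \<ge> 1" and \<beta>: "\<beta> holomorphic_on UNIV"
  shows "\<exists>e. (\<forall>i. e i holomorphic_on {z. poly (lead_coeff F) z \<noteq> 0}) \<and>
    (\<forall>z w. poly (lead_coeff F) z \<noteq> 0 \<longrightarrow> ev F z w = 0 \<longrightarrow> \<beta> w = (\<Sum>i<degree F. e i z * w ^ i))"
proof -
  define U where "U = {z. poly (lead_coeff F) z \<noteq> 0}"
  obtain m where m: "degree F = Suc m" using d by (cases "degree F") auto
  define c where "c i z = poly (coeff F i) z / poly (lead_coeff F) z" for i z
  \<comment> \<open>\<open>r k\<close> holds the remainder of w^k. Multiplying by w shifts its
    coefficients, and the overflow \<open>r k m\<close> times w^(m+1) is rewritten by the monic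
    relation with coefficients \<open>c\<close>.\<close>
  define r :: "nat \<Rightarrow> nat \<Rightarrow> complex \<Rightarrow> complex" where
    "r = rec_nat (\<lambda>i z. if i = 0 then 1 else 0)
       (\<lambda>k rk i z. (if i = 0 then 0 else rk (i - 1) z) - c i z * rk m z)"
  have r0: "r 0 i z = (if i = 0 then 1 else 0)" for i z by (simp add: r_def)
  have rS: "r (Suc k) i z = (if i = 0 then 0 else r k (i - 1) z) - c i z * r k m z" for k i z
    by (simp add: r_def)
  have openU: "open U"
    unfolding U_def by (intro open_Collect_neq continuous_intros)
  have hol_c: "c i holomorphic_on U" for i
    unfolding c_def by (intro holomorphic_intros) (auto simp: U_def)
  have hol_r: "r k i holomorphic_on U" for k i
  proof (induction k arbitrary: i)
    case 0
    show ?case by (cases "i = 0") (simp_all add: r0[abs_def])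
  next
    case (Suc k)
    show ?case unfolding rS[abs_def] using Suc hol_c
      by (cases "i = 0") (auto intro!: holomorphic_intros)
  qed
  have pow: "w ^ k = (\<Sum>i<Suc m. r k i z * w ^ i)" if z: "z \<in> U" "ev F z w = 0" for z w k
  proof (induction k)
    case 0
    have "(\<Sum>i<Suc m. r 0 i z * w ^ i) = (\<Sum>i<Suc m. if i = 0 then 1 else 0)"
      by (intro sum.cong) (auto simp: r0)
    then show ?case by simp
  next
    case (Suc k)
    have lc: "poly (coeff F (Suc m)) z \<noteq> 0" using z m by (simp add: U_def)
    have "(\<Sum>j\<le>Suc m. poly (coeff F j) z * w ^ j) = 0"
      using z(2) by (simp add: ev_altdef m)
    then have "poly (coeff F (Suc m)) z * w ^ Suc m = - (\<Sum>j<Suc m. poly (coeff F j) z * w ^ j)"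
      by (simp add: lessThan_Suc_atMost eq_neg_iff_add_eq_0 add.commute)
    then have top: "w ^ Suc m = - (\<Sum>j<Suc m. c j z * w ^ j)"
      using lc by (simp add: c_def m sum_divide_distrib[symmetric] field_simps del: sum.lessThan_Suc power_Suc)
    have "w ^ Suc k = (\<Sum>i<Suc m. r k i z * w ^ Suc i)"
      by (simp add: Suc sum_distrib_left mult_ac del: sum.lessThan_Suc)
    also have "\<dots> = (\<Sum>i<m. r k i z * w ^ Suc i) + r k m z * w ^ Suc m" by simp
    also have "(\<Sum>i<m. r k i z * w ^ Suc i) = (\<Sum>i<Suc m. (if i = 0 then 0 else r k (i - 1) z) * w ^ i)"
      by (simp add: sum.lessThan_Suc_shift del: sum.lessThan_Suc)
    also have "r k m z * w ^ Suc m = - (\<Sum>i<Suc m. c i z * r k m z * w ^ i)"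
      by (simp add: top sum_distrib_left mult_ac del: sum.lessThan_Suc power_Suc)
    finally show ?case
      by (simp add: rS sum_subtractf left_diff_distrib del: sum.lessThan_Suc power_Suc)
  qed
  have bound: "norm (r k i z) \<le> (1 + C) ^ k"
    if C: "\<And>i. i \<le> m \<Longrightarrow> norm (c i z) \<le> C" "i \<le> m" for k i z C
    using that(2)
  proof (induction k arbitrary: i)
    case 0
    then show ?case by (simp add: r0)
  next
    case (Suc k)
    have C0: "C \<ge> 0" using C(1)[of 0] norm_ge_zero order_trans by blast
    have "norm (r (Suc k) i z) \<le> norm (if i = 0 then 0 else r k (i - 1) z) + norm (c i z) * norm (r k m z)"
      unfolding rS by (metis norm_mult norm_triangle_ineq4)
    also have "\<dots> \<le> (1 + C) ^ k + C * (1 + C) ^ k"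
      using Suc.IH[of "i - 1"] Suc.IH[of m] Suc.prems C(1)[of i] C0
      by (intro add_mono mult_mono) auto
    finally show ?case by (simp add: algebra_simps)
  qed
  define b where "b k = (deriv ^^ k) \<beta> 0 / fact k" for k
  have b: "(\<lambda>k. b k * w ^ k) sums \<beta> w" for w
    using holomorphic_power_series[of \<beta> 0 "norm w + 1" w] \<beta>
    by (auto simp: b_def dest: holomorphic_on_subset)
  have b_abs: "summable (\<lambda>k. norm (b k) * R ^ k)" if "R \<ge> 0" for R :: real
  proof -
    have "summable (\<lambda>k. norm (b k * of_real R ^ k))"
      by (rule powser_insidea[OF sums_summable[OF b[of "of_real (R + 1)"]]]) (use that in \<open>simp flip: of_real_add\<close>)
    then show ?thesis using that by (simp add: norm_mult norm_power)
  qed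
  \<comment> \<open>Indices above \<open>m\<close> get the value 0, which makes \<open>e i\<close>
    holomorphic for every \<open>i\<close>.\<close>
  define e where "e i z = (if i \<le> m then (\<Sum>k. b k * r k i z) else 0)" for i z
  have locbound: "\<exists>C\<ge>0. \<forall>i\<le>m. \<forall>z\<in>K. norm (c i z) \<le> C" if "compact K" "K \<subseteq> U" for K
  proof -
    have "\<exists>C. \<forall>z\<in>K. norm (c i z) \<le> C" for i
    proof -
      have "compact (c i ` K)"
        using hol_c[of i] that by (meson compact_continuous_image holomorphic_on_imp_continuous_on holomorphic_on_subset)
      then show ?thesis using compact_imp_bounded bounded_iff by (metis imageI)
    qed
    then obtain C where C: "\<And>i z. z \<in> K \<Longrightarrow> norm (c i z) \<le> C i" by metis
    show ?thesis
    proof (intro exI conjI allI impI ballI)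
      show "(\<Sum>i\<le>m. \<bar>C i\<bar>) \<ge> 0" by (simp add: sum_nonneg)
      fix i z assume "i \<le> m" "z \<in> K"
      then have "norm (c i z) \<le> \<bar>C i\<bar>" using C[of z i] by linarith
      also have "\<dots> \<le> (\<Sum>i\<le>m. \<bar>C i\<bar>)" using \<open>i \<le> m\<close> by (intro member_le_sum) auto
      finally show "norm (c i z) \<le> (\<Sum>i\<le>m. \<bar>C i\<bar>)" .
    qed
  qed
  have hol_e: "e i holomorphic_on U" for i
  proof (cases "i \<le> m")
    case True
    then have ei: "e i = (\<lambda>z. \<Sum>k. b k * r k i z)" by (auto simp: e_def)
    show ?thesis
    proof (rule holomorphic_uniform_sequence[OF openU])
      show "(\<lambda>z. \<Sum>k<n. b k * r k i z) holomorphic_on U" for n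
        using hol_r by (intro holomorphic_intros) auto
      fix x assume "x \<in> U"
      then obtain \<delta> where \<delta>: "\<delta> > 0" "cball x \<delta> \<subseteq> U" using openU open_contains_cball by blast
      obtain C where C: "C \<ge> 0" "\<And>i z. i \<le> m \<Longrightarrow> z \<in> cball x \<delta> \<Longrightarrow> norm (c i z) \<le> C"
        using locbound[of "cball x \<delta>"] \<delta> by auto
      have "uniform_limit (cball x \<delta>) (\<lambda>n z. \<Sum>k<n. b k * r k i z) (\<lambda>z. \<Sum>k. b k * r k i z) sequentially"
      proof (rule Weierstrass_m_test)
        show "summable (\<lambda>k. norm (b k) * (1 + C) ^ k)" using b_abs[of "1 + C"] C(1) by simp
        fix k z assume "z \<in> cball x \<delta>"
        then have "norm (r k i z) \<le> (1 + C) ^ k" using C(2) True by (intro bound) auto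
        then show "norm (b k * r k i z) \<le> norm (b k) * (1 + C) ^ k"
          by (simp add: norm_mult mult_left_mono)
      qed
      then show "\<exists>d>0. cball x d \<subseteq> U \<and> uniform_limit (cball x d) (\<lambda>n z. \<Sum>k<n. b k * r k i z) (e i) sequentially"
        unfolding ei using \<delta> by blast
    qed
  qed (simp add: e_def[abs_def])
  have "\<beta> w = (\<Sum>i<Suc m. e i z * w ^ i)" if z: "z \<in> U" "ev F z w = 0" for z w
  proof -
    obtain C where C: "C \<ge> 0" "\<And>i. i \<le> m \<Longrightarrow> norm (c i z) \<le> C"
      using locbound[of "{z}"] z by auto
    have "(\<lambda>k. b k * r k i z) sums e i z" if "i \<le> m" for i
    proof -
      have "summable (\<lambda>k. b k * r k i z)"
      proof (rule summable_comparison_test')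
        show "summable (\<lambda>k. norm (b k) * (1 + C) ^ k)" using b_abs[of "1 + C"] C(1) by simp
        show "norm (b k * r k i z) \<le> norm (b k) * (1 + C) ^ k" for k
          using bound[of z C i k] C that by (simp add: norm_mult mult_left_mono)
      qed
      then show ?thesis using that by (simp add: e_def summable_sums)
    qed
    then have "(\<lambda>k. \<Sum>i<Suc m. b k * r k i z * w ^ i) sums (\<Sum>i<Suc m. e i z * w ^ i)"
      by (intro sums_sum sums_mult2) auto
    also have "(\<lambda>k. \<Sum>i<Suc m. b k * r k i z * w ^ i) = (\<lambda>k. b k * w ^ k)"
    proof
      fix k
      have "b k * w ^ k = b k * (\<Sum>i<Suc m. r k i z * w ^ i)"
        by (rule arg_cong[OF pow[OF z]])
      then show "(\<Sum>i<Suc m. b k * r k i z * w ^ i) = b k * w ^ k"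
        by (simp only: sum_distrib_left mult.assoc)
    qed
    finally show ?thesis using b sums_unique2 by blast
  qed
  note fin = this
  show ?thesis
  proof (intro exI conjI allI impI)
    show "e i holomorphic_on {z. poly (lead_coeff F) z \<noteq> 0}" for i
      using hol_e[of i] by (simp only: U_def)
    fix z w assume "poly (lead_coeff F) z \<noteq> 0" "ev F z w = 0"
    then have "z \<in> U" "ev F z w = 0" by (simp_all add: U_def)
    from fin[OF this] show "\<beta> w = (\<Sum>i<degree F. e i z * w ^ i)" by (simp only: m)
  qed
qed

section \<open>Norm of an analytic relation along the curve\<close>

lemma holomorphic_det:
  assumes "\<And>k i. (\<lambda>z. N z k i) holomorphic_on U"
  shows "(\<lambda>z. Determinant.det (Matrix.mat d d (\<lambda>(k, i). N z k i) :: complex Matrix.mat)) holomorphic_on U"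
proof -
  have eq: "Determinant.det (Matrix.mat d d (\<lambda>(k, i). N z k i)) =
      (\<Sum>p | p permutes {0..<d}. signof p * (\<Prod>i = 0..<d. N z i (p i)))" for z
    unfolding Determinant.det_def by (auto intro!: sum.cong prod.cong)
  show ?thesis unfolding eq using assms by (intro holomorphic_intros) auto
qed

lemma det_eq_0_iff_kernel:
  "Determinant.det (Matrix.mat d d (\<lambda>(k, i). N k i) :: complex Matrix.mat) = 0 \<longleftrightarrow>
   (\<exists>v. (\<exists>i<d. v i \<noteq> 0) \<and> (\<forall>k<d. (\<Sum>i<d. N k i * v i) = 0))"
proof -
  let ?A = "Matrix.mat d d (\<lambda>(k, i). N k i) :: complex Matrix.mat"
  have mv: "?A *\<^sub>v Matrix.vec d v = 0\<^sub>v d \<longleftrightarrow> (\<forall>k<d. (\<Sum>i<d. N k i * v i) = 0)" for v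
    by (auto simp: vec_eq_iff scalar_prod_def atLeast0LessThan)
  have nz: "Matrix.vec d v \<noteq> 0\<^sub>v d \<longleftrightarrow> (\<exists>i<d. v i \<noteq> 0)" for v :: "nat \<Rightarrow> complex"
    by (auto simp: vec_eq_iff)
  have "Determinant.det ?A = 0 \<longleftrightarrow> (\<exists>v. v \<in> carrier_vec d \<and> v \<noteq> 0\<^sub>v d \<and> ?A *\<^sub>v v = 0\<^sub>v d)"
    by (rule det_0_iff_vec_prod_zero) auto
  also have "\<dots> \<longleftrightarrow> (\<exists>v. Matrix.vec d v \<noteq> 0\<^sub>v d \<and> ?A *\<^sub>v Matrix.vec d v = 0\<^sub>v d)"
  proof (intro iffI; elim exE conjE)
    fix v :: "complex Matrix.vec" assume v: "v \<in> carrier_vec d" "v \<noteq> 0\<^sub>v d" "?A *\<^sub>v v = 0\<^sub>v d"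
    have "v = Matrix.vec d (vec_index v)" using v(1) by (auto simp: vec_eq_iff)
    with v show "\<exists>v. Matrix.vec d v \<noteq> 0\<^sub>v d \<and> ?A *\<^sub>v Matrix.vec d v = 0\<^sub>v d" by metis
  next
    fix v assume "Matrix.vec d v \<noteq> 0\<^sub>v d" "?A *\<^sub>v Matrix.vec d v = 0\<^sub>v d"
    then show "\<exists>v. v \<in> carrier_vec d \<and> v \<noteq> 0\<^sub>v d \<and> ?A *\<^sub>v v = 0\<^sub>v d"
      by (metis vec_carrier)
  qed
  finally show ?thesis unfolding mv nz .
qed

lemma open_imp_fsigma:
  fixes S :: "'a::{real_inner,euclidean_space} set"
  assumes "open S"
  shows "fsigma S"
proof -
  obtain C where "\<And>n::nat. compact (C n)" "\<Union>(C ` UNIV) = S"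
    using open_Union_compact_subsets[OF assms] by metis
  then show ?thesis unfolding fsigma_Union_compact by (intro exI[of _ C]) auto
qed

text \<open>\<open>N\<close> is the matrix of multiplication by \<open>E\<close> on the powers 1, w,
  ..., w^(d-1), viewed as functions on the points over z; when these are d distinct points,
  \<open>D\<close> is the product of the values of \<open>E\<close> there. Writing \<open>E\<close>
  as a finite sum of products separates the variables, so that division by \<open>F\<close> is
  applied to entire functions of w only.\<close>

lemma propagate_common_zeros:
  fixes F :: "complex poly poly" and n :: nat
  assumes F: "prime_elem F" "degree F \<ge> 1"
    and U0: "open U0" "connected U0" "countable (- U0)"
    and \<alpha>: "\<And>j. \<alpha> j holomorphic_on U0"
    and \<beta>: "\<And>j. \<beta> j holomorphic_on UNIV"
    and E: "\<And>z w. E z w = (\<Sum>j\<le>n. \<alpha> j z * \<beta> j w)"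
    and unc: "uncountable {z \<in> U0. \<exists>w. ev F z w = 0 \<and> E z w = 0}"
  shows "countable {z. \<not> (\<exists>w. ev F z w = 0 \<and> E z w = 0)}"
proof -
  define d where "d = degree F"
  define Z where "Z = {z. poly (lead_coeff F) z = 0}"
  have "F \<noteq> 0" using F by auto
  then have finZ: "finite Z" unfolding Z_def using poly_roots_finite[of "lead_coeff F"] by simp
  define U where "U = U0 - Z"
  have U: "open U" "connected U"
    unfolding U_def using U0 finZ
    by (auto intro: open_Diff finite_imp_closed connected_open_diff_countable countable_finite)
  \<comment> \<open>Row k of the matrix belongs to w^k times \<open>E\<close>; the power of w is
    absorbed into the entire function before the division.\<close>
  have "\<forall>k j. \<exists>e. (\<forall>i. e i holomorphic_on {z. poly (lead_coeff F) z \<noteq> 0}) \<and>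
    (\<forall>z w. poly (lead_coeff F) z \<noteq> 0 \<longrightarrow> ev F z w = 0 \<longrightarrow> w ^ k * \<beta> j w = (\<Sum>i<degree F. e i z * w ^ i))"
    using \<beta> by (intro allI weierstrass_division F(2) holomorphic_intros) auto
  then obtain e where e0: "\<forall>k j. (\<forall>i. e k j i holomorphic_on {z. poly (lead_coeff F) z \<noteq> 0}) \<and>
    (\<forall>z w. poly (lead_coeff F) z \<noteq> 0 \<longrightarrow> ev F z w = 0 \<longrightarrow> w ^ k * \<beta> j w = (\<Sum>i<degree F. e k j i z * w ^ i))"
    unfolding choice_iff by (elim exE)
  then have e: "e k j i holomorphic_on {z. poly (lead_coeff F) z \<noteq> 0}"
    "poly (lead_coeff F) z \<noteq> 0 \<Longrightarrow> ev F z w = 0 \<Longrightarrow> w ^ k * \<beta> j w = (\<Sum>i<d. e k j i z * w ^ i)" for k j i z w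
    unfolding d_def by (simp_all only: HOL.simp_thms)
  define N where "N z k i = (\<Sum>j\<le>n. \<alpha> j z * e k j i z)" for z k i
  have mult: "w ^ k * E z w = (\<Sum>i<d. N z k i * w ^ i)" if "z \<in> U" "ev F z w = 0" for z w k
  proof -
    have lc: "poly (lead_coeff F) z \<noteq> 0" using that by (auto simp: U_def Z_def)
    have "w ^ k * E z w = (\<Sum>j\<le>n. \<alpha> j z * (w ^ k * \<beta> j w))"
      by (simp add: E sum_distrib_left mult_ac)
    also have "\<dots> = (\<Sum>j\<le>n. \<Sum>i<d. \<alpha> j z * e k j i z * w ^ i)"
      by (simp add: e(2)[OF lc that(2)] sum_distrib_left mult_ac)
    also have "\<dots> = (\<Sum>i<d. N z k i * w ^ i)"
      by (subst sum.swap) (simp add: N_def sum_distrib_right)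
    finally show ?thesis .
  qed
  have holN: "(\<lambda>z. N z k i) holomorphic_on U" for k i
    unfolding N_def
    by (intro holomorphic_intros holomorphic_on_subset[OF \<alpha>] holomorphic_on_subset[OF e(1)])
       (auto simp: U_def Z_def)
  define D where "D z = Determinant.det (Matrix.mat d d (\<lambda>(k, i). N z k i))" for z
  have holD: "D holomorphic_on U" unfolding D_def using holN by (rule holomorphic_det)
  \<comment> \<open>A common zero w makes (1, w, ..., w^(d-1)) a kernel vector.\<close>
  have D0: "D z = 0" if z: "z \<in> U" "ev F z w = 0" "E z w = 0" for z w
    unfolding D_def det_eq_0_iff_kernel
  proof (intro exI conjI allI impI)
    show "0 < d" using F d_def by simp
    show "w ^ 0 \<noteq> 0" by simp
    show "(\<Sum>i<d. N z k i * w ^ i) = 0" for k using mult[OF z(1,2), of k] z(3) by simp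
  qed
  have "{z \<in> U0. \<exists>w. ev F z w = 0 \<and> E z w = 0} \<subseteq> Z \<union> {z \<in> U. D z = 0}"
    using D0 by (auto simp: U_def)
  then have "uncountable {z \<in> U. D z = 0}"
    using unc finZ by (meson countable_Un countable_finite countable_subset)
  then have "U \<subseteq> {z \<in> U. D z = 0}"
    by (rule holomorphic_countable_equal[OF holD holomorphic_on_const U open_imp_fsigma[OF U(1)]])
  then have Dz: "D z = 0" if "z \<in> U" for z using that by blast
  define Q where "Q = {z. card {w. ev F z w = 0} \<noteq> d}"
  have "\<exists>w. ev F z w = 0 \<and> E z w = 0" if z: "z \<in> U" "z \<notin> Q" for z
  proof (rule ccontr)
    assume no: "\<not> ?thesis"
    \<comment> \<open>Now a left kernel vector is wanted, hence the transpose. Its entries are the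
      coefficients of a polynomial \<open>u\<close> of degree below d with u(w) E(z, w) = 0 at all d
      roots w; if \<open>E\<close> vanished at none of them, \<open>u\<close> would have d
      roots.\<close>
    have "Determinant.det (Matrix.mat d d (\<lambda>(k, i). N z i k)) =
        Determinant.det (transpose_mat (Matrix.mat d d (\<lambda>(k, i). N z k i)))"
      by (rule arg_cong[of _ _ Determinant.det]) auto
    also have "\<dots> = 0" using Dz[OF z(1)] by (subst det_transpose) (auto simp: D_def)
    finally obtain v where v: "\<exists>i<d. v i \<noteq> 0" "\<forall>i<d. (\<Sum>k<d. N z k i * v k) = 0"
      unfolding det_eq_0_iff_kernel by blast
    define u where "u = (\<Sum>k<d. monom (v k) k)"
    have coeff_u: "coeff u k = (if k < d then v k else 0)" for k
      by (simp add: u_def coeff_sum)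
    have "poly u w = 0" if w: "ev F z w = 0" for w
    proof -
      have "poly u w * E z w = (\<Sum>k<d. v k * (w ^ k * E z w))"
        by (simp add: u_def poly_sum poly_monom sum_distrib_right mult.assoc)
      also have "\<dots> = (\<Sum>k<d. \<Sum>i<d. N z k i * v k * w ^ i)"
        unfolding mult[OF z(1) w] by (simp add: sum_distrib_left mult_ac)
      also have "\<dots> = (\<Sum>i<d. (\<Sum>k<d. N z k i * v k) * w ^ i)"
        by (subst sum.swap) (simp add: sum_distrib_right)
      also have "\<dots> = 0" using v(2) by simp
      finally show ?thesis using no w by auto
    qed
    then have sub: "{w. ev F z w = 0} \<subseteq> {w. poly u w = 0}" by blast
    have "u \<noteq> 0" using v(1) coeff_u by (metis coeff_0)
    then have "d \<le> degree u"
      using card_mono[OF poly_roots_finite sub] card_poly_roots_bound[of u] z(2) by (simp add: Q_def)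
    moreover have "degree u < d"
      using coeff_u \<open>u \<noteq> 0\<close> by (metis leading_coeff_0_iff)
    ultimately show False by simp
  qed
  then have "{z. \<not> (\<exists>w. ev F z w = 0 \<and> E z w = 0)} \<subseteq> - U0 \<union> Z \<union> Q"
    by (auto simp: U_def)
  moreover have "finite Q" unfolding Q_def d_def by (rule finite_not_rsquarefree_slices[OF F])
  ultimately show ?thesis
    using U0 finZ by (meson countable_Un countable_finite countable_subset)
qed

section \<open>Lattices and the Weierstrass function\<close>

lemma zero_in_lattice: "is_lattice L \<Longrightarrow> 0 \<in> L"
  by (auto simp: is_lattice_def lattice_gen_def intro!: exI[of _ 0])

lemma lattice_add: "is_lattice L \<Longrightarrow> a \<in> L \<Longrightarrow> b \<in> L \<Longrightarrow> a + b \<in> L"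
proof (clarsimp simp: is_lattice_def lattice_gen_def)
  fix w1 w2 :: complex and m n m' n' :: int
  show "\<exists>ma na. of_int m * w1 + of_int n * w2 + (of_int m' * w1 + of_int n' * w2) = of_int ma * w1 + of_int na * w2"
    by (rule exI[of _ "m + m'"], rule exI[of _ "n + n'"]) (simp add: algebra_simps)
qed

lemma lattice_of_int_mult: "is_lattice L \<Longrightarrow> a \<in> L \<Longrightarrow> of_int k * a \<in> L"
proof (clarsimp simp: is_lattice_def lattice_gen_def)
  fix w1 w2 :: complex and m n :: int
  show "\<exists>ma na. of_int k * (of_int m * w1 + of_int n * w2) = of_int ma * w1 + of_int na * w2"
    by (rule exI[of _ "k * m"], rule exI[of _ "k * n"]) (simp add: algebra_simps)
qed

lemma lattice_uminus: "is_lattice L \<Longrightarrow> a \<in> L \<Longrightarrow> - a \<in> L"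
  using lattice_of_int_mult[of L a "- 1"] by simp

lemma lattice_diff: "is_lattice L \<Longrightarrow> a \<in> L \<Longrightarrow> b \<in> L \<Longrightarrow> a - b \<in> L"
  using lattice_add[of L a "- b"] lattice_uminus[of L b] by simp

lemma countable_lattice: "is_lattice L \<Longrightarrow> countable L"
proof (clarsimp simp: is_lattice_def)
  fix w1 w2 :: complex
  have "lattice_gen w1 w2 = (\<lambda>(m, n). of_int m * w1 + of_int n * w2) ` (UNIV :: (int \<times> int) set)"
    by (auto simp: lattice_gen_def)
  then show "countable (lattice_gen w1 w2)" by simp
qed

lemma is_lattice_scale:
  assumes "is_lattice L" "c \<noteq> 0"
  shows "is_lattice ((\<lambda>z. c * z) ` L)"
proof -
  obtain w1 w2 where w: "w1 \<noteq> 0" "Im (w2 / w1) \<noteq> 0" "L = lattice_gen w1 w2"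
    using assms by (auto simp: is_lattice_def)
  have "(\<lambda>z. c * z) ` L = lattice_gen (c * w1) (c * w2)"
    unfolding w(3) lattice_gen_def
  proof (intro equalityI subsetI)
    fix z assume "z \<in> {of_int m * (c * w1) + of_int n * (c * w2) |m n. True}"
    then obtain m n where "z = of_int m * (c * w1) + of_int n * (c * w2)" by auto
    then have "z = c * (of_int m * w1 + of_int n * w2)" by (simp add: algebra_simps)
    then show "z \<in> (\<lambda>z. c * z) ` {of_int m * w1 + of_int n * w2 |m n. True}" by blast
  next
    fix z assume "z \<in> (\<lambda>z. c * z) ` {of_int m * w1 + of_int n * w2 |m n. True}"
    then obtain m n where "z = c * (of_int m * w1 + of_int n * w2)" by auto
    then have "z = of_int m * (c * w1) + of_int n * (c * w2)" by (simp add: algebra_simps)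
    then show "z \<in> {of_int m * (c * w1) + of_int n * (c * w2) |m n. True}" by blast
  qed
  moreover have "c * w1 \<noteq> 0" "Im ((c * w2) / (c * w1)) \<noteq> 0" using w assms(2) by auto
  ultimately show ?thesis unfolding is_lattice_def by blast
qed

lemma is_lattice_cnj:
  assumes "is_lattice L"
  shows "is_lattice (cnj ` L)"
proof -
  obtain w1 w2 where w: "w1 \<noteq> 0" "Im (w2 / w1) \<noteq> 0" "L = lattice_gen w1 w2"
    using assms by (auto simp: is_lattice_def)
  have "cnj ` L = lattice_gen (cnj w1) (cnj w2)"
    unfolding w(3) lattice_gen_def
  proof (intro equalityI subsetI)
    fix z assume "z \<in> {of_int m * cnj w1 + of_int n * cnj w2 |m n. True}"
    then obtain m n where "z = of_int m * cnj w1 + of_int n * cnj w2" by auto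
    then have "z = cnj (of_int m * w1 + of_int n * w2)" by simp
    then show "z \<in> cnj ` {of_int m * w1 + of_int n * w2 |m n. True}" by blast
  next
    fix z assume "z \<in> cnj ` {of_int m * w1 + of_int n * w2 |m n. True}"
    then obtain m n where "z = cnj (of_int m * w1 + of_int n * w2)" by blast
    then have "z = of_int m * cnj w1 + of_int n * cnj w2" by simp
    then show "z \<in> {of_int m * cnj w1 + of_int n * cnj w2 |m n. True}" by blast
  qed
  moreover have "cnj w1 \<noteq> 0" "Im (cnj w2 / cnj w1) \<noteq> 0"
    using w by (auto simp flip: complex_cnj_divide)
  ultimately show ?thesis unfolding is_lattice_def by blast
qed

lemma lattice_norm_lower_bound:
  assumes "w1 \<noteq> 0" "Im (w2 / w1) \<noteq> 0"
  obtains c where "c > 0" "\<And>m n :: int. c * (\<bar>of_int m\<bar> + \<bar>of_int n\<bar>) \<le> norm (of_int m * w1 + of_int n * w2)"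
proof -
  define \<tau> where "\<tau> = w2 / w1"
  \<comment> \<open>With s = |m + n \<tau>|, the imaginary part bounds |n| by s / |Im \<tau>|, and
    the triangle inequality bounds |m| by s + |n| |\<tau>|; \<open>b\<close> collects the resulting
    factors of s.\<close>
  define b where "b = 1 + norm \<tau> / \<bar>Im \<tau>\<bar> + 1 / \<bar>Im \<tau>\<bar>"
  have im: "\<bar>Im \<tau>\<bar> > 0" using assms by (simp add: \<tau>_def)
  then have b: "b > 0" by (auto simp: b_def intro!: add_pos_nonneg)
  show ?thesis
  proof (rule that[of "norm w1 / b"])
    show "norm w1 / b > 0" using b assms by simp
    fix m n :: int
    define s where "s = norm (of_int m + of_int n * \<tau>)"
    have "\<bar>Im (of_int m + of_int n * \<tau>)\<bar> \<le> s" unfolding s_def by (rule abs_Im_le_cmod)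
    then have "\<bar>of_int n\<bar> * \<bar>Im \<tau>\<bar> \<le> s" by (simp add: abs_mult)
    then have n: "\<bar>of_int n\<bar> \<le> s / \<bar>Im \<tau>\<bar>" using im by (simp add: field_simps)
    have "\<bar>of_int m\<bar> = norm ((of_int m + of_int n * \<tau>) - of_int n * \<tau>)" by simp
    also have "\<dots> \<le> s + \<bar>of_int n\<bar> * norm \<tau>"
      unfolding s_def by (rule order_trans[OF norm_triangle_ineq4]) (simp add: norm_mult)
    also have "\<dots> \<le> s + s / \<bar>Im \<tau>\<bar> * norm \<tau>"
      using n by (intro add_left_mono mult_right_mono) auto
    finally have "\<bar>of_int m\<bar> + \<bar>of_int n\<bar> \<le> (s + s / \<bar>Im \<tau>\<bar> * norm \<tau>) + s / \<bar>Im \<tau>\<bar>"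
      using n by (rule add_mono)
    also have "\<dots> = s * b" unfolding b_def distrib_left by simp
    finally have "(\<bar>of_int m\<bar> + \<bar>of_int n\<bar>) / b \<le> s"
      using b by (simp add: pos_divide_le_eq)
    then have "norm w1 * ((\<bar>of_int m\<bar> + \<bar>of_int n\<bar>) / b) \<le> norm w1 * s"
      by (rule mult_left_mono) simp
    also have "norm w1 * s = norm (w1 * (of_int m + of_int n * \<tau>))"
      by (simp only: s_def norm_mult)
    also have "w1 * (of_int m + of_int n * \<tau>) = of_int m * w1 + of_int n * w2"
      using assms(1) by (simp add: \<tau>_def distrib_left)
    finally show "norm w1 / b * (\<bar>of_int m\<bar> + \<bar>of_int n\<bar>) \<le> norm (of_int m * w1 + of_int n * w2)"
      by simp
  qed
qed

lemma finite_lattice_ball: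
  assumes "is_lattice L"
  shows "finite {w \<in> L. norm w \<le> r}"
proof -
  obtain w1 w2 where w: "w1 \<noteq> 0" "Im (w2 / w1) \<noteq> 0" "L = lattice_gen w1 w2"
    using assms by (auto simp: is_lattice_def)
  obtain c where c: "c > 0" "\<And>m n :: int. c * (\<bar>of_int m\<bar> + \<bar>of_int n\<bar>) \<le> norm (of_int m * w1 + of_int n * w2)"
    using lattice_norm_lower_bound[OF w(1,2)] by blast
  define K where "K = \<lfloor>r / c\<rfloor>"
  have "{w \<in> L. norm w \<le> r} \<subseteq> (\<lambda>(m, n). of_int m * w1 + of_int n * w2) ` ({-K..K} \<times> {-K..K})"
  proof
    fix z assume "z \<in> {w \<in> L. norm w \<le> r}"
    then obtain m n where z: "z = of_int m * w1 + of_int n * w2" "norm z \<le> r"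
      by (auto simp: w lattice_gen_def)
    have "(\<bar>of_int m\<bar> + \<bar>of_int n\<bar>) \<le> r / c" using c(2)[of m n] z c(1) by (simp add: field_simps)
    then have "\<bar>of_int m\<bar> \<le> r / c" "\<bar>of_int n\<bar> \<le> r / c" by linarith+
    then have "\<bar>m\<bar> \<le> K" "\<bar>n\<bar> \<le> K" unfolding K_def by (simp_all add: le_floor_iff)
    then show "z \<in> (\<lambda>(m, n). of_int m * w1 + of_int n * w2) ` ({-K..K} \<times> {-K..K})"
      unfolding z(1) by (intro image_eqI[of _ _ "(m, n)"]) auto
  qed
  then show ?thesis by (rule finite_subset) auto
qed

text \<open>The exponent 3 of the lattice sum is shared equally by the two coordinates; 3/2 > 1
  keeps each one-dimensional series convergent.\<close>

lemma summable_on_int_pairs: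
  "(\<lambda>(m, n). (1 + \<bar>of_int m\<bar>) powr (-3/2) * (1 + \<bar>of_int n\<bar>) powr (-3/2) :: real) summable_on (UNIV :: (int \<times> int) set)"
proof -
  define a :: "int \<Rightarrow> real" where "a m = (1 + \<bar>of_int m\<bar>) powr (-3/2)" for m
  have "summable (\<lambda>k. real (Suc k) powr (-3/2))"
    using summable_real_powr_iff[of "-3/2"] by (subst summable_Suc_iff) simp
  then have sk: "(\<lambda>k. a (int k)) summable_on UNIV"
    by (subst summable_on_UNIV_nonneg_real_iff) (auto simp: a_def add_ac)
  have "a summable_on range int"
    using sk by (subst summable_on_reindex) (auto simp: o_def)
  moreover have "a summable_on range (\<lambda>k. - int k)"
    using sk by (subst summable_on_reindex) (auto simp: o_def inj_on_def a_def)
  ultimately have "a summable_on (range int \<union> range (\<lambda>k. - int k))"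
    by (rule summable_on_union)
  also have "range int \<union> range (\<lambda>k. - int k) = UNIV"
    by (auto simp: image_def) (metis int_cases2)
  finally have a: "a summable_on UNIV" .
  define f where "f = (\<lambda>(m, n). a m * a n)"
  have "f summable_on UNIV \<times> UNIV"
  proof (rule summable_on_SigmaI[where g = "\<lambda>m. a m * infsum a UNIV"])
    show "((\<lambda>n. f (m, n)) has_sum a m * infsum a UNIV) UNIV" for m
      unfolding f_def case_prod_conv using a by (intro has_sum_cmult_right has_sum_infsum)
    show "(\<lambda>m. a m * infsum a UNIV) summable_on UNIV" using a by (rule summable_on_cmult_left)
  qed (auto simp: a_def f_def)
  then show ?thesis by (simp add: f_def a_def)
qed

lemma summable_lattice_cubes:
  assumes "is_lattice L"
  shows "(\<lambda>w. 1 / norm w ^ 3) summable_on L"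
proof -
  obtain w1 w2 where w: "w1 \<noteq> 0" "Im (w2 / w1) \<noteq> 0" "L = lattice_gen w1 w2"
    using assms by (auto simp: is_lattice_def)
  obtain c where c: "c > 0" "\<And>m n :: int. c * (\<bar>of_int m\<bar> + \<bar>of_int n\<bar>) \<le> norm (of_int m * w1 + of_int n * w2)"
    using lattice_norm_lower_bound[OF w(1,2)] by blast
  define e :: "int \<times> int \<Rightarrow> complex" where "e = (\<lambda>(m, n). of_int m * w1 + of_int n * w2)"
  have L: "L = e ` UNIV" by (auto simp: w lattice_gen_def e_def)
  have inj: "inj e"
  proof (rule injI)
    fix p q assume "e p = e q"
    then have "of_int (fst p - fst q) * w1 + of_int (snd p - snd q) * w2 = 0"
      by (simp add: e_def case_prod_beta algebra_simps)
    then have "\<bar>of_int (fst p - fst q)\<bar> + \<bar>of_int (snd p - snd q)\<bar> \<le> (0::real)"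
      using c(2)[of "fst p - fst q" "snd p - snd q"] c(1)
      by (simp add: mult_le_0_iff del: of_int_diff)
    then have "fst p - fst q = 0" "snd p - snd q = 0" by linarith+
    then show "p = q" by (simp add: prod_eq_iff)
  qed
  have "(\<lambda>p. 1 / norm (e p) ^ 3) summable_on UNIV"
  proof (rule summable_on_comparison_test)
    show "(\<lambda>p. 8 / c ^ 3 * (case p of (m, n) \<Rightarrow> (1 + \<bar>of_int m\<bar>) powr (-3/2) * (1 + \<bar>of_int n\<bar>) powr (-3/2))) summable_on UNIV"
      by (rule summable_on_cmult_right[OF summable_on_int_pairs])
    fix p :: "int \<times> int"
    obtain m n where p: "p = (m, n)" by (cases p)
    define s :: real where "s = \<bar>of_int m\<bar> + \<bar>of_int n\<bar>"
    show "1 / norm (e p) ^ 3 \<le> 8 / c ^ 3 * (case p of (m, n) \<Rightarrow> (1 + \<bar>of_int m\<bar>) powr (-3/2) * (1 + \<bar>of_int n\<bar>) powr (-3/2))"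
    proof (cases "p = (0, 0)")
      case True
      \<comment> \<open>At the origin the summand is \<open>1 / 0 = 0\<close>.\<close>
      then show ?thesis using c by (simp add: e_def)
    next
      case False
      have "\<bar>m\<bar> + \<bar>n\<bar> \<ge> 1" using False p by auto
      then have s1: "s \<ge> 1" unfolding s_def by linarith
      \<comment> \<open>\<open>P\<close> is at most 4 s^2 for s >= 1; raising to the power 3/2 gives
        the constant 8 = 4^(3/2) of the majorant.\<close>
      define P :: real where "P = (1 + \<bar>of_int m\<bar>) * (1 + \<bar>of_int n\<bar>)"
      have "P = 1 + s + \<bar>of_int m\<bar> * \<bar>of_int n\<bar>" by (simp add: P_def s_def algebra_simps)
      also have "\<bar>of_int m\<bar> * \<bar>of_int n\<bar> \<le> s * s" unfolding s_def by (intro mult_mono) auto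
      also have "1 + s + s * s \<le> 4 * (s * s)"
      proof -
        have "1 * s \<le> s * s" using s1 by (intro mult_right_mono) auto
        then show ?thesis using s1 by linarith
      qed
      finally have P: "P \<le> 4 * s\<^sup>2" by (simp add: power2_eq_square)
      have P1: "P > 0" by (auto simp: P_def intro!: mult_pos_pos add_pos_nonneg)
      have "P powr (3/2) \<le> (4 * s\<^sup>2) powr (3/2)" using P P1 by (intro powr_mono2) auto
      also have "(4 * s\<^sup>2) = (2 * s) powr 2" using s1 by (simp add: power2_eq_square)
      also have "((2 * s) powr 2) powr (3/2) = (2 * s) powr 3" by (simp add: powr_powr)
      also have "\<dots> = 8 * s ^ 3" using s1 by (simp add: power_mult_distrib)
      finally have Ps: "P powr (3/2) \<le> 8 * s ^ 3" .
      have "(c * s) ^ 3 \<le> norm (e p) ^ 3"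
        using c(2)[of m n] c(1) s1 by (intro power_mono) (auto simp: e_def p s_def)
      moreover have "0 < (c * s) ^ 3" using c(1) s1 by simp
      ultimately have "1 / norm (e p) ^ 3 \<le> 1 / (c * s) ^ 3"
        by (intro divide_left_mono mult_pos_pos) auto
      also have "\<dots> = 8 / c ^ 3 * (1 / (8 * s ^ 3))" by (simp add: power_mult_distrib)
      also have "\<dots> \<le> 8 / c ^ 3 * (1 / P powr (3/2))"
        using Ps P1 c(1) s1 by (intro mult_left_mono divide_left_mono) auto
      also have "1 / P powr (3/2) = (1 + \<bar>of_int m\<bar>) powr (-3/2) * (1 + \<bar>of_int n\<bar>) powr (-3/2)"
        unfolding P_def by (simp add: powr_mult powr_minus_divide)
      finally show ?thesis by (simp add: p)
    qed
  qed auto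
  then show ?thesis unfolding L using summable_on_reindex[OF inj, of "\<lambda>w. 1 / norm w ^ 3"] by (simp only: o_def)
qed

section \<open>Convergence and periodicity of the Weierstrass series\<close>

definition wp_term :: "complex \<Rightarrow> complex \<Rightarrow> complex" where
  "wp_term z w = 1 / (z - w)\<^sup>2 - 1 / w\<^sup>2"

text \<open>The difference of fractions equals z (2 w - z) / ((z - w)^2 w^2). Under the hypotheses
  |2 w - z| <= 5/2 |w| and |z - w| >= |w| / 2, whence the constant 10 = (5/2) * 4.\<close>

lemma wp_term_bound:
  assumes "norm z \<le> R" "2 * R \<le> norm w" "0 < R"
  shows "norm (wp_term z w) \<le> 10 * R / norm w ^ 3"
proof -
  have w0: "w \<noteq> 0" and nw: "norm w > 0" using assms by auto
  have zw: "norm (z - w) \<ge> norm w / 2"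
    using norm_triangle_ineq2[of w z] assms by (simp add: norm_minus_commute)
  then have zw0: "z \<noteq> w" using nw by auto
  have "wp_term z w = z * (2 * w - z) / ((z - w)\<^sup>2 * w\<^sup>2)"
    using w0 zw0 by (simp add: wp_term_def divide_simps) (simp add: power2_eq_square algebra_simps)
  then have "norm (wp_term z w) = norm z * norm (2 * w - z) / (norm (z - w) ^ 2 * norm w ^ 2)"
    by (simp add: norm_mult norm_divide norm_power)
  also have "\<dots> \<le> R * (5 / 2 * norm w) / ((norm w / 2) ^ 2 * norm w ^ 2)"
  proof (rule frac_le)
    have "norm (2 * w - z) \<le> norm (2 * w) + norm z" by (rule norm_triangle_ineq4)
    then have "norm (2 * w - z) \<le> 5 / 2 * norm w" using assms by (simp add: norm_mult)
    then show "norm z * norm (2 * w - z) \<le> R * (5 / 2 * norm w)" using assms by (intro mult_mono) auto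
    show "(norm w / 2) ^ 2 * norm w ^ 2 \<le> norm (z - w) ^ 2 * norm w ^ 2"
      using zw by (intro mult_right_mono power_mono) auto
  qed (use assms nw in auto)
  also have "\<dots> = 10 * R / norm w ^ 3"
    using nw by (simp add: field_simps power2_eq_square power3_eq_cube)
  finally show ?thesis .
qed

lemma wp_term_summable:
  assumes L: "is_lattice L" and A: "A \<subseteq> L"
  shows "wp_term z summable_on A"
proof -
  define R where "R = norm z + 1"
  have R: "R > 0" "norm z \<le> R" by (auto simp: R_def add_nonneg_pos)
  let ?A1 = "{w \<in> A. norm w \<le> 2 * R}" and ?A2 = "{w \<in> A. norm w > 2 * R}"
  have "finite ?A1" by (rule finite_subset[OF _ finite_lattice_ball[OF L, of "2 * R"]]) (use A in auto)
  then have 1: "wp_term z summable_on ?A1" by simp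
  have "(\<lambda>w. 10 * R / norm w ^ 3) summable_on ?A2"
    using summable_on_cmult_right[OF summable_on_subset_banach[OF summable_lattice_cubes[OF L]], of ?A2 "10 * R"] A
    by auto
  then have "(\<lambda>w. norm (wp_term z w)) summable_on ?A2"
    by (rule Infinite_Sum.abs_summable_on_comparison_test') (use R in \<open>auto intro!: wp_term_bound\<close>)
  then have 2: "wp_term z summable_on ?A2" by (rule abs_summable_summable)
  have "wp_term z summable_on (?A1 \<union> ?A2)" using 1 2 by (rule summable_on_union)
  also have "?A1 \<union> ?A2 = A" by auto
  finally show ?thesis .
qed

text \<open>Stated for every subset of the lattice, so that the term of a single pole can be left
  out. Near z0 the finitely many terms with |w| <= 2 R are differentiated one by one; the others
  have no pole in the unit disc about z0, and their sum converges uniformly there.\<close>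

lemma wp_term_infsum_holomorphic:
  assumes L: "is_lattice L" and A: "A \<subseteq> L"
  shows "(\<lambda>z. infsum (wp_term z) A) holomorphic_on - A"
proof -
  have "(\<lambda>z. infsum (wp_term z) A) field_differentiable at z0" if z0: "z0 \<notin> A" for z0
  proof -
    define R where "R = norm z0 + 1"
    have R: "R > 0" by (auto simp: R_def add_nonneg_pos)
    have zR: "norm z \<le> R" if "z \<in> cball z0 1" for z
      using that norm_triangle_ineq[of "z - z0" z0] by (simp add: R_def dist_norm norm_minus_commute)
    let ?A1 = "{w \<in> A. norm w \<le> 2 * R}" and ?A2 = "{w \<in> A. norm w > 2 * R}"
    have fin: "finite ?A1" by (rule finite_subset[OF _ finite_lattice_ball[OF L, of "2 * R"]]) (use A in auto)
    have "(\<lambda>w. 10 * R / norm w ^ 3) summable_on ?A2"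
      using summable_on_cmult_right[OF summable_on_subset_banach[OF summable_lattice_cubes[OF L]], of ?A2 "10 * R"] A
    by auto
    then have ul: "uniform_limit (cball z0 1) (\<lambda>X z. \<Sum>w\<in>X. wp_term z w) (\<lambda>z. infsum (wp_term z) ?A2) (finite_subsets_at_top ?A2)"
      by (rule Weierstrass_m_test_general[rotated])
         (use R zR in \<open>auto intro!: wp_term_bound\<close>)
    have hol: "(\<lambda>z. \<Sum>w\<in>X. wp_term z w) holomorphic_on cball z0 1" if "X \<subseteq> ?A2" for X
      unfolding wp_term_def
    proof (intro holomorphic_intros)
      fix w z assume "w \<in> X" "z \<in> cball z0 1"
      then have "norm w > 2 * R" "norm z \<le> R" using that zR by auto
      then show "(z - w)\<^sup>2 \<noteq> 0" using R by auto
    qed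
    have "(\<lambda>z. infsum (wp_term z) ?A2) holomorphic_on ball z0 1"
    proof (rule holomorphic_uniform_limit[OF _ ul])
      show "\<forall>\<^sub>F X in finite_subsets_at_top ?A2. continuous_on (cball z0 1) (\<lambda>z. \<Sum>w\<in>X. wp_term z w) \<and>
         (\<lambda>z. \<Sum>w\<in>X. wp_term z w) holomorphic_on ball z0 1"
        by (rule eventually_finite_subsets_at_top_weakI)
           (metis hol holomorphic_on_imp_continuous_on holomorphic_on_subset ball_subset_cball)
    qed auto
    then have "(\<lambda>z. infsum (wp_term z) ?A2) field_differentiable at z0"
      by (rule holomorphic_on_imp_differentiable_at) auto
    moreover have "(\<lambda>z. \<Sum>w\<in>?A1. wp_term z w) field_differentiable at z0"
      unfolding wp_term_def using z0 by (intro derivative_intros field_differentiable_sum) auto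
    ultimately have "(\<lambda>z. (\<Sum>w\<in>?A1. wp_term z w) + infsum (wp_term z) ?A2) field_differentiable at z0"
      by (intro field_differentiable_add)
    moreover have "(\<Sum>w\<in>?A1. wp_term z w) + infsum (wp_term z) ?A2 = infsum (wp_term z) A" for z
    proof -
      have "infsum (wp_term z) (?A1 \<union> ?A2) = infsum (wp_term z) ?A1 + infsum (wp_term z) ?A2"
        by (intro infsum_Un_disjoint wp_term_summable[OF L]) (use A in auto)
      moreover have "?A1 \<union> ?A2 = A" by auto
      ultimately show ?thesis using fin by simp
    qed
    ultimately show ?thesis by simp
  qed
  then show ?thesis
    unfolding holomorphic_on_def by (blast intro: field_differentiable_at_within)
qed

lemma wp_altdef: "wp L z = 1 / z\<^sup>2 + infsum (wp_term z) (L - {0})"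
  by (simp add: wp_def wp_term_def[abs_def])

text \<open>With \<open>1 / 0 = 0\<close> the term at w = 0 is 1 / z^2. So the leading summand of
  \<open>wp\<close> becomes an ordinary lattice term, and any lattice point can be singled out in
  place of 0.\<close>

lemma wp_split:
  assumes L: "is_lattice L" and "\<omega> \<in> L"
  shows wp_eq_infsum: "wp L z = infsum (wp_term z) L"
    and "wp L z = wp_term z \<omega> + infsum (wp_term z) (L - {\<omega>})"
proof -
  have *: "infsum (wp_term z) L = wp_term z a + infsum (wp_term z) (L - {a})" if "a \<in> L" for a
  proof -
    have "infsum (wp_term z) ({a} \<union> (L - {a})) = infsum (wp_term z) {a} + infsum (wp_term z) (L - {a})"
      by (intro infsum_Un_disjoint wp_term_summable[OF L]) (use that in auto)
    moreover have "{a} \<union> (L - {a}) = L" using that by auto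
    ultimately show ?thesis by simp
  qed
  show "wp L z = infsum (wp_term z) L"
    using *[OF zero_in_lattice[OF L]] by (simp add: wp_altdef wp_term_def)
  then show "wp L z = wp_term z \<omega> + infsum (wp_term z) (L - {\<omega>})" using *[OF assms(2)] by simp
qed

lemma wp_holomorphic:
  assumes L: "is_lattice L"
  shows "wp L holomorphic_on - L"
proof -
  have "wp L = (\<lambda>z. infsum (wp_term z) L)"
    using wp_eq_infsum[OF L zero_in_lattice[OF L]] by (rule ext)
  then show ?thesis using wp_term_infsum_holomorphic[OF L order_refl] by simp
qed

text \<open>Shifting the summation index by \<open>\<omega>\<close> gives \<open>wp L (z + \<omega>) = wp L z - wp L (- \<omega>)\<close>, and the
  substitution of \<open>- w - \<omega>\<close> for \<open>w\<close> shows that \<open>wp L (- \<omega>)\<close> is its own negative. (With the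
  convention \<open>1 / 0 = 0\<close> this even holds at the poles.)\<close>
lemma wp_periodic:
  assumes L: "is_lattice L" and \<omega>: "\<omega> \<in> L"
  shows "wp L (z + \<omega>) = wp L z"
proof -
  have "infsum (\<lambda>w. wp_term (- \<omega>) (- w - \<omega>)) L = infsum (wp_term (- \<omega>)) L"
    by (rule infsum_reindex_bij_betw, rule bij_betwI[where g = "\<lambda>w. - w - \<omega>"])
       (use L \<omega> in \<open>auto intro: lattice_diff lattice_uminus\<close>)
  moreover have "wp_term (- \<omega>) (- w - \<omega>) = - wp_term (- \<omega>) w" for w
  proof -
    have "(- \<omega> - w)\<^sup>2 = (- w - \<omega>)\<^sup>2" by (simp add: power2_eq_square algebra_simps)
    then show ?thesis by (simp add: wp_term_def)
  qed
  ultimately have "wp L (- \<omega>) = - wp L (- \<omega>)"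
    by (simp add: wp_eq_infsum[OF L \<omega>] infsum_uminus)
  then have zero: "wp L (- \<omega>) = 0" by simp
  have "wp L (z + \<omega>) = infsum (\<lambda>w. wp_term (z + \<omega>) (w + \<omega>)) L"
    unfolding wp_eq_infsum[OF L \<omega>]
    by (rule infsum_reindex_bij_betw[symmetric], rule bij_betwI[where g = "\<lambda>w. w - \<omega>"])
       (use L \<omega> in \<open>auto intro: lattice_diff lattice_add\<close>)
  also have "(\<lambda>w. wp_term (z + \<omega>) (w + \<omega>)) = (\<lambda>w. wp_term z w - wp_term (- \<omega>) w)"
  proof
    fix w
    have "(- \<omega> - w)\<^sup>2 = (w + \<omega>)\<^sup>2" by (simp add: power2_eq_square algebra_simps)
    then show "wp_term (z + \<omega>) (w + \<omega>) = wp_term z w - wp_term (- \<omega>) w"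
      by (simp add: wp_term_def)
  qed
  also have "infsum \<dots> L = wp L z - wp L (- \<omega>)"
    unfolding wp_eq_infsum[OF L \<omega>] 
    using infsum_add[OF wp_term_summable[OF L order_refl] summable_on_uminus[THEN iffD2, OF wp_term_summable[OF L order_refl]], of z "- \<omega>"]
    by (simp add: infsum_uminus)
  finally show ?thesis using zero by simp
qed

lemma cnj_wp:
  shows "cnj (wp L z) = wp (cnj ` L) (cnj z)"
proof -
  have eq: "cnj ` L - {0} = cnj ` (L - {0})" by auto
  have "infsum (\<lambda>w. 1 / (cnj z - w)\<^sup>2 - 1 / w\<^sup>2) (cnj ` (L - {0})) = infsum (\<lambda>w. cnj (1 / (z - w)\<^sup>2 - 1 / w\<^sup>2)) (L - {0})"
    by (subst infsum_reindex) (auto simp: inj_on_def o_def)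
  then show ?thesis by (simp only: wp_def eq infsum_cnj) simp
qed

section \<open>Poles, quotient representation and level sets of \<open>wp\<close>\<close>

lemma closed_subset_lattice:
  assumes L: "is_lattice L" and "A \<subseteq> L"
  shows "closed A"
proof -
  have "\<not> x islimpt A" for x
  proof
    assume "x islimpt A"
    then have "infinite (A \<inter> ball x 1)" by (simp add: islimpt_eq_infinite_ball)
    moreover have "A \<inter> ball x 1 \<subseteq> {w \<in> L. norm w \<le> norm x + 1}"
    proof
      fix w assume w: "w \<in> A \<inter> ball x 1"
      have "norm w \<le> norm x + norm (w - x)" by (rule norm_triangle_sub)
      with w show "w \<in> {w \<in> L. norm w \<le> norm x + 1}"
        using assms(2) by (auto simp: dist_norm norm_minus_commute)
    qed
    ultimately show False using finite_lattice_ball[OF L] finite_subset by blast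
  qed
  then show ?thesis by (simp add: closed_limpt)
qed

text \<open>At a lattice point only the summand with that pole is singular; the remaining sum is
  analytic there.\<close>

lemma wp_meromorphic:
  assumes L: "is_lattice L"
  shows "wp L meromorphic_on A"
proof -
  have "wp L meromorphic_on {z}" for z
  proof (cases "z \<in> L")
    case True
    have "(\<lambda>w. infsum (wp_term w) (L - {z})) holomorphic_on - (L - {z})"
      by (intro wp_term_infsum_holomorphic[OF L]) auto
    then have "(\<lambda>w. infsum (wp_term w) (L - {z})) analytic_on {z}"
      unfolding analytic_at using open_Compl[OF closed_subset_lattice[OF L Diff_subset[of L "{z}"]]]
      by (intro exI[of _ "- (L - {z})"]) simp
    then have "(\<lambda>w. wp_term w z + infsum (wp_term w) (L - {z})) meromorphic_on {z}"
      unfolding wp_term_def by (intro meromorphic_intros analytic_on_imp_meromorphic_on) auto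
    then show ?thesis by (simp add: wp_split(2)[OF L True, abs_def])
  next
    case False
    then have "wp L analytic_on {z}"
      unfolding analytic_at using closed_subset_lattice[OF L, of L] wp_holomorphic[OF L]
      by (intro exI[of _ "- L"]) (simp add: open_Compl)
    then show ?thesis by (rule analytic_on_imp_meromorphic_on)
  qed
  then show ?thesis using meromorphic_on_meromorphic_at by blast
qed

lemma wp_analytic: "is_lattice L \<Longrightarrow> z \<notin> L \<Longrightarrow> wp L analytic_on {z}"
  unfolding analytic_at using closed_subset_lattice[of L L] wp_holomorphic[of L]
  by (intro exI[of _ "- L"]) (simp add: open_Compl)

text \<open>Entire numerator and denominator are wanted because division by \<open>F\<close> applies
  to entire functions of w. \<open>remove_sings\<close> brings the function into the form that the
  factorization theorem expects; off the lattice it changes nothing.\<close>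

lemma wp_quotient:
  assumes L: "is_lattice L"
  obtains A B where "A holomorphic_on UNIV" "B holomorphic_on UNIV"
    "\<And>z. z \<notin> L \<Longrightarrow> B z \<noteq> 0" "\<And>z. z \<notin> L \<Longrightarrow> wp L z = A z / B z"
proof -
  let ?g = "remove_sings (wp L)"
  have "?g nicely_meromorphic_on UNIV"
    by (rule remove_sings_nicely_meromorphic[OF wp_meromorphic[OF L]])
  then obtain h f1 f2 where h: "h holomorphic_on UNIV" "f1 holomorphic_on UNIV" "f2 holomorphic_on UNIV"
    "\<forall>z. f2 z = 0 \<longleftrightarrow> is_pole ?g z" "\<forall>z. ?g z = h z * f1 z / f2 z"
    by (rule weierstrass_factorization_meromorphic_UNIV)
  have g: "?g z = wp L z" "\<not> is_pole ?g z" if "z \<notin> L" for z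
    using wp_analytic[OF L that] analytic_at_imp_no_pole[of "wp L" z]
      is_pole_remove_sings_iff[OF isolated_singularity_at_analytic[of "wp L" z]] by auto
  show ?thesis
  proof (rule that[of "\<lambda>z. h z * f1 z" f2])
    show "(\<lambda>z. h z * f1 z) holomorphic_on UNIV" using h by (intro holomorphic_intros)
    show "f2 z \<noteq> 0" "wp L z = h z * f1 z / f2 z" if "z \<notin> L" for z using h(4,5) g[OF that] by auto
  qed (rule h)
qed

text \<open>A constant value would make 1 / w^2 a difference of functions that stay bounded near
  0.\<close>

lemma wp_not_constant:
  assumes L: "is_lattice L"
  shows "\<not> (\<forall>z. z \<notin> L \<longrightarrow> wp L z = c)"
proof
  assume c: "\<forall>z. z \<notin> L \<longrightarrow> wp L z = c"
  have open0: "open (- (L - {0}))" by (rule open_Compl[OF closed_subset_lattice[OF L Diff_subset]])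
  have "(\<lambda>w. infsum (wp_term w) (L - {0})) holomorphic_on - (L - {0})"
    by (intro wp_term_infsum_holomorphic[OF L]) auto
  then have "continuous_on (- (L - {0})) (\<lambda>w. infsum (wp_term w) (L - {0}))"
    by (rule holomorphic_on_imp_continuous_on)
  then have "isCont (\<lambda>w. infsum (wp_term w) (L - {0})) 0"
    using open0 by (auto simp: continuous_on_eq_continuous_at)
  then have lim: "(\<lambda>w. infsum (wp_term w) (L - {0})) \<midarrow>0\<rightarrow> infsum (wp_term 0) (L - {0})"
    by (simp add: isCont_def)
  have ev: "\<forall>\<^sub>F w in at 0. w \<in> - (L - {0}) - {0}"
    using eventually_at_in_open[OF open0, of 0] by simp
  have "(\<lambda>w. c - infsum (wp_term w) (L - {0})) \<midarrow>0\<rightarrow> c - infsum (wp_term 0) (L - {0})"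
    by (intro tendsto_intros lim)
  moreover have "\<forall>\<^sub>F w in at 0. c - infsum (wp_term w) (L - {0}) = 1 / w\<^sup>2"
    using ev by eventually_elim (use c in \<open>auto simp: wp_altdef\<close>)
  ultimately have "((\<lambda>w::complex. 1 / w\<^sup>2) \<longlongrightarrow> c - infsum (wp_term 0) (L - {0})) (at 0)"
    by (rule Lim_transform_eventually)
  moreover have "filterlim (\<lambda>w::complex. 1 / w\<^sup>2) at_infinity (at 0)"
  proof -
    have "is_pole (\<lambda>w::complex. 1 / (w - 0) ^ 2) 0" by (rule is_pole_inverse_power) simp
    then show ?thesis by (simp add: is_pole_def)
  qed
  ultimately show False using not_tendsto_and_filterlim_at_infinity[of "at (0::complex)"] by auto
qed

text \<open>An uncountable level set would force the entire functions A and y B to coincide, making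
  \<open>wp\<close> constant.\<close>

lemma wp_level_set_countable:
  assumes L: "is_lattice L"
  shows "countable {z. z \<notin> L \<and> wp L z = y}"
proof (rule ccontr)
  assume "\<not> ?thesis"
  then have unc: "uncountable {z \<in> - L. wp L z = y}" by simp
  obtain A B where AB: "A holomorphic_on UNIV" "B holomorphic_on UNIV"
    "\<And>z. z \<notin> L \<Longrightarrow> B z \<noteq> 0" "\<And>z. z \<notin> L \<Longrightarrow> wp L z = A z / B z"
    using wp_quotient[OF L] by blast
  have "{z \<in> - L. wp L z = y} \<subseteq> {z. A z = y * B z}"
    using AB(3,4) by (auto simp: field_simps)
  then have "uncountable {z. A z = y * B z}" using unc countable_subset by blast
  then have "A = (\<lambda>z. y * B z)"
    using AB by (intro holomorphic_countable_equal_UNIV) (auto intro!: holomorphic_intros)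
  then have "wp L z = y" if "z \<notin> L" for z using AB(3,4)[OF that] by simp
  then show False using wp_not_constant[OF L] by blast
qed

lemma lattice_cocompact:
  assumes "is_lattice L"
  obtains r where "\<And>z. \<exists>\<omega>\<in>L. norm (z - \<omega>) \<le> r"
proof -
  obtain w1 w2 where w: "w1 \<noteq> 0" "Im (w2 / w1) \<noteq> 0" "L = lattice_gen w1 w2"
    using assms by (auto simp: is_lattice_def)
  show ?thesis
  proof (rule that)
    fix z
    define \<tau> where "\<tau> = w2 / w1"
    define b where "b = Im (z / w1) / Im \<tau>"
    define a where "a = Re (z / w1) - b * Re \<tau>"
    have "Im \<tau> \<noteq> 0" using w(2) by (simp only: \<tau>_def not_False_eq_True)
    then have "z / w1 = of_real a + of_real b * \<tau>"
      unfolding complex_eq_iff by (simp add: a_def b_def)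
    then have "z = (of_real a + of_real b * \<tau>) * w1" using w(1) by (metis nonzero_divide_eq_eq)
    moreover have "\<tau> * w1 = w2" using w(1) by (simp add: \<tau>_def)
    ultimately have z: "z = of_real a * w1 + of_real b * w2"
      by (simp only: distrib_right mult.assoc)
    let ?\<omega> = "of_int \<lfloor>a\<rfloor> * w1 + of_int \<lfloor>b\<rfloor> * w2"
    have "z - ?\<omega> = of_real (a - of_int \<lfloor>a\<rfloor>) * w1 + of_real (b - of_int \<lfloor>b\<rfloor>) * w2"
      by (simp add: z algebra_simps)
    also have "norm \<dots> \<le> \<bar>a - of_int \<lfloor>a\<rfloor>\<bar> * norm w1 + \<bar>b - of_int \<lfloor>b\<rfloor>\<bar> * norm w2"
      by (rule order_trans[OF norm_triangle_ineq]) (simp only: norm_mult norm_of_real order_refl)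
    also have "\<dots> \<le> 1 * norm w1 + 1 * norm w2"
    proof -
      have "\<bar>a - of_int \<lfloor>a\<rfloor>\<bar> \<le> 1" "\<bar>b - of_int \<lfloor>b\<rfloor>\<bar> \<le> 1" by linarith+
      then show ?thesis by (intro add_mono mult_right_mono norm_ge_zero)
    qed
    finally have "norm (z - ?\<omega>) \<le> norm w1 + norm w2" by simp
    moreover have "?\<omega> \<in> L" unfolding w lattice_gen_def by blast
    ultimately show "\<exists>\<omega>\<in>L. norm (z - \<omega>) \<le> norm w1 + norm w2" by blast
  qed
qed

text \<open>By periodicity every solution has a representative in a fixed disc, where the entire
  function A - y B has finitely many zeros.\<close>

lemma wp_level_set_finite_mod:
  assumes L: "is_lattice L"
  shows "\<exists>T. finite T \<and> (\<forall>w. w \<notin> L \<longrightarrow> wp L w = y \<longrightarrow> (\<exists>t\<in>T. w - t \<in> L))"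
proof -
  obtain A B where AB: "A holomorphic_on UNIV" "B holomorphic_on UNIV"
    "\<And>z. z \<notin> L \<Longrightarrow> B z \<noteq> 0" "\<And>z. z \<notin> L \<Longrightarrow> wp L z = A z / B z"
    using wp_quotient[OF L] by blast
  define k where "k z = A z - y * B z" for z
  obtain r where r: "\<And>z. \<exists>\<omega>\<in>L. norm (z - \<omega>) \<le> r" using lattice_cocompact[OF L] by blast
  define T where "T = {z \<in> cball 0 r. k z = 0}"
  have zero: "k z = 0 \<longleftrightarrow> wp L z = y" if "z \<notin> L" for z
    using AB(3)[OF that] by (simp add: k_def AB(4)[OF that] divide_eq_eq)
  have "finite T"
  proof (cases "k constant_on UNIV")
    case True
    then obtain c where c: "\<And>z. k z = c" by (auto simp: constant_on_def)
    have "c \<noteq> 0" using wp_not_constant[OF L, of y] zero c by blast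
    then show ?thesis by (simp add: T_def c)
  next
    case False
    have "k holomorphic_on UNIV" unfolding k_def using AB by (intro holomorphic_intros)
    then show ?thesis unfolding T_def
      by (rule holomorphic_compact_finite_zeros) (use False in auto)
  qed
  moreover have "\<exists>t\<in>T. w - t \<in> L" if w: "w \<notin> L" "wp L w = y" for w
  proof -
    obtain \<omega> where \<omega>: "\<omega> \<in> L" "norm (w - \<omega>) \<le> r" using r by blast
    have "w - \<omega> \<notin> L" using lattice_add[OF L, of "w - \<omega>" \<omega>] \<omega>(1) w(1) by auto
    moreover have "wp L (w - \<omega>) = y"
      using wp_periodic[OF L \<omega>(1), of "w - \<omega>"] w(2) by simp
    ultimately have "w - \<omega> \<in> T" using \<omega>(2) zero by (simp add: T_def)
    then show ?thesis using \<omega>(1) by (intro bexI[of _ "w - \<omega>"]) auto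
  qed
  ultimately show ?thesis by blast
qed

section \<open>Infinite bialgebraic sets are lines\<close>

abbreviation zz :: "real \<times> real \<Rightarrow> complex" where
  "zz p \<equiv> Complex (fst p) (snd p)"

lemma inj_zz: "inj_on zz S"
  by (auto simp: inj_on_def prod_eq_iff)

lemma cnj_zz: "cnj (zz p) = Complex (fst p) (- snd p)"
  by (simp add: complex_eq_iff)

lemma evc_cnj: "evc F p = ev F (zz p) (cnj (zz p))"
  by (simp add: evc_def cnj_zz)

text \<open>At such z the relation \<open>G\<close> puts no condition on the conjugate value, so
  these z have to be avoided.\<close>

lemma countable_wp_bad:
  assumes L: "is_lattice L" and G: "G \<noteq> 0"
  shows "countable {z. z \<notin> L \<and> slice G (wp L z) = 0}"
proof -
  have "{z. z \<notin> L \<and> slice G (wp L z) = 0} = (\<Union>y\<in>{y. slice G y = 0}. {z. z \<notin> L \<and> wp L z = y})"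
    by auto
  then show ?thesis
    using slice_eq_0_finite[OF G] wp_level_set_countable[OF L] by (simp add: countable_finite)
qed

text \<open>Generic translates of the curve \<open>F = 0\<close> by lattice vectors all meet the finite set \<open>T\<close> modulo
  the lattice over a fixed abscissa, so two of them share a generic point and hence coincide.\<close>
lemma translate_invariance:
  assumes L: "is_lattice L" and M: "is_lattice M"
    and F: "prime_elem F" "degree F \<ge> 1" and G: "G \<noteq> 0"
    and ae: "countable {z. \<not> (\<exists>w. ev F z w = 0 \<and> (w \<notin> M \<longrightarrow> ev G (wp L z) (wp M w) = 0))}"
    and l: "l \<in> L" "l \<noteq> 0"
  shows "\<exists>k::int. \<exists>\<nu>\<in>M. \<exists>x0 y0. k \<noteq> 0 \<and> (\<forall>x y. ev F x y = 0 \<longleftrightarrow> of_int k * l * (y - y0) = \<nu> * (x - x0))"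
proof -
  define N where "N = {z. \<not> (\<exists>w. ev F z w = 0 \<and> (w \<notin> M \<longrightarrow> ev G (wp L z) (wp M w) = 0))}"
  \<comment> \<open>Abscissae where the curve meets a translate that does not contain it. A
    translate containing the curve is given the empty set, which keeps every
    \<open>P \<tau> \<nu>\<close> finite.\<close>
  define P where "P \<tau> \<nu> = (if F dvd shift \<tau> \<nu> F then {} else {x. \<exists>y. ev F x y = 0 \<and> ev (shift \<tau> \<nu> F) x y = 0})" for \<tau> \<nu>
  have finP: "finite (P \<tau> \<nu>)" for \<tau> \<nu> unfolding P_def using finite_common_zeros[OF F] by auto
  let ?bad = "L \<union> {z. z \<notin> L \<and> slice G (wp L z) = 0} \<union> (\<Union>c\<in>L. (\<lambda>x. x - c) ` N) \<union>
     (\<Union>c\<in>L. \<Union>\<tau>\<in>L. \<Union>\<nu>\<in>M. (\<lambda>x. x - c) ` P \<tau> \<nu>)"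
  have "countable ?bad"
    using countable_lattice[OF L] countable_lattice[OF M] countable_wp_bad[OF L G] ae finP
    by (intro countable_Un countable_UN countable_image) (auto simp: N_def countable_finite)
  then have "?bad \<noteq> UNIV" using uncountable_UNIV_complex by metis
  then obtain z0 where z0: "z0 \<notin> ?bad" by blast
  then have z0': "z0 \<notin> L" "slice G (wp L z0) \<noteq> 0" by auto
  have zN: "z0 + c \<notin> N" if "c \<in> L" for c
  proof
    assume "z0 + c \<in> N"
    then have "z0 \<in> (\<lambda>x. x - c) ` N" by (intro image_eqI[of _ _ "z0 + c"]) simp_all
    then show False using z0 that by blast
  qed
  have zP: "z0 + c \<notin> P \<tau> \<nu>" if "c \<in> L" "\<tau> \<in> L" "\<nu> \<in> M" for c \<tau> \<nu>
  proof
    assume "z0 + c \<in> P \<tau> \<nu>"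
    then have "z0 \<in> (\<lambda>x. x - c) ` P \<tau> \<nu>" by (intro image_eqI[of _ _ "z0 + c"]) simp_all
    then have "z0 \<in> ?bad" by (intro UnI2 UN_I[OF that(1)] UN_I[OF that(2)] UN_I[OF that(3)])
    then show False using z0 by contradiction
  qed
  have nl: "of_int n * l \<in> L" for n using lattice_of_int_mult[OF L l(1)] .
  have "\<forall>n::int. \<exists>w. ev F (z0 + of_int n * l) w = 0 \<and>
      (w \<notin> M \<longrightarrow> ev G (wp L (z0 + of_int n * l)) (wp M w) = 0)"
  proof
    fix n :: int
    show "\<exists>w. ev F (z0 + of_int n * l) w = 0 \<and>
      (w \<notin> M \<longrightarrow> ev G (wp L (z0 + of_int n * l)) (wp M w) = 0)"
      using zN[OF nl[of n]] unfolding N_def mem_Collect_eq not_not .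
  qed
  then obtain w where w: "\<And>n::int. ev F (z0 + of_int n * l) (w n) = 0"
    "\<And>n. w n \<notin> M \<Longrightarrow> ev G (wp L z0) (wp M (w n)) = 0"
    unfolding wp_periodic[OF L nl] choice_iff by blast
  \<comment> \<open>Periodicity has replaced \<open>wp L (z0 + of_int n * l)\<close> by
    \<open>wp L z0\<close>, so the candidates for \<open>wp M (w n)\<close> form one finite set for
    all n.\<close>
  define Y where "Y = {y. poly (slice G (wp L z0)) y = 0}"
  have finY: "finite Y" unfolding Y_def using z0'(2) by (rule poly_roots_finite)
  obtain Ty where Ty: "\<And>y. finite (Ty y)" "\<And>y w. w \<notin> M \<Longrightarrow> wp M w = y \<Longrightarrow> \<exists>t\<in>Ty y. w - t \<in> M"
    using wp_level_set_finite_mod[OF M] by metis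
  \<comment> \<open>The representative 0 serves the roots that lie in \<open>M\<close>, where the
    relation is not asserted.\<close>
  define T where "T = insert 0 (\<Union>y\<in>Y. Ty y)"
  have finT: "finite T" using finY Ty(1) by (simp add: T_def)
  have "\<exists>t\<in>T. w n - t \<in> M" for n
  proof (cases "w n \<in> M")
    case False
    then have "wp M (w n) \<in> Y" using w(2) by (simp add: Y_def poly_slice)
    then show ?thesis using Ty(2)[OF False refl] by (auto simp: T_def)
  qed (simp add: T_def)
  then obtain t where t: "\<And>n. t n \<in> T" "\<And>n. w n - t n \<in> M" by metis
  have "\<not> inj t"
  proof
    assume "inj t"
    moreover have "finite (range t)" using finT t(1) finite_subset by (metis image_subsetI)
    ultimately have "finite (UNIV :: int set)" using finite_imageD by blast
    then show False by simp
  qed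
  then obtain n m where nm: "t n = t m" "n \<noteq> m" by (auto simp: inj_def)
  define \<tau> where "\<tau> = of_int (m - n) * l"
  define \<nu> where "\<nu> = w m - w n"
  have \<tau>: "\<tau> \<in> L" "\<tau> \<noteq> 0" using nl l nm by (auto simp: \<tau>_def simp del: of_int_diff)
  have "\<nu> = (w m - t m) - (w n - t n)" by (simp add: \<nu>_def nm)
  then have \<nu>: "\<nu> \<in> M" using t(2) lattice_diff[OF M] by metis
  have "ev (shift \<tau> \<nu> F) (z0 + of_int n * l) (w n) = 0"
    using w(1)[of m] by (simp add: ev_shift \<tau>_def \<nu>_def algebra_simps)
  then have "F dvd shift \<tau> \<nu> F"
    using zP[OF nl[of n] \<tau>(1) \<nu>] w(1)[of n] unfolding P_def by (auto split: if_splits)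
  then have "ev F x y = 0 \<longleftrightarrow> \<tau> * (y - w n) = \<nu> * (x - (z0 + of_int n * l))" for x y
    using zeros_line_if_dvd_shift[OF F _ \<tau>(2) w(1)[of n]] by blast
  moreover have "m - n \<noteq> 0" using nm by simp
  ultimately show ?thesis using \<nu> unfolding \<tau>_def by blast
qed

text \<open>Real line through v in conjugate coordinates: a direction u is encoded by \<alpha> =
  conj u / u, which is unchanged by real scaling. The set is a line exactly when |\<alpha>| = 1; for
  other \<alpha> it is the point v.\<close>

definition cline :: "complex \<Rightarrow> complex \<Rightarrow> (real \<times> real) set" where
  "cline \<alpha> v = {p. cnj (zz p - v) = \<alpha> * (zz p - v)}"

lemma wpP_zz: "zz (wpP L p) = wp L (zz p)"
  by (simp add: wpP_def complex_eq_iff)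

text \<open>\<open>translate_invariance\<close> is applied to every nonzero lattice vector. One
  vector fixes the line; the others describe the same zero set and so give the arithmetic condition
  for the same \<alpha>.\<close>

lemma infinite_bialgebraic_linear:
  assumes L: "is_lattice L" and S: "irred_alg S" "S \<noteq> UNIV" "infinite S"
    and W: "proper_real_alg_set W" "wpP L ` (S \<inter> {p. zz p \<notin> L}) \<subseteq> W"
  shows "\<exists>\<alpha> \<beta>. (\<forall>p\<in>S. cnj (zz p) = \<alpha> * zz p + \<beta>) \<and>
    (\<forall>l\<in>L. l \<noteq> 0 \<longrightarrow> (\<exists>k::int. k \<noteq> 0 \<and> of_int k * \<alpha> * l \<in> cnj ` L))"
proof -
  define M where "M = cnj ` L"
  have M: "is_lattice M" unfolding M_def by (rule is_lattice_cnj[OF L])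
  obtain F where F: "prime_elem F" "degree F \<ge> 1" "\<And>p. p \<in> S \<Longrightarrow> evc F p = 0"
    using irred_alg_prime_poly[OF S] by blast
  obtain Ws g where g: "W = zero_set Ws" "g \<in> Ws" "g \<noteq> 0"
    using W(1) by (auto simp: proper_real_alg_set_def)
  obtain G where G: "G \<noteq> 0" "\<And>p. evc G p = of_real (eval2 g p)"
    using complexify_nonzero[OF g(3)] by blast
  have G0: "ev G (wp L (zz p)) (wp M (cnj (zz p))) = 0" if "p \<in> S" "zz p \<notin> L" for p
  proof -
    have "wpP L p \<in> W" using that W(2) by blast
    then have "eval2 g (wpP L p) = 0" using g by (auto simp: zero_set_def)
    then have "evc G (wpP L p) = 0" by (simp add: G)
    then show ?thesis by (simp add: evc_cnj wpP_zz cnj_wp M_def)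
  qed
  obtain A B where AB: "A holomorphic_on UNIV" "B holomorphic_on UNIV"
    "\<And>z. z \<notin> M \<Longrightarrow> B z \<noteq> 0" "\<And>z. z \<notin> M \<Longrightarrow> wp M z = A z / B z"
    using wp_quotient[OF M] by blast
  define b where "b = degree G"
  \<comment> \<open>The factor \<open>B w ^ b\<close>, with b the degree of \<open>G\<close> in its
    outer variable, clears the denominators of \<open>wp M w = A w / B w\<close>. On
    \<open>M\<close> this factor may vanish, so a zero of \<open>E\<close> gives the relation only
    for w outside \<open>M\<close>.\<close>
  define E where "E z w = (\<Sum>j\<le>b. poly (coeff G j) (wp L z) * (B w ^ (b - j) * A w ^ j))" for z w
  have E: "E z w = B w ^ b * ev G (wp L z) (wp M w)" if "w \<notin> M" for z w
  proof -
    have "B w ^ (b - j) * A w ^ j = B w ^ b * (A w / B w) ^ j" if "j \<le> b" for j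
      using AB(3)[OF \<open>w \<notin> M\<close>] that by (simp add: power_divide power_diff)
    then show ?thesis
      unfolding E_def ev_altdef AB(4)[OF that] b_def sum_distrib_left by (intro sum.cong) auto
  qed
  have "countable {z. \<not> (\<exists>w. ev F z w = 0 \<and> E z w = 0)}"
  proof (rule propagate_common_zeros[OF F(1,2), where ?U0.0 = "- L"])
    show "open (- L)" using closed_subset_lattice[OF L order_refl] by (rule open_Compl)
    have "connected (UNIV - L)"
      by (rule connected_open_diff_countable) (use countable_lattice[OF L] in auto)
    then show "connected (- L)" by (simp add: Compl_eq_Diff_UNIV)
    show "countable (- (- L))" using countable_lattice[OF L] by simp
    show "(\<lambda>z. poly (coeff G j) (wp L z)) holomorphic_on - L" for j
      using wp_holomorphic[OF L] by (intro holomorphic_intros)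
    show "(\<lambda>w. B w ^ (b - j) * A w ^ j) holomorphic_on UNIV" for j
      using AB by (intro holomorphic_intros)
    show "E z w = (\<Sum>j\<le>b. poly (coeff G j) (wp L z) * (B w ^ (b - j) * A w ^ j))" for z w
      by (rule E_def)
    have "zz ` S - L \<subseteq> {z \<in> - L. \<exists>w. ev F z w = 0 \<and> E z w = 0}"
    proof
      fix z assume "z \<in> zz ` S - L"
      then obtain p where p: "p \<in> S" "z = zz p" "zz p \<notin> L" by auto
      have "cnj z \<notin> M" using p unfolding M_def by (metis complex_cnj_cnj imageE)
      then have "E z (cnj z) = 0" using G0[OF p(1,3)] p(2) E by simp
      moreover have "ev F z (cnj z) = 0" using F(3)[OF p(1)] p(2) by (simp only: evc_cnj)
      ultimately show "z \<in> {z \<in> - L. \<exists>w. ev F z w = 0 \<and> E z w = 0}" using p by blast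
    qed
    moreover have "uncountable (zz ` S)"
      using irred_alg_uncountable[OF S] inj_zz countable_image_inj_on by blast
    then have "uncountable (zz ` S - L)"
      using countable_lattice[OF L] by (simp add: uncountable_minus_countable)
    ultimately show "uncountable {z \<in> - L. \<exists>w. ev F z w = 0 \<and> E z w = 0}"
      using countable_subset by blast
  qed
  moreover have "{z. \<not> (\<exists>w. ev F z w = 0 \<and> (w \<notin> M \<longrightarrow> ev G (wp L z) (wp M w) = 0))}
     \<subseteq> {z. \<not> (\<exists>w. ev F z w = 0 \<and> E z w = 0)}"
    using E AB(3) by auto
  ultimately have ae: "countable {z. \<not> (\<exists>w. ev F z w = 0 \<and> (w \<notin> M \<longrightarrow> ev G (wp L z) (wp M w) = 0))}"
    by (rule countable_subset[rotated])
  note line = translate_invariance[OF L M F(1,2) G(1) ae]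
  obtain l1 where l1: "l1 \<in> L" "l1 \<noteq> 0"
    using L by (auto simp: is_lattice_def lattice_gen_def) (metis mult_1 mult_zero_left add.right_neutral of_int_0 of_int_1)
  obtain k1 \<nu>1 x1 y1 where k1: "k1 \<noteq> 0" "\<And>x y. ev F x y = 0 \<longleftrightarrow> of_int k1 * l1 * (y - y1) = \<nu>1 * (x - x1)"
    using line[OF l1] by blast
  define \<alpha> where "\<alpha> = \<nu>1 / (of_int k1 * l1)"
  define \<beta> where "\<beta> = y1 - \<alpha> * x1"
  have zero: "ev F x y = 0 \<longleftrightarrow> y = \<alpha> * x + \<beta>" for x y
  proof -
    have "of_int k1 * l1 \<noteq> 0" using k1 l1 by simp
    then have "ev F x y = 0 \<longleftrightarrow> y - y1 = \<alpha> * (x - x1)"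
      by (auto simp: k1(2) \<alpha>_def field_simps)
    then show ?thesis by (auto simp: \<beta>_def algebra_simps)
  qed
  show ?thesis
  proof (rule exI[of _ \<alpha>], rule exI[of _ \<beta>], intro conjI ballI impI)
    show "cnj (zz p) = \<alpha> * zz p + \<beta>" if "p \<in> S" for p
      using F(3)[OF that] unfolding evc_cnj zero .
    fix l assume l: "l \<in> L" "l \<noteq> 0"
    obtain k \<nu> x0 y0 where k: "k \<noteq> 0" "\<nu> \<in> M" "\<And>x y. ev F x y = 0 \<longleftrightarrow> of_int k * l * (y - y0) = \<nu> * (x - x0)"
      using line[OF l] by blast
    \<comment> \<open>Comparing the points of the line over x = 0 and x = 1 gives \<nu> = k \<alpha>
      l.\<close>
    have eq: "of_int k * l * (\<beta> - y0) = \<nu> * (0 - x0)" "of_int k * l * (\<alpha> + \<beta> - y0) = \<nu> * (1 - x0)"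
      using k(3)[of 0 \<beta>] k(3)[of 1 "\<alpha> + \<beta>"] by (simp_all add: zero)
    have "of_int k * \<alpha> * l = of_int k * l * (\<alpha> + \<beta> - y0) - of_int k * l * (\<beta> - y0)"
      by (simp add: algebra_simps)
    also have "\<dots> = \<nu>" unfolding eq by (simp add: algebra_simps)
    finally have "of_int k * \<alpha> * l = \<nu>" .
    then show "\<exists>k::int. k \<noteq> 0 \<and> of_int k * \<alpha> * l \<in> cnj ` L" using k unfolding M_def by blast
  qed
qed

section \<open>Real lines as algebraic sets\<close>

lemma restrict_to_line:
  fixes f :: "real poly poly"
  shows "\<exists>q. \<forall>t. poly q t = ev f (x + t * a) (y + t * b)"
proof (induction f)
  case 0
  show ?case by (rule exI[of _ 0]) simp
next
  case (pCons c f)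
  then obtain q where q: "\<And>t. poly q t = ev f (x + t * a) (y + t * b)" by blast
  show ?case
    by (rule exI[of _ "pcompose c [:x, a:] + [:y, b:] * q"]) (simp add: poly_pcompose q algebra_simps)
qed

lemma line_subset_if_infinite:
  assumes "infinite {t. (x + t * a, y + t * b) \<in> zero_set Fs}"
  shows "(x + t * a, y + t * b) \<in> zero_set Fs"
proof -
  have "ev f (x + t * a) (y + t * b) = 0" if "f \<in> Fs" for f
  proof -
    obtain q where q: "\<And>t. poly q t = ev f (x + t * a) (y + t * b)"
      using restrict_to_line by blast
    have "{t. (x + t * a, y + t * b) \<in> zero_set Fs} \<subseteq> {t. poly q t = 0}"
      using that by (auto simp: q zero_set_def eval2_ev)
    then have "infinite {t. poly q t = 0}" using assms finite_subset by blast
    then have "q = 0" using poly_roots_finite by blast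
    then show ?thesis using q[of t] by simp
  qed
  then show ?thesis by (auto simp: zero_set_def eval2_ev)
qed

lemma cline_param:
  assumes "u \<noteq> 0" "cnj u = \<alpha> * u"
  shows "cline \<alpha> v = range (\<lambda>t. (Re v + t * Re u, Im v + t * Im u))"
proof (intro equalityI subsetI)
  fix p assume "p \<in> cline \<alpha> v"
  then have p: "cnj (zz p - v) = \<alpha> * (zz p - v)" by (simp add: cline_def)
  define c where "c = (zz p - v) / u"
  have "\<alpha> \<noteq> 0" using assms by auto
  then have "cnj c = c" unfolding c_def complex_cnj_divide p assms(2) by simp
  then have "c = of_real (Re c)" by (simp add: complex_eq_iff)
  then have "zz p = v + of_real (Re c) * u" using assms(1) c_def by (metis add_diff_cancel_left' diff_add_cancel nonzero_eq_divide_eq add.commute)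
  then show "p \<in> range (\<lambda>t. (Re v + t * Re u, Im v + t * Im u))"
    by (intro image_eqI[of _ _ "Re c"]) (auto simp: prod_eq_iff complex_eq_iff)
next
  fix p assume "p \<in> range (\<lambda>t. (Re v + t * Re u, Im v + t * Im u))"
  then obtain t where "p = (Re v + t * Re u, Im v + t * Im u)" by blast
  then have "zz p - v = of_real t * u" by (simp add: complex_eq_iff)
  then show "p \<in> cline \<alpha> v"
    by (simp only: cline_def mem_Collect_eq complex_cnj_mult complex_cnj_complex_of_real assms(2) mult.left_commute)
qed

text \<open>In the real parameter of the line each defining equation is a one-variable polynomial
  with infinitely many roots.\<close>

lemma subset_cline_eq:
  assumes S: "real_alg_set S" "infinite S" and "S \<subseteq> cline \<alpha> v" and u: "u \<noteq> 0" "cnj u = \<alpha> * u"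
  shows "S = cline \<alpha> v"
proof -
  obtain Fs where Fs: "S = zero_set Fs" using S by (auto simp: real_alg_set_def)
  let ?f = "\<lambda>t. (Re v + t * Re u, Im v + t * Im u)"
  have "infinite {t. ?f t \<in> S}"
  proof
    assume "finite {t. ?f t \<in> S}"
    moreover have "S \<subseteq> ?f ` {t. ?f t \<in> S}" using assms(3) unfolding cline_param[OF u] by auto
    ultimately show False using S(2) finite_surj by blast
  qed
  then have "?f t \<in> S" for t unfolding Fs by (rule line_subset_if_infinite)
  then show ?thesis using assms(3) unfolding cline_param[OF u] by auto
qed

text \<open>The difference u of two points of S satisfies conj u = \<alpha> u, and comparing norms
  gives |\<alpha>| = 1. So S lies on a real line and, being infinite and algebraic, fills
  it.\<close>

lemma infinite_bialgebraic_is_cline: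
  assumes L: "is_lattice L" and S: "irred_alg S" "S \<noteq> UNIV" "infinite S"
    and W: "proper_real_alg_set W" "wpP L ` (S \<inter> {p. zz p \<notin> L}) \<subseteq> W"
  shows "\<exists>\<alpha> v. norm \<alpha> = 1 \<and> S = cline \<alpha> v \<and>
    (\<forall>l\<in>L. l \<noteq> 0 \<longrightarrow> (\<exists>k::int. k \<noteq> 0 \<and> of_int k * \<alpha> * l \<in> cnj ` L))"
proof -
  obtain \<alpha> \<beta> where ab: "\<And>p. p \<in> S \<Longrightarrow> cnj (zz p) = \<alpha> * zz p + \<beta>"
    "\<forall>l\<in>L. l \<noteq> 0 \<longrightarrow> (\<exists>k::int. k \<noteq> 0 \<and> of_int k * \<alpha> * l \<in> cnj ` L)"
    using infinite_bialgebraic_linear[OF assms] by blast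
  obtain p where p: "p \<in> S" using S(3) by (metis finite.emptyI ex_in_conv)
  have "\<not> S \<subseteq> {p}" using S(3) finite_subset by blast
  then obtain q where q: "q \<in> S" "q \<noteq> p" by blast
  define u where "u = zz q - zz p"
  have u: "u \<noteq> 0" using q by (auto simp: u_def complex_eq_iff prod_eq_iff)
  have cu: "cnj u = \<alpha> * u" using ab(1)[OF p] ab(1)[OF q(1)] by (simp add: u_def algebra_simps)
  have "norm (cnj u) = norm \<alpha> * norm u" unfolding cu by (rule norm_mult)
  then have "norm \<alpha> = 1" using u by simp
  moreover have "S \<subseteq> cline \<alpha> (zz p)"
    using ab(1)[OF p] ab(1) by (auto simp: cline_def algebra_simps)
  then have "S = cline \<alpha> (zz p)"
    using S u cu by (intro subset_cline_eq) (auto simp: irred_alg_def)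
  ultimately show ?thesis using ab(2) by blast
qed

section \<open>Algebraic dependence of elliptic functions\<close>

lemma homogeneous_system_nontrivial_solution:
  fixes a :: "'k \<Rightarrow> 'i \<Rightarrow> 'a::field"
  assumes "finite K" "finite I" "card K < card I"
  shows "\<exists>c. (\<exists>i\<in>I. c i \<noteq> 0) \<and> (\<forall>k\<in>K. (\<Sum>i\<in>I. a k i * c i) = 0)"
  using assms
proof (induction K arbitrary: I a rule: finite_induct)
  case empty
  then obtain i where "i \<in> I" by fastforce
  then show ?case by (intro exI[of _ "\<lambda>_. 1"]) auto
next
  case (insert k K)
  show ?case
  proof (cases "\<forall>i\<in>I. a k i = 0")
    case True
    have "card K < card I" using insert by simp
    then obtain c where "\<exists>i\<in>I. c i \<noteq> 0" "\<forall>k\<in>K. (\<Sum>i\<in>I. a k i * c i) = 0"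
      using insert.IH[of I a] insert.prems by blast
    then show ?thesis using True by (intro exI[of _ c]) auto
  next
    case False
    then obtain p where p: "p \<in> I" "a k p \<noteq> 0" by blast
    define J where "J = I - {p}"
    have J: "finite J" "p \<notin> J" "I = insert p J" using p insert.prems by (auto simp: J_def)
    have "card K < card J" using insert J by simp
    \<comment> \<open>Gaussian elimination: equation \<open>k\<close> removes the unknown
      \<open>p\<close> from the other equations and afterwards determines it.\<close>
    then obtain c where c: "\<exists>i\<in>J. c i \<noteq> 0"
      "\<forall>k'\<in>K. (\<Sum>i\<in>J. (a k' i - a k' p * a k i / a k p) * c i) = 0"
      using insert.IH[of J "\<lambda>k' i. a k' i - a k' p * a k i / a k p"] J by blast
    define s where "s = (\<Sum>i\<in>J. a k i * c i)"
    define d where "d = c(p := - s / a k p)"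
    have sum_d: "(\<Sum>i\<in>I. a k' i * d i) = a k' p * (- s / a k p) + (\<Sum>i\<in>J. a k' i * c i)" for k'
    proof -
      have "(\<Sum>i\<in>J. a k' i * d i) = (\<Sum>i\<in>J. a k' i * c i)"
        using J by (intro sum.cong) (auto simp: d_def)
      then show ?thesis using J by (simp add: d_def)
    qed
    have "(\<Sum>i\<in>I. a k' i * d i) = 0" if "k' \<in> K" for k'
    proof -
      have "0 = (\<Sum>i\<in>J. a k' i * c i - a k' p / a k p * (a k i * c i))"
        using c(2) that by (simp add: algebra_simps)
      also have "\<dots> = (\<Sum>i\<in>J. a k' i * c i) - a k' p / a k p * s"
        by (simp add: sum_subtractf s_def sum_distrib_left)
      finally show ?thesis by (simp add: sum_d)
    qed
    moreover have "(\<Sum>i\<in>I. a k i * d i) = 0" using p by (simp add: sum_d s_def)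
    moreover have "\<exists>i\<in>I. d i \<noteq> 0"
    proof -
      obtain i where "i \<in> J" "c i \<noteq> 0" using c(1) by blast
      then have "i \<in> I" "d i \<noteq> 0" using J by (auto simp: d_def)
      then show ?thesis by blast
    qed
    ultimately show ?thesis by (intro exI[of _ d]) auto
  qed
qed

text \<open>Only finitely many linear conditions on the coefficients are needed to cancel all principal parts
  in \<open>\<Sum> c\<^sub>i\<^sub>j f\<^sup>i g\<^sup>j\<close> (their number grows linearly with the degree bound, the number
  of coefficients quadratically); the remaining function is bounded and entire.\<close>
lemma elliptic_functions_alg_dependent:
  assumes M: "is_lattice M"
    and f: "f meromorphic_on UNIV" "\<And>z \<omega>. \<omega> \<in> M \<Longrightarrow> f (z + \<omega>) = f z"
    and g: "g meromorphic_on UNIV" "\<And>z \<omega>. \<omega> \<in> M \<Longrightarrow> g (z + \<omega>) = g z"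
  shows "\<exists>n c. (\<exists>i<n. \<exists>j<n. c i j \<noteq> 0) \<and>
    (\<forall>z. f analytic_on {z} \<longrightarrow> g analytic_on {z} \<longrightarrow> (\<Sum>i<n. \<Sum>j<n. c i j * (f z ^ i * g z ^ j)) = 0)"
proof -
  obtain r where r: "\<And>z. \<exists>\<omega>\<in>M. norm (z - \<omega>) \<le> r" using lattice_cocompact[OF M] by blast
  \<comment> \<open>Every point is congruent to one in this disc. Radius at least 1 makes the disc
    infinite, so it contains a point \<open>z1\<close> off the finite set of singularities.\<close>
  define K where "K = cball (0::complex) (max r 1)"
  have K: "\<exists>\<omega>\<in>M. z - \<omega> \<in> K" for z using r[of z] by (force simp: K_def)
  have compK: "compact K" by (simp add: K_def)
  define P where "P = K \<inter> ({w. \<not> f analytic_on {w}} \<union> {w. \<not> g analytic_on {w}})"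
  have "finite (K \<inter> {w. \<not> h analytic_on {w}})" if "h meromorphic_on UNIV" for h
    using sparse_in_compact_finite[OF sparse_in_subset[OF meromorphic_on_imp_sparse_singularities[OF that]] compK] by simp
  then have finP: "finite P" using f(1) g(1) unfolding P_def Int_Un_distrib by simp
  have infK: "infinite K"
  proof -
    have "uncountable (cball (0::complex) (max r 1))" by (rule uncountable_cball) simp
    then show ?thesis unfolding K_def using countable_finite by blast
  qed
  then obtain z1 where z1: "z1 \<in> K" "z1 \<notin> P" using finP by (meson finite_subset subsetI)
  then have z1: "f analytic_on {z1}" "g analytic_on {z1}" by (auto simp: P_def)
  define lf where "lf = laurent_expansion f"
  define lg where "lg = laurent_expansion g"
  have lf: "(\<lambda>w. f (p + w)) has_laurent_expansion lf p" for p
    using f(1) by (simp add: meromorphic_on_def' lf_def)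
  have lg: "(\<lambda>w. g (p + w)) has_laurent_expansion lg p" for p
    using g(1) by (simp add: meromorphic_on_def' lg_def)
  \<comment> \<open>A common bound for the pole orders of \<open>f\<close> and \<open>g\<close> on
    \<open>P\<close>; each product of powers below \<open>n\<close> then has pole order at most 2 n
    m.\<close>
  define m where "m = (\<Sum>p\<in>P. nat \<bar>fls_subdegree (lf p)\<bar> + nat \<bar>fls_subdegree (lg p)\<bar>)"
  have m: "fls_subdegree (lf p) \<ge> - int m" "fls_subdegree (lg p) \<ge> - int m" if "p \<in> P" for p
  proof -
    have "nat \<bar>fls_subdegree (lf p)\<bar> + nat \<bar>fls_subdegree (lg p)\<bar> \<le> m"
      unfolding m_def using finP that by (intro member_le_sum) auto
    then show "fls_subdegree (lf p) \<ge> - int m" "fls_subdegree (lg p) \<ge> - int m" by linarith+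
  qed
  \<comment> \<open>The n^2 unknowns exceed the 2 n m |P| + 1 conditions, since n^2 = 2 n m |P| + 2
    n.\<close>
  define n where "n = 2 * m * card P + 2"
  define I where "I = {..<n} \<times> {..<n}"
  have low: "fls_nth (lf p ^ i * lg p ^ j) k = 0" if "p \<in> P" "i < n" "j < n" "k < - int (2 * n * m)" for p i j k
  proof (cases "lf p ^ i = 0 \<or> lg p ^ j = 0")
    case False
    have "int i * - int m \<le> int i * fls_subdegree (lf p)" "int j * - int m \<le> int j * fls_subdegree (lg p)"
      using m[OF that(1)] by (intro mult_left_mono; simp)+
    moreover have "int i * int m \<le> int n * int m" "int j * int m \<le> int n * int m"
      using that by (intro mult_right_mono; simp)+
    ultimately have "- int (2 * n * m) \<le> int i * fls_subdegree (lf p) + int j * fls_subdegree (lg p)"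
      by (simp add: algebra_simps)
    then have "- int (2 * n * m) \<le> fls_subdegree (lf p ^ i * lg p ^ j)"
      using False by (simp add: fls_subdegree_pow)
    then show ?thesis using that(4) by simp
  next
    case True
    then have "lf p ^ i * lg p ^ j = 0" by (simp only: mult_eq_0_iff)
    then show ?thesis by (simp only: fls_zero_nth)
  qed
  \<comment> \<open>\<open>Some (p, l)\<close> asks that the coefficient of order -l at p vanish;
    \<open>None\<close> asks for a zero at \<open>z1\<close>, which makes the final constant
    0.\<close>
  define E where "E = insert None (Some ` (P \<times> {1..2 * n * m}))"
  define a where "a k ij = (case k of None \<Rightarrow> f z1 ^ fst ij * g z1 ^ snd ij
     | Some (p, l) \<Rightarrow> fls_nth (lf p ^ fst ij * lg p ^ snd ij) (- int l))" for k :: "(complex \<times> nat) option" and ij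
  have "card E \<le> Suc (card P * (2 * n * m))"
    unfolding E_def using finP by (intro card_insert_le_m1[THEN order_trans]) (auto simp: card_image card_cartesian_product)
  also have "\<dots> < card I" by (simp add: I_def card_cartesian_product n_def algebra_simps)
  finally have "card E < card I" .
  moreover have "finite E" "finite I" using finP by (simp_all add: E_def I_def)
  ultimately obtain c where c: "\<exists>i\<in>I. c i \<noteq> 0" "\<forall>k\<in>E. (\<Sum>i\<in>I. a k i * c i) = 0"
    using homogeneous_system_nontrivial_solution[of E I a] by blast
  define H where "H z = (\<Sum>ij\<in>I. c ij * (f z ^ fst ij * g z ^ snd ij))" for z
  have Hz1: "H z1 = 0" using c(2) by (auto simp: E_def a_def H_def mult.commute)
  have Hmero: "H meromorphic_on UNIV" unfolding H_def using f(1) g(1) by (intro meromorphic_intros)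
  have Hper: "H (z + \<omega>) = H z" if "\<omega> \<in> M" for z \<omega> using f(2)[OF that] g(2)[OF that] by (simp add: H_def)
  have Hana: "H analytic_on {z}" if "f analytic_on {z}" "g analytic_on {z}" for z
    unfolding H_def using that by (intro analytic_intros)
  have lim0: "\<exists>l. H \<midarrow>z\<rightarrow> l" if "z \<in> K" for z
  proof (cases "z \<in> P")
    case False
    then have "H analytic_on {z}" using that by (intro Hana) (auto simp: P_def)
    then have "isCont H z" by (simp add: analytic_at_imp_isCont)
    then show ?thesis by (auto simp: isCont_def)
  next
    case True
    define lH where "lH = (\<Sum>ij\<in>I. fls_const (c ij) * (lf z ^ fst ij * lg z ^ snd ij))"
    have lH: "(\<lambda>w. H (z + w)) has_laurent_expansion lH"
      unfolding H_def lH_def using lf lg by (intro laurent_expansion_intros)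
    have "fls_nth lH k = 0" if "k < 0" for k
    proof -
      have "fls_nth lH k = (\<Sum>ij\<in>I. c ij * fls_nth (lf z ^ fst ij * lg z ^ snd ij) k)"
        by (simp add: lH_def fls_nth_sum)
      also have "\<dots> = 0"
      proof (cases "k < - int (2 * n * m)")
        case True
        then show ?thesis using low[OF \<open>z \<in> P\<close>] by (intro sum.neutral) (auto simp: I_def)
      next
        case False
        define l where "l = nat (- k)"
        have l: "k = - int l" "l \<in> {1..2 * n * m}" using False \<open>k < 0\<close> by (auto simp: l_def nat_le_iff simp del: of_nat_mult)
        then have "Some (z, l) \<in> E" using True by (auto simp: E_def)
        then have "(\<Sum>ij\<in>I. a (Some (z, l)) ij * c ij) = 0" using c(2) by blast
        then show ?thesis by (simp add: a_def l(1) mult.commute)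
      qed
      finally show ?thesis .
    qed
    then have "fls_subdegree lH \<ge> 0" by (rule fls_subdegree_ge0I)
    then show ?thesis using has_laurent_expansion_imp_tendsto[OF lH] by blast
  qed
  have lim: "\<exists>l. H \<midarrow>z\<rightarrow> l" for z
  proof -
    obtain \<omega> where \<omega>: "\<omega> \<in> M" "z - \<omega> \<in> K" using K by blast
    obtain l where "H \<midarrow>(z - \<omega>)\<rightarrow> l" using lim0[OF \<omega>(2)] by blast
    then have "(\<lambda>x. H (x + - \<omega>)) \<midarrow>(z - \<omega> - - \<omega>)\<rightarrow> l" by (rule LIM_offset)
    moreover have "H (x + - \<omega>) = H x" for x using Hper lattice_uminus[OF M \<omega>(1)] by blast
    ultimately show ?thesis by auto
  qed
  \<comment> \<open>\<open>H\<close> has a limit everywhere, but its values at singular points of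
    \<open>f\<close> and \<open>g\<close> may be arbitrary; \<open>h\<close> is the entire function
    formed by the limits.\<close>
  define h where "h = remove_sings H"
  have h_ana: "h analytic_on {z}" for z
  proof -
    have "isolated_singularity_at H z" using Hmero by (auto simp: meromorphic_on_altdef)
    then show ?thesis unfolding h_def using lim remove_sings_analytic_at by blast
  qed
  then have h_hol: "h holomorphic_on UNIV"
    using analytic_imp_holomorphic analytic_on_analytic_at by blast
  have h_per: "h (z + \<omega>) = h z" if "\<omega> \<in> M" for z \<omega>
  proof -
    obtain l where l: "H \<midarrow>(z + \<omega>)\<rightarrow> l" using lim by blast
    then have "(\<lambda>x. H (x + \<omega>)) \<midarrow>(z + \<omega> - \<omega>)\<rightarrow> l" by (rule LIM_offset)
    then have "H \<midarrow>z\<rightarrow> l" using Hper[OF that] by simp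
    then show ?thesis using l remove_sings_eqI unfolding h_def by metis
  qed
  have "range h = h ` K"
  proof
    show "range h \<subseteq> h ` K"
    proof clarify
      fix z
      obtain \<omega> where \<omega>: "\<omega> \<in> M" "z - \<omega> \<in> K" using K by blast
      then have "h z = h (z - \<omega>)" using h_per[OF \<omega>(1), of "z - \<omega>"] by simp
      then show "h z \<in> h ` K" using \<omega>(2) by blast
    qed
  qed auto
  moreover have "compact (h ` K)"
    by (rule compact_continuous_image[OF holomorphic_on_imp_continuous_on compK])
       (rule holomorphic_on_subset[OF h_hol], simp)
  ultimately have "bounded (range h)" by (simp add: compact_imp_bounded)
  then have "h constant_on UNIV" using h_hol by (intro Liouville_theorem)
  then have h_const: "h z = h z1" for z by (auto simp: constant_on_def)
  have hH: "h z = H z" if "f analytic_on {z}" "g analytic_on {z}" for z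
    unfolding h_def by (rule remove_sings_at_analytic[OF Hana[OF that]])
  have "H z = 0" if "f analytic_on {z}" "g analytic_on {z}" for z
    using hH[OF that] hH[OF z1] h_const[of z] Hz1 by simp
  moreover have "H z = (\<Sum>i<n. \<Sum>j<n. c (i, j) * (f z ^ i * g z ^ j))" for z
    unfolding H_def I_def by (simp add: sum.cartesian_product case_prod_beta)
  moreover have "\<exists>i<n. \<exists>j<n. c (i, j) \<noteq> 0" using c(1) by (auto simp: I_def)
  ultimately show ?thesis by (intro exI[of _ n] exI[of _ "\<lambda>i j. c (i, j)"]) auto
qed

section \<open>Bialgebraic lines\<close>

lemma exists_cnj_eq_mult:
  assumes "norm \<alpha> = 1"
  obtains u where "u \<noteq> 0" "cnj u = \<alpha> * u"
\<comment> \<open>If s^2 = \<alpha> and |s| = 1, then \<alpha> conj s = s (s conj s) = s, so u =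
  conj s works.\<close>
proof (rule that[of "cnj (csqrt \<alpha>)"])
  have "norm (csqrt \<alpha>) = 1" using assms by (simp add: norm_csqrt)
  then have unit: "csqrt \<alpha> * cnj (csqrt \<alpha>) = 1" by (simp flip: complex_norm_square)
  then show "cnj (csqrt \<alpha>) \<noteq> 0" by auto
  have "\<alpha> * cnj (csqrt \<alpha>) = csqrt \<alpha> * (csqrt \<alpha> * cnj (csqrt \<alpha>))"
    by (metis mult.assoc power2_csqrt power2_eq_square)
  then show "cnj (cnj (csqrt \<alpha>)) = \<alpha> * cnj (csqrt \<alpha>)" by (simp add: unit)
qed

lemma real_alg_set_cline: "real_alg_set (cline \<alpha> v)"
proof -
  define F where "F = [:[:\<alpha> * v - cnj v, - \<alpha>:], 1:]"
  obtain f g where fg: "\<And>x y. ev F (Complex x y) (Complex x (- y)) = Complex (ev f x y) (ev g x y)"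
    using real_imag_parts by blast
  have "p \<in> cline \<alpha> v \<longleftrightarrow> eval2 f p = 0 \<and> eval2 g p = 0" for p
  proof -
    have "p \<in> cline \<alpha> v \<longleftrightarrow> cnj (zz p) + (\<alpha> * v - cnj v - \<alpha> * zz p) = 0"
      by (simp add: cline_def algebra_simps)
    also have "\<dots> \<longleftrightarrow> ev F (zz p) (cnj (zz p)) = 0" by (simp add: F_def algebra_simps)
    also have "\<dots> \<longleftrightarrow> eval2 f p = 0 \<and> eval2 g p = 0"
      by (simp add: cnj_zz fg eval2_ev complex_eq_iff)
    finally show ?thesis .
  qed
  then have "cline \<alpha> v = {p \<in> UNIV. eval2 f p = 0 \<and> eval2 g p = 0}" by auto
  moreover have "real_alg_set UNIV"
    using real_alg_setI[of "{}"] by (simp add: zero_set_def)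
  ultimately show ?thesis using real_alg_set_Int_zeros[of UNIV f g] by (simp only:)
qed

lemma infinite_cline:
  assumes "norm \<alpha> = 1"
  shows "infinite (cline \<alpha> v)"
proof -
  obtain u where u: "u \<noteq> 0" "cnj u = \<alpha> * u" using exists_cnj_eq_mult[OF assms] by blast
  have "inj (\<lambda>t. (Re v + t * Re u, Im v + t * Im u))"
    using u(1) by (auto simp: inj_def complex_eq_iff)
  then show ?thesis
    unfolding cline_param[OF u] using finite_imageD infinite_UNIV_char_0 by blast
qed

lemma cline_ne_UNIV: "norm \<alpha> = 1 \<Longrightarrow> cline \<alpha> v \<noteq> UNIV"
proof
  assume "norm \<alpha> = 1" and U: "cline \<alpha> v = UNIV"
  then obtain u where u: "u \<noteq> 0" "cnj u = \<alpha> * u" using exists_cnj_eq_mult by blast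
  \<comment> \<open>Turning the direction u by a right angle replaces conj u / u by its
    negative.\<close>
  let ?p = "(Re (v + \<i> * u), Im (v + \<i> * u))"
  have "?p \<in> cline \<alpha> v" using U by blast
  moreover have "zz ?p - v = \<i> * u" by (simp add: complex_eq_iff)
  ultimately have "cnj (\<i> * u) = \<alpha> * (\<i> * u)" unfolding cline_def mem_Collect_eq by metis
  then have "- (\<i> * (\<alpha> * u)) = \<i> * (\<alpha> * u)" by (simp add: u(2))
  then have "\<alpha> * u = 0" by simp
  then show False using u by auto
qed

lemma irred_alg_cline:
  assumes "norm \<alpha> = 1"
  shows "irred_alg (cline \<alpha> v)"
proof -
  obtain u where u: "u \<noteq> 0" "cnj u = \<alpha> * u" using exists_cnj_eq_mult[OF assms] by blast
  have "\<not> (\<exists>V1 V2. real_alg_set V1 \<and> real_alg_set V2 \<and> V1 \<subset> cline \<alpha> v \<and> V2 \<subset> cline \<alpha> v \<and> cline \<alpha> v = V1 \<union> V2)"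
  proof
    assume "\<exists>V1 V2. real_alg_set V1 \<and> real_alg_set V2 \<and> V1 \<subset> cline \<alpha> v \<and> V2 \<subset> cline \<alpha> v \<and> cline \<alpha> v = V1 \<union> V2"
    then obtain V1 V2 where V: "real_alg_set V1" "real_alg_set V2" "V1 \<subset> cline \<alpha> v" "V2 \<subset> cline \<alpha> v"
      "cline \<alpha> v = V1 \<union> V2" by blast
    then have "infinite V1 \<or> infinite V2" using infinite_cline[OF assms, of v] by auto
    then show False using subset_cline_eq[OF _ _ _ u] V by (metis psubset_eq)
  qed
  then show ?thesis
    using real_alg_set_cline infinite_cline[OF assms] unfolding irred_alg_def by (metis finite.emptyI)
qed

lemma weakly_bialgebraic_altdef:
  "weakly_bialgebraic L S \<longleftrightarrow> irred_alg S \<and> S \<noteq> UNIV \<and>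
     (\<exists>W. proper_real_alg_set W \<and> wpP L ` (S \<inter> {p. zz p \<notin> L}) \<subseteq> W)"
  unfolding weakly_bialgebraic_def irred_alg_def by blast

lemma weakly_bialgebraic_singleton: "weakly_bialgebraic L {p}"
proof -
  have "irred_alg {p}" unfolding irred_alg_def using real_alg_set_singleton by blast
  moreover have "(fst p + 1, snd p) \<notin> {p}" by (auto simp: prod_eq_iff)
  then have "{p} \<noteq> UNIV" by blast
  moreover have "proper_real_alg_set {wpP L p}"
    unfolding proper_real_alg_set_def
  proof (intro exI conjI)
    let ?F = "{[:[:- fst (wpP L p), 1:]:], [:[:- snd (wpP L p):], 1:]}"
    show "finite ?F" by simp
    show "\<exists>f\<in>?F. f \<noteq> 0" by simp
    show "{wpP L p} = zero_set ?F" by (auto simp: zero_set_def eval2_ev prod_eq_iff)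
  qed
  ultimately show ?thesis unfolding weakly_bialgebraic_altdef by blast
qed

text \<open>On real arguments the real and the imaginary part of the relation hold separately. The
  part kept is one in which the coefficient with index (i0, j0) survives, so that \<open>Q\<close>
  is nonzero.\<close>

lemma real_relation_polynomial:
  fixes c :: "nat \<Rightarrow> nat \<Rightarrow> complex"
  assumes "i0 < n" "j0 < n" "c i0 j0 \<noteq> 0"
  obtains Q :: "real poly poly" where "Q \<noteq> 0"
    "\<And>x y. (\<Sum>i<n. \<Sum>j<n. c i j * (of_real x ^ i * of_real y ^ j)) = 0 \<Longrightarrow> ev Q x y = 0"
proof -
  note witness = that
  have *: thesis if d: "d i0 j0 \<noteq> 0"
    "\<And>x y. (\<Sum>i<n. \<Sum>j<n. c i j * (of_real x ^ i * of_real y ^ j)) = 0 \<Longrightarrow> (\<Sum>i<n. \<Sum>j<n. d i j * (x ^ i * y ^ j)) = 0"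
    for d :: "nat \<Rightarrow> nat \<Rightarrow> real"
  proof -
    define Q where "Q = (\<Sum>j<n. monom (\<Sum>i<n. monom (d i j) i) j)"
    have "coeff (coeff Q j0) i0 = d i0 j0" using assms by (simp add: Q_def coeff_sum)
    then have "Q \<noteq> 0" using d(1) by auto
    moreover have "ev Q x y = (\<Sum>i<n. \<Sum>j<n. d i j * (x ^ i * y ^ j))" for x y
    proof -
      have "ev (monom a j) x y = poly a x * y ^ j" for a j
        by (simp add: ev_def poly_monom)
      then have "ev Q x y = (\<Sum>j<n. \<Sum>i<n. d i j * (x ^ i * y ^ j))"
        by (simp add: Q_def ev_sum poly_sum poly_monom sum_distrib_right mult.assoc)
      then show ?thesis by (subst sum.swap)
    qed
    ultimately show thesis using d(2) by (intro witness[of Q]) simp_all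
  qed
  have Re: "Re (\<Sum>i<n. \<Sum>j<n. c i j * (of_real x ^ i * of_real y ^ j)) = (\<Sum>i<n. \<Sum>j<n. Re (c i j) * (x ^ i * y ^ j))"
    and Im: "Im (\<Sum>i<n. \<Sum>j<n. c i j * (of_real x ^ i * of_real y ^ j)) = (\<Sum>i<n. \<Sum>j<n. Im (c i j) * (x ^ i * y ^ j))" for x y
  proof -
    have eq: "c i j * (of_real x ^ i * of_real y ^ j) = c i j * of_real (x ^ i * y ^ j)" for i j by simp
    have "Re (z * of_real r) = Re z * r" "Im (z * of_real r) = Im z * r" for z r by simp_all
    then show "Re (\<Sum>i<n. \<Sum>j<n. c i j * (of_real x ^ i * of_real y ^ j)) = (\<Sum>i<n. \<Sum>j<n. Re (c i j) * (x ^ i * y ^ j))"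
      "Im (\<Sum>i<n. \<Sum>j<n. c i j * (of_real x ^ i * of_real y ^ j)) = (\<Sum>i<n. \<Sum>j<n. Im (c i j) * (x ^ i * y ^ j))"
      by (simp_all only: eq Re_sum Im_sum)
  qed
  show thesis
  proof (cases "Re (c i0 j0) = 0")
    case False
    show thesis
    proof (rule *[of "\<lambda>i j. Re (c i j)"])
      fix x y assume 0: "(\<Sum>i<n. \<Sum>j<n. c i j * (of_real x ^ i * of_real y ^ j)) = 0"
      show "(\<Sum>i<n. \<Sum>j<n. Re (c i j) * (x ^ i * y ^ j)) = 0" using Re[of x y] unfolding 0 by simp
    qed (rule False)
  next
    case True
    then have nz: "Im (c i0 j0) \<noteq> 0" using assms(3) by (simp add: complex_eq_iff)
    show thesis
    proof (rule *[of "\<lambda>i j. Im (c i j)"])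
      fix x y assume 0: "(\<Sum>i<n. \<Sum>j<n. c i j * (of_real x ^ i * of_real y ^ j)) = 0"
      show "(\<Sum>i<n. \<Sum>j<n. Im (c i j) * (x ^ i * y ^ j)) = 0" using Im[of x y] unfolding 0 by simp
    qed (rule nz)
  qed
qed

text \<open>On the line, conj z is the affine function \<alpha> z + \<beta>, so the conjugate of
  \<open>wp L z\<close> extends to the elliptic function
  \<open>wp L' (\<alpha> * z + \<beta>)\<close> of z. Both it and \<open>wp L\<close> are periodic
  under k L, since k \<alpha> L lies in the conjugate lattice.\<close>

lemma weakly_bialgebraic_cline:
  assumes L: "is_lattice L" and \<alpha>: "norm \<alpha> = 1" and k: "k \<noteq> 0" "of_int k * \<alpha> \<in> Isog L (cnj ` L)"
  shows "weakly_bialgebraic L (cline \<alpha> v)"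
proof -
  define L' where "L' = cnj ` L"
  have L': "is_lattice L'" unfolding L'_def by (rule is_lattice_cnj[OF L])
  define M where "M = (\<lambda>z. of_int k * z) ` L"
  have M: "is_lattice M" unfolding M_def by (rule is_lattice_scale[OF L]) (use k in simp)
  have M_L: "\<omega> \<in> L" "\<alpha> * \<omega> \<in> L'" if \<omega>: "\<omega> \<in> M" for \<omega>
  proof -
    obtain l where l: "l \<in> L" "\<omega> = of_int k * l" using \<omega> by (auto simp: M_def)
    then show "\<omega> \<in> L" using lattice_of_int_mult[OF L] by simp
    have "of_int k * \<alpha> * l \<in> L'" using k(2) l(1) by (auto simp: Isog_def L'_def)
    then show "\<alpha> * \<omega> \<in> L'" by (simp add: l mult_ac)
  qed
  define \<beta> where "\<beta> = cnj v - \<alpha> * v"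
  define f where "f = wp L"
  define g where "g z = wp L' (\<alpha> * z + \<beta>)" for z
  have f: "f meromorphic_on UNIV" unfolding f_def by (rule wp_meromorphic[OF L])
  have g: "g meromorphic_on UNIV"
    unfolding g_def by (rule meromorphic_on_compose[OF wp_meromorphic[OF L'], of _ UNIV]) (auto intro!: analytic_intros)
  have f_per: "f (z + \<omega>) = f z" if "\<omega> \<in> M" for z \<omega>
    unfolding f_def using wp_periodic[OF L M_L(1)[OF that]] .
  have g_per: "g (z + \<omega>) = g z" if "\<omega> \<in> M" for z \<omega>
    unfolding g_def using wp_periodic[OF L' M_L(2)[OF that], of "\<alpha> * z + \<beta>"] by (simp add: algebra_simps)
  \<comment> \<open>\<open>a\<close> and \<open>b\<close> continue the real and the imaginary part
    of \<open>wp L\<close> from the line, so a relation between them is a polynomial equation in the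
    coordinates of \<open>wpP L\<close>.\<close>
  define a where "a z = (f z + g z) / 2" for z
  define b where "b z = (f z - g z) / (2 * \<i>)" for z
  have "\<exists>n c. (\<exists>i<n. \<exists>j<n. c i j \<noteq> 0) \<and>
    (\<forall>z. a analytic_on {z} \<longrightarrow> b analytic_on {z} \<longrightarrow> (\<Sum>i<n. \<Sum>j<n. c i j * (a z ^ i * b z ^ j)) = 0)"
  proof (rule elliptic_functions_alg_dependent[OF M])
    show "a meromorphic_on UNIV" "b meromorphic_on UNIV"
      unfolding a_def b_def using f g by (auto intro!: meromorphic_intros)
  qed (auto simp: a_def b_def f_per g_per)
  then obtain n c i0 j0 where c: "i0 < n" "j0 < n" "c i0 j0 \<noteq> 0"
    "\<And>z. a analytic_on {z} \<Longrightarrow> b analytic_on {z} \<Longrightarrow> (\<Sum>i<n. \<Sum>j<n. c i j * (a z ^ i * b z ^ j)) = 0"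
    by blast
  obtain Q where Q: "Q \<noteq> 0"
    "\<And>x y. (\<Sum>i<n. \<Sum>j<n. c i j * (of_real x ^ i * of_real y ^ j)) = 0 \<Longrightarrow> ev Q x y = 0"
    using real_relation_polynomial[of i0 n j0 c] c(1-3) by blast
  have "eval2 Q (wpP L p) = 0" if p: "p \<in> cline \<alpha> v" "zz p \<notin> L" for p
  proof -
    have cz: "cnj (zz p) = \<alpha> * zz p + \<beta>" using p(1) by (simp add: cline_def \<beta>_def algebra_simps)
    have cL: "cnj (zz p) \<notin> L'" using p(2) unfolding L'_def by (metis complex_cnj_cnj imageE)
    have fa: "f analytic_on {zz p}" unfolding f_def by (rule wp_analytic[OF L p(2)])
    have "wp L' \<circ> (\<lambda>z. \<alpha> * z + \<beta>) analytic_on {zz p}"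
      by (rule analytic_on_compose) (use wp_analytic[OF L' cL] cz in \<open>auto intro!: analytic_intros\<close>)
    then have ga: "g analytic_on {zz p}" by (simp add: g_def[abs_def] o_def)
    have "a analytic_on {zz p}" "b analytic_on {zz p}"
      unfolding a_def b_def using fa ga by (auto intro!: analytic_intros)
    then have 0: "(\<Sum>i<n. \<Sum>j<n. c i j * (a (zz p) ^ i * b (zz p) ^ j)) = 0" by (rule c(4))
    have gz: "g (zz p) = cnj (f (zz p))"
      unfolding g_def f_def cz[symmetric] L'_def by (rule cnj_wp[symmetric])
    have ab: "a (zz p) = of_real (fst (wpP L p))" "b (zz p) = of_real (snd (wpP L p))"
      unfolding a_def b_def gz by (simp_all add: f_def wpP_def complex_eq_iff)
    show ?thesis unfolding eval2_ev using 0 unfolding ab by (rule Q(2))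
  qed
  then have "wpP L ` (cline \<alpha> v \<inter> {p. zz p \<notin> L}) \<subseteq> zero_set {Q}"
    by (auto simp: zero_set_def)
  moreover have "proper_real_alg_set (zero_set {Q})"
    unfolding proper_real_alg_set_def using Q(1) by (intro exI[of _ "{Q}"]) simp
  ultimately show ?thesis
    unfolding weakly_bialgebraic_altdef using irred_alg_cline[OF \<alpha>] cline_ne_UNIV[OF \<alpha>] by blast
qed

text \<open>Separates geometry from arithmetic: it remains to find the unit \<alpha> that have a
  nonzero integer multiple in the isogeny group from L to its conjugate.\<close>

lemma weakly_bialgebraic_iff:
  assumes L: "is_lattice L"
  shows "weakly_bialgebraic L S \<longleftrightarrow> (\<exists>p. S = {p}) \<or>
    (\<exists>\<alpha> v. norm \<alpha> = 1 \<and> (\<exists>k::int. k \<noteq> 0 \<and> of_int k * \<alpha> \<in> Isog L (cnj ` L)) \<and> S = cline \<alpha> v)"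
proof
  assume wb: "weakly_bialgebraic L S"
  then have S: "irred_alg S" "S \<noteq> UNIV"
    and "\<exists>W. proper_real_alg_set W \<and> wpP L ` (S \<inter> {p. zz p \<notin> L}) \<subseteq> W"
    unfolding weakly_bialgebraic_altdef by blast+
  then obtain W where W: "proper_real_alg_set W" "wpP L ` (S \<inter> {p. zz p \<notin> L}) \<subseteq> W" by blast
  show "(\<exists>p. S = {p}) \<or>
    (\<exists>\<alpha> v. norm \<alpha> = 1 \<and> (\<exists>k::int. k \<noteq> 0 \<and> of_int k * \<alpha> \<in> Isog L (cnj ` L)) \<and> S = cline \<alpha> v)"
  proof (cases "finite S")
    case True
    then show ?thesis using irred_alg_finite[OF S(1)] by blast
  next
    case False
    obtain \<alpha> v where \<alpha>: "norm \<alpha> = 1" "S = cline \<alpha> v"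
      "\<forall>l\<in>L. l \<noteq> 0 \<longrightarrow> (\<exists>k::int. k \<noteq> 0 \<and> of_int k * \<alpha> * l \<in> cnj ` L)"
      using infinite_bialgebraic_is_cline[OF L S False W] by blast
    obtain w1 w2 where w: "w1 \<noteq> 0" "Im (w2 / w1) \<noteq> 0" "L = lattice_gen w1 w2"
      using L by (auto simp: is_lattice_def)
    have "w2 \<noteq> 0" using w(2) by auto
    have "w1 \<in> L" unfolding w lattice_gen_def by (rule CollectI, rule exI[of _ 1], rule exI[of _ 0]) simp
    moreover have "w2 \<in> L" unfolding w lattice_gen_def by (rule CollectI, rule exI[of _ 0], rule exI[of _ 1]) simp
    ultimately obtain k1 k2 :: int where k: "k1 \<noteq> 0" "of_int k1 * \<alpha> * w1 \<in> cnj ` L"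
      "k2 \<noteq> 0" "of_int k2 * \<alpha> * w2 \<in> cnj ` L"
      using \<alpha>(3) w(1) \<open>w2 \<noteq> 0\<close> by meson
    \<comment> \<open>The multipliers obtained for the two generators may differ; their product
      works for both, hence for all of \<open>L\<close>.\<close>
    have "of_int (k1 * k2) * \<alpha> * l \<in> cnj ` L" if lL: "l \<in> L" for l
    proof -
      obtain m n where l: "l = of_int m * w1 + of_int n * w2" using lL by (auto simp: w lattice_gen_def)
      have "of_int (k1 * k2) * \<alpha> * l = of_int (m * k2) * (of_int k1 * \<alpha> * w1) + of_int (n * k1) * (of_int k2 * \<alpha> * w2)"
        by (simp add: l algebra_simps)
      then show ?thesis
        using k is_lattice_cnj[OF L] lattice_add lattice_of_int_mult by metis
    qed
    then have "of_int (k1 * k2) * \<alpha> \<in> Isog L (cnj ` L)" by (auto simp: Isog_def)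
    moreover have "k1 * k2 \<noteq> 0" using k by simp
    ultimately show ?thesis using \<alpha>(1,2) by blast
  qed
next
  assume "(\<exists>p. S = {p}) \<or>
    (\<exists>\<alpha> v. norm \<alpha> = 1 \<and> (\<exists>k::int. k \<noteq> 0 \<and> of_int k * \<alpha> \<in> Isog L (cnj ` L)) \<and> S = cline \<alpha> v)"
  then show "weakly_bialgebraic L S"
    using weakly_bialgebraic_singleton weakly_bialgebraic_cline[OF L] by blast
qed

section \<open>The cases of the theorem\<close>

lemma translate_cline: "translate p (cline \<alpha> 0) = cline \<alpha> (zz p)"
proof -
  have *: "zz q - zz p = zz (fst q - fst p, snd q - snd p)" for q by (simp add: complex_eq_iff)
  show ?thesis
  proof (intro equalityI subsetI)
    fix q assume "q \<in> translate p (cline \<alpha> 0)"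
    then obtain s where s: "s \<in> cline \<alpha> 0" "q = (fst s + fst p, snd s + snd p)"
      by (auto simp: translate_def)
    have "zz q - zz p = zz s" using s(2) by (simp add: complex_eq_iff)
    then show "q \<in> cline \<alpha> (zz p)" using s(1) unfolding cline_def mem_Collect_eq by (simp only: diff_zero)
  next
    fix q assume "q \<in> cline \<alpha> (zz p)"
    then have "(fst q - fst p, snd q - snd p) \<in> cline \<alpha> 0"
      unfolding cline_def mem_Collect_eq * by simp
    moreover have "q = (fst (fst q - fst p, snd q - snd p) + fst p, snd (fst q - fst p, snd q - snd p) + snd p)"
      by simp
    ultimately show "q \<in> translate p (cline \<alpha> 0)" unfolding translate_def by (rule rev_image_eqI)
  qed
qed

lemma cline_eq_translate: "cline \<alpha> v = translate (Re v, Im v) (cline \<alpha> 0)"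
  by (simp add: translate_cline)

text \<open>If s is a square root of g, then s z is real iff conj z = (s / conj s) z, and s / conj s
  = g / |g|; for imaginary s z the sign changes. The quotient is the same for s and -s, so these are
  the lines of either square root.\<close>

lemma line1_eq: "g \<noteq> 0 \<Longrightarrow> line1 g = cline (g / of_real (norm g)) 0"
  and line2_eq: "g \<noteq> 0 \<Longrightarrow> line2 g = cline (- g / of_real (norm g)) 0"
proof -
  assume g: "g \<noteq> 0"
  define s where "s = csqrt g"
  have s: "s \<noteq> 0" "g = s * s" using g by (auto simp: s_def simp flip: power2_eq_square)
  have ng: "of_real (norm g) = s * cnj s"
    using complex_norm_square[of s] by (simp add: s(2) norm_mult power2_eq_square)
  have q: "g / of_real (norm g) = s / cnj s" unfolding ng by (subst s(2)) (simp add: s(1))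
  have 1: "s * z \<in> \<real> \<longleftrightarrow> cnj z = (g / of_real (norm g)) * z" for z
  proof -
    have "s * z \<in> \<real> \<longleftrightarrow> cnj (s * z) = s * z" by (simp only: Reals_cnj_iff)
    also have "\<dots> \<longleftrightarrow> cnj z = s / cnj s * z" using s(1) by (auto simp: field_simps)
    finally show ?thesis by (simp only: q)
  qed
  show "line1 g = cline (g / of_real (norm g)) 0"
    unfolding line1_def cline_def s_def[symmetric] 1 by simp
  have 2: "s * z \<in> range (\<lambda>t. \<i> * of_real t) \<longleftrightarrow> cnj z = (- g / of_real (norm g)) * z" for z
  proof -
    have "s * z \<in> range (\<lambda>t. \<i> * of_real t) \<longleftrightarrow> cnj (s * z) = - (s * z)"
    proof
      assume "cnj (s * z) = - (s * z)"
      then have "s * z = \<i> * of_real (Im (s * z))" by (simp add: complex_eq_iff)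
      then show "s * z \<in> range (\<lambda>t. \<i> * of_real t)" by blast
    next
      assume "s * z \<in> range (\<lambda>t. \<i> * of_real t)"
      then obtain t where t: "s * z = \<i> * of_real t" by blast
      show "cnj (s * z) = - (s * z)" unfolding t by simp
    qed
    also have "\<dots> \<longleftrightarrow> cnj z = - (s / cnj s) * z" using s(1) by (auto simp: field_simps)
    finally show ?thesis using q by simp
  qed
  show "line2 g = cline (- g / of_real (norm g)) 0"
    unfolding line2_def cline_def s_def[symmetric] 2 by simp
qed

lemma line_through_eq: "w \<noteq> 0 \<Longrightarrow> line_through w = cline (cnj w / w) 0"
  by (subst cline_param[of w]) (auto simp: line_through_def)

section \<open>Unit directions with a multiple in the isogeny group\<close>

lemma Isog_multiple_eq_0:
  assumes "\<not> isogenous L M" "k \<noteq> 0" "of_int k * \<alpha> \<in> Isog L M"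
  shows "\<alpha> = 0"
  using assms by (auto simp: isogenous_def)

text \<open>From k \<alpha> = n g and |\<alpha>| = 1 comes |g| = |k| / |n|, and \<alpha>, a real
  multiple of g, is plus or minus g / |g|. Conversely |g| = a / b gives a (g / |g|) = b g.\<close>

lemma unit_direction_cyclic_Isog:
  assumes I: "Isog L M = range (\<lambda>n::int. of_int n * g)" and "isogenous L M"
  shows "norm \<alpha> = 1 \<and> (\<exists>k::int. k \<noteq> 0 \<and> of_int k * \<alpha> \<in> Isog L M) \<longleftrightarrow>
    norm g \<in> \<rat> \<and> (\<alpha> = g / of_real (norm g) \<or> \<alpha> = - g / of_real (norm g))"
proof -
  have g: "g \<noteq> 0"
  proof
    assume "g = 0"
    then have "Isog L M = {0}" unfolding I by auto
    then show False using assms(2) by (simp add: isogenous_def)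
  qed
  show ?thesis
  proof
    assume "norm \<alpha> = 1 \<and> (\<exists>k::int. k \<noteq> 0 \<and> of_int k * \<alpha> \<in> Isog L M)"
    then obtain k n :: int where k: "norm \<alpha> = 1" "k \<noteq> 0" "of_int k * \<alpha> = of_int n * g"
      unfolding I by auto
    have "norm (of_int k * \<alpha>) = norm (of_int n * g)" unfolding k(3) ..
    then have kn: "\<bar>of_int k\<bar> = \<bar>of_int n\<bar> * norm g" using k(1) by (simp add: norm_mult)
    then have n: "n \<noteq> 0" using k(2) by auto
    have ng: "norm g = \<bar>of_int k\<bar> / \<bar>of_int n\<bar>" using kn n by (simp add: field_simps)
    have "\<alpha> = of_int n * g / of_int k" using k(2,3) by (simp add: field_simps)
    also have "\<dots> = of_real (of_int n / of_int k) * g" by simp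
    finally have \<alpha>: "\<alpha> = of_real (of_int n / of_int k) * g" .
    have "\<bar>of_int n / of_int k\<bar> = 1 / norm g" unfolding ng by (simp add: abs_divide)
    then have "of_int n / of_int k = 1 / norm g \<or> of_int n / of_int k = - (1 / norm g)" by linarith
    then have "\<alpha> = g / of_real (norm g) \<or> \<alpha> = - g / of_real (norm g)"
    proof
      assume "of_int n / of_int k = 1 / norm g"
      then show ?thesis unfolding \<alpha> by simp
    next
      assume "of_int n / of_int k = - (1 / norm g)"
      then show ?thesis unfolding \<alpha> by simp
    qed
    moreover have "norm g \<in> \<rat>" unfolding ng by simp
    ultimately show "norm g \<in> \<rat> \<and> (\<alpha> = g / of_real (norm g) \<or> \<alpha> = - g / of_real (norm g))" by blast
  next
    assume rhs: "norm g \<in> \<rat> \<and> (\<alpha> = g / of_real (norm g) \<or> \<alpha> = - g / of_real (norm g))"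
    then obtain a b :: int where ab: "b \<noteq> 0" "norm g = of_int a / of_int b"
      by (metis Rats_cases' less_numeral_extra(3))
    have a: "a \<noteq> 0" using ab g by auto
    have ba: "complex_of_real (norm g) * of_int b = of_int a" using ab by simp
    then have "of_int a * (g / of_real (norm g)) = of_int b * g"
      using g by (simp flip: ba)
    then have "of_int a * \<alpha> = of_int b * g \<or> of_int a * \<alpha> = of_int (- b) * g"
      using rhs by auto
    then have "of_int a * \<alpha> \<in> Isog L M" unfolding I by blast
    moreover have "norm \<alpha> = 1" using rhs g by (auto simp: norm_divide)
    ultimately show "norm \<alpha> = 1 \<and> (\<exists>k::int. k \<noteq> 0 \<and> of_int k * \<alpha> \<in> Isog L M)" using a by blast
  qed
qed

text \<open>Sending u to conj (\<alpha> u) is the reflection in the line conj u = \<alpha> u. So l +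
  conj (\<alpha> l) is twice the projection of l to that line, and its k-fold multiple lies in L. It
  cannot vanish for both generators: they would both be perpendicular to the line, and w2 / w1 would
  be real.\<close>

lemma unit_direction_contains_lattice_point:
  assumes L: "is_lattice L" and \<alpha>: "norm \<alpha> = 1" and k: "k \<noteq> 0" "of_int k * \<alpha> \<in> Isog L (cnj ` L)"
  obtains w where "w \<in> L" "w \<noteq> 0" "\<alpha> = cnj w / w"
proof -
  obtain w1 w2 where w: "w1 \<noteq> 0" "Im (w2 / w1) \<noteq> 0" "L = lattice_gen w1 w2"
    using L by (auto simp: is_lattice_def)
  have w1: "w1 \<in> L" unfolding w lattice_gen_def by (rule CollectI, rule exI[of _ 1], rule exI[of _ 0]) simp
  have w2: "w2 \<in> L" unfolding w lattice_gen_def by (rule CollectI, rule exI[of _ 0], rule exI[of _ 1]) simp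
  define s where "s l = of_int k * l + cnj (of_int k * \<alpha> * l)" for l
  have unit: "\<alpha> * cnj \<alpha> = 1" using \<alpha> by (simp flip: complex_norm_square)
  have sL: "s l \<in> L" if "l \<in> L" for l
  proof -
    have "of_int k * \<alpha> * l \<in> cnj ` L" using k(2) that by (auto simp: Isog_def)
    then have "cnj (of_int k * \<alpha> * l) \<in> L" by (metis complex_cnj_cnj imageE)
    then show ?thesis unfolding s_def using lattice_add[OF L] lattice_of_int_mult[OF L that] by blast
  qed
  have cs: "cnj (s l) = \<alpha> * s l" for l
  proof -
    have "\<alpha> * s l = of_int k * (\<alpha> * l) + of_int k * (\<alpha> * cnj \<alpha>) * cnj l"
      by (simp add: s_def algebra_simps)
    then show ?thesis by (simp add: unit s_def)
  qed
  have "s w1 \<noteq> 0 \<or> s w2 \<noteq> 0"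
  proof (rule ccontr)
    assume "\<not> ?thesis"
    then have "of_int k * w1 = of_int k * (- cnj \<alpha> * cnj w1)" "of_int k * w2 = of_int k * (- cnj \<alpha> * cnj w2)"
      by (auto simp: s_def eq_neg_iff_add_eq_0 mult.assoc)
    then have e: "w1 = - cnj \<alpha> * cnj w1" "w2 = - cnj \<alpha> * cnj w2" using k(1) by (metis mult_left_cancel of_int_eq_0_iff)+
    have "cnj \<alpha> \<noteq> 0" using unit by auto
    then have "(- cnj \<alpha> * cnj w2) / (- cnj \<alpha> * cnj w1) = cnj (w2 / w1)" by simp
    moreover have "w2 / w1 = (- cnj \<alpha> * cnj w2) / (- cnj \<alpha> * cnj w1)" by (rule arg_cong2[OF e(2,1)])
    ultimately have "Im (w2 / w1) = Im (cnj (w2 / w1))" by (simp only:)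
    then have "Im (w2 / w1) = 0" unfolding cnj.sel by linarith
    then show False using w(2) by contradiction
  qed
  then obtain l where "l \<in> L" "s l \<noteq> 0" using w1 w2 by blast
  then show ?thesis using that[OF sL] cs[of l] by (simp add: field_simps)
qed

text \<open>A non-real multiplier is a root of the characteristic polynomial of its integer matrix,
  so its trace 2 Re r is an integer and conj r is that integer minus r.\<close>

lemma Isog_self_cnj:
  assumes L: "is_lattice L" and r: "r \<in> Isog L L"
  shows "cnj r \<in> Isog L L"
proof (cases "Im r = 0")
  case True
  then have "cnj r = r" by (simp add: complex_eq_iff)
  then show ?thesis using r by simp
next
  case False
  obtain w1 w2 where w: "w1 \<noteq> 0" "Im (w2 / w1) \<noteq> 0" "L = lattice_gen w1 w2"
    using L by (auto simp: is_lattice_def)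
  have w20: "w2 \<noteq> 0" using w(2) by auto
  have w1: "w1 \<in> L" unfolding w lattice_gen_def by (rule CollectI, rule exI[of _ 1], rule exI[of _ 0]) simp
  have w2: "w2 \<in> L" unfolding w lattice_gen_def by (rule CollectI, rule exI[of _ 0], rule exI[of _ 1]) simp
  have "r * w1 \<in> L" "r * w2 \<in> L" using r w1 w2 by (auto simp: Isog_def)
  then obtain a b c d :: int where abcd: "r * w1 = of_int a * w1 + of_int b * w2" "r * w2 = of_int c * w1 + of_int d * w2"
    unfolding w lattice_gen_def by auto
  have "((r - of_int a) * w1) * ((r - of_int d) * w2) = (of_int b * w2) * (of_int c * w1)"
    by (simp add: abcd left_diff_distrib)
  then have "((r - of_int a) * (r - of_int d)) * (w1 * w2) = (of_int b * of_int c) * (w1 * w2)"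
    by (simp add: mult_ac)
  then have "(r - of_int a) * (r - of_int d) = of_int b * of_int c"
    using w(1) w20 by (metis mult_right_cancel mult_eq_0_iff)
  then have "Im ((r - of_int a) * (r - of_int d)) = 0" by simp
  then have "Im r * (2 * Re r - of_int (a + d)) = 0" by (simp add: algebra_simps)
  then have "2 * Re r = of_int (a + d)" using False by simp
  then have cr: "cnj r = of_int (a + d) - r" by (simp add: complex_eq_iff)
  have "cnj r * x \<in> L" if "x \<in> L" for x
  proof -
    have "r * x \<in> L" using r that by (auto simp: Isog_def)
    then show ?thesis unfolding cr left_diff_distrib
      using lattice_diff[OF L] lattice_of_int_mult[OF L that] by blast
  qed
  then show ?thesis by (auto simp: Isog_def)
qed

text \<open>For independent multipliers a and b, the points a w and b w span a sublattice of index
  |D|, so every x in L satisfies D x = t w with a multiplier t. Then D (conj w / w) x = t conj w is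
  the conjugate of (conj t) w, and conj t is again a multiplier by
  \<open>Isog_self_cnj\<close>.\<close>

lemma CM_lattice_point_direction:
  assumes L: "is_lattice L" and CM: "is_CM L" and w: "w \<in> L" "w \<noteq> 0"
  shows "\<exists>k::int. k \<noteq> 0 \<and> of_int k * (cnj w / w) \<in> Isog L (cnj ` L)"
proof -
  obtain a b where ab: "a \<in> Isog L L" "b \<in> Isog L L"
    "\<And>m n :: int. of_int m * a + of_int n * b = 0 \<Longrightarrow> m = 0 \<and> n = 0"
    using CM unfolding is_CM_def by blast
  obtain w1 w2 where L': "L = lattice_gen w1 w2" using L by (auto simp: is_lattice_def)
  have "a * w \<in> L" "b * w \<in> L" using ab(1,2) w by (auto simp: Isog_def)
  then obtain p q r s :: int where m: "a * w = of_int p * w1 + of_int q * w2" "b * w = of_int r * w1 + of_int s * w2"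
    unfolding L' lattice_gen_def by auto
  define D where "D = p * s - q * r"
  \<comment> \<open>Cramer's rule, expressing D w1 and then D w2 through a w and b w.\<close>
  have r1: "(of_int s * a + of_int (- q) * b) * w = of_int D * w1"
  proof -
    have "(of_int s * a + of_int (- q) * b) * w = of_int s * (a * w) - of_int q * (b * w)" by (simp add: algebra_simps)
    also have "\<dots> = of_int D * w1" unfolding m by (simp add: D_def algebra_simps)
    finally show ?thesis .
  qed
  have r2: "(of_int (- r) * a + of_int p * b) * w = of_int D * w2"
  proof -
    have "(of_int (- r) * a + of_int p * b) * w = of_int p * (b * w) - of_int r * (a * w)" by (simp add: algebra_simps)
    also have "\<dots> = of_int D * w2" unfolding m by (simp add: D_def algebra_simps)
    finally show ?thesis .
  qed
  \<comment> \<open>If D = 0, independence of a and b makes all four matrix entries 0, and then a w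
    = 0.\<close>
  have "D \<noteq> 0"
  proof
    assume "D = 0"
    then have "of_int s * a + of_int (- q) * b = 0" "of_int (- r) * a + of_int p * b = 0"
      using r1 r2 w(2) by auto
    then have "s = 0 \<and> - q = 0" "- r = 0 \<and> p = 0" using ab(3) by blast+
    then have "a = 0" using m(1) w(2) by simp
    then show False using ab(3)[of 1 0] by simp
  qed
  moreover have "of_int D * (cnj w / w) * x \<in> cnj ` L" if x: "x \<in> L" for x
  proof -
    obtain i j :: int where x': "x = of_int i * w1 + of_int j * w2" using x unfolding L' lattice_gen_def by auto
    define t where "t = of_int i * (of_int s * a + of_int (- q) * b) + of_int j * (of_int (- r) * a + of_int p * b)"
    have "t * w = of_int i * ((of_int s * a + of_int (- q) * b) * w) + of_int j * ((of_int (- r) * a + of_int p * b) * w)"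
      by (simp add: t_def distrib_right mult.assoc)
    also have "\<dots> = of_int D * x" unfolding r1 r2 x' by (simp add: algebra_simps)
    finally have tw: "t * w = of_int D * x" .
    have "t \<in> Isog L L"
    proof -
      have t': "t = of_int (i * s - j * r) * a + of_int (j * p - i * q) * b"
        by (simp add: t_def algebra_simps)
      have "t * y \<in> L" if "y \<in> L" for y
      proof -
        have "a * y \<in> L" "b * y \<in> L" using ab(1,2) that by (auto simp: Isog_def)
        then show ?thesis unfolding t' distrib_right mult.assoc
          using lattice_add[OF L] lattice_of_int_mult[OF L] by blast
      qed
      then show ?thesis by (auto simp: Isog_def)
    qed
    then have "cnj t * w \<in> L" using Isog_self_cnj[OF L] w(1) by (auto simp: Isog_def)
    moreover have "of_int D * (cnj w / w) * x = cnj (cnj t * w)"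
    proof -
      have "of_int D * (cnj w / w) * x = (t * w) * (cnj w / w)" unfolding tw by simp
      then show ?thesis using w(2) by simp
    qed
    ultimately show ?thesis by blast
  qed
  ultimately show ?thesis by (intro exI[of _ D]) (auto simp: Isog_def)
qed

theorem theorem2p1p3:
  fixes L :: "complex set"
  assumes "is_lattice L"
  shows
    "(\<not> isogenous L (cnj ` L) \<longrightarrow>
        (\<forall>S. weakly_bialgebraic L S \<longleftrightarrow> (\<exists>p. S = {p})))
   \<and> (\<not> is_CM L \<and> isogenous L (cnj ` L) \<longrightarrow>
        (\<forall>g. Isog L (cnj ` L) = range (\<lambda>n::int. of_int n * g) \<longrightarrow>
           (cmod g \<notin> \<rat> \<longrightarrow> (\<forall>S. weakly_bialgebraic L S \<longleftrightarrow> (\<exists>p. S = {p})))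
         \<and> (cmod g \<in> \<rat> \<longrightarrow> (\<forall>S. weakly_bialgebraic L S \<longleftrightarrow>
              (\<exists>p. S = {p}) \<or> (\<exists>v. S = translate v (line1 g) \<or> S = translate v (line2 g))))))
   \<and> (is_CM L \<longrightarrow>
        (\<forall>S. weakly_bialgebraic L S \<longleftrightarrow>
           (\<exists>p. S = {p}) \<or> (\<exists>v w. w \<in> L \<and> w \<noteq> 0 \<and> S = translate v (line_through w))))"
proof (intro conjI impI allI)
  fix S
  assume "\<not> isogenous L (cnj ` L)"
  have "\<not> (\<exists>\<alpha>. norm \<alpha> = 1 \<and> (\<exists>k::int. k \<noteq> 0 \<and> of_int k * \<alpha> \<in> Isog L (cnj ` L)))"
  proof (intro notI; elim exE conjE)
    fix \<alpha> :: complex and k :: int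
    assume "norm \<alpha> = 1" "k \<noteq> 0" "of_int k * \<alpha> \<in> Isog L (cnj ` L)"
    then show False using Isog_multiple_eq_0[OF \<open>\<not> isogenous L (cnj ` L)\<close>, of k \<alpha>] by simp
  qed
  then show "weakly_bialgebraic L S \<longleftrightarrow> (\<exists>p. S = {p})"
    unfolding weakly_bialgebraic_iff[OF assms] by blast
next
  fix g S
  assume "\<not> is_CM L \<and> isogenous L (cnj ` L)" and I: "Isog L (cnj ` L) = range (\<lambda>n::int. of_int n * g)"
  then have iso: "isogenous L (cnj ` L)" by blast
  have g: "g \<noteq> 0"
  proof
    assume "g = 0"
    then have "Isog L (cnj ` L) = {0}" unfolding I by auto
    then show False using iso by (simp add: isogenous_def)
  qed
  note dir = unit_direction_cyclic_Isog[OF I iso]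
  show "weakly_bialgebraic L S \<longleftrightarrow> (\<exists>p. S = {p})" if "cmod g \<notin> \<rat>"
  proof -
    have "\<not> (norm \<alpha> = 1 \<and> (\<exists>k::int. k \<noteq> 0 \<and> of_int k * \<alpha> \<in> Isog L (cnj ` L)))" for \<alpha>
      unfolding dir using that by blast
    then show ?thesis unfolding weakly_bialgebraic_iff[OF assms] by blast
  qed
  show "weakly_bialgebraic L S \<longleftrightarrow>
      (\<exists>p. S = {p}) \<or> (\<exists>v. S = translate v (line1 g) \<or> S = translate v (line2 g))" if rat: "cmod g \<in> \<rat>"
  proof -
    have "(\<exists>\<alpha> v. norm \<alpha> = 1 \<and> (\<exists>k::int. k \<noteq> 0 \<and> of_int k * \<alpha> \<in> Isog L (cnj ` L)) \<and> S = cline \<alpha> v) \<longleftrightarrow>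
       (\<exists>\<alpha> v. (\<alpha> = g / of_real (norm g) \<or> \<alpha> = - g / of_real (norm g)) \<and> S = cline \<alpha> v)"
      unfolding conj_assoc[symmetric] dir using rat by simp
    also have "\<dots> \<longleftrightarrow> (\<exists>v. S = cline (g / of_real (norm g)) v \<or> S = cline (- g / of_real (norm g)) v)" by blast
    also have "\<dots> \<longleftrightarrow> (\<exists>v. S = translate v (line1 g) \<or> S = translate v (line2 g))"
      unfolding line1_eq[OF g] line2_eq[OF g]
    proof
      assume "\<exists>v. S = cline (g / of_real (norm g)) v \<or> S = cline (- g / of_real (norm g)) v"
      then obtain v where "S = cline (g / of_real (norm g)) v \<or> S = cline (- g / of_real (norm g)) v" ..
      then show "\<exists>v. S = translate v (cline (g / of_real (norm g)) 0) \<or> S = translate v (cline (- g / of_real (norm g)) 0)"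
        unfolding cline_eq_translate[of _ v] by (rule exI)
    next
      assume "\<exists>v. S = translate v (cline (g / of_real (norm g)) 0) \<or> S = translate v (cline (- g / of_real (norm g)) 0)"
      then show "\<exists>v. S = cline (g / of_real (norm g)) v \<or> S = cline (- g / of_real (norm g)) v"
        unfolding translate_cline by blast
    qed
    finally show ?thesis unfolding weakly_bialgebraic_iff[OF assms] by (rule arg_cong)
  qed
next
  fix S
  assume CM: "is_CM L"
  have "(\<exists>\<alpha> v. norm \<alpha> = 1 \<and> (\<exists>k::int. k \<noteq> 0 \<and> of_int k * \<alpha> \<in> Isog L (cnj ` L)) \<and> S = cline \<alpha> v) \<longleftrightarrow>
      (\<exists>v w. w \<in> L \<and> w \<noteq> 0 \<and> S = translate v (line_through w))"
  proof (intro iffI; elim exE conjE)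
    fix \<alpha> v and k :: int
    assume \<alpha>: "norm \<alpha> = 1" "k \<noteq> 0" "of_int k * \<alpha> \<in> Isog L (cnj ` L)" and S: "S = cline \<alpha> v"
    obtain w where w: "w \<in> L" "w \<noteq> 0" "\<alpha> = cnj w / w"
      by (rule unit_direction_contains_lattice_point[OF assms \<alpha>])
    have "S = translate (Re v, Im v) (line_through w)"
      unfolding line_through_eq[OF w(2)] S w(3) by (rule cline_eq_translate)
    then show "\<exists>v w. w \<in> L \<and> w \<noteq> 0 \<and> S = translate v (line_through w)" using w by blast
  next
    fix v w assume w: "w \<in> L" "w \<noteq> 0" and S: "S = translate v (line_through w)"
    have "S = cline (cnj w / w) (zz v)"
      unfolding S line_through_eq[OF w(2)] by (rule translate_cline)
    moreover have "norm (cnj w / w) = 1" using w(2) by (simp add: norm_divide)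
    moreover have "\<exists>k::int. k \<noteq> 0 \<and> of_int k * (cnj w / w) \<in> Isog L (cnj ` L)"
      by (rule CM_lattice_point_direction[OF assms CM w])
    ultimately show "\<exists>\<alpha> v. norm \<alpha> = 1 \<and> (\<exists>k::int. k \<noteq> 0 \<and> of_int k * \<alpha> \<in> Isog L (cnj ` L)) \<and> S = cline \<alpha> v"
      by blast
  qed
  then show "weakly_bialgebraic L S \<longleftrightarrow>
      (\<exists>p. S = {p}) \<or> (\<exists>v w. w \<in> L \<and> w \<noteq> 0 \<and> S = translate v (line_through w))"
    unfolding weakly_bialgebraic_iff[OF assms] by (rule arg_cong)
qed

end
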